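(* Let $\{\widetilde{\mathbf p}_n\}_{n=0}^\infty$ be a sequence with $\widetilde{\mathbf p}_n\in\mathrm{Sym}(W^{\mathrm{gr}})^{r_n}$ a column vector of length $r_n$ and $\widetilde{\mathbf p}_0=1$. The following are equivalent. (1) There exists a determinate measure $\mu\in\mathcal M(\widehat W)$ with compact support such that $\{\widetilde{\mathbf p}_n\}$ is orthonormal with respect to $\mu$. (2) For $n\in\mathbb N_0$, $m\in[n]$, $i\in[N_m]$ and $0\le k\le m$, there exist matrices $M^k_{n,m,i}\in\mathrm{Mat}(r_{n-m},r_{n-m+k})$ such that (a) $w_{m,i}\,\widetilde{\mathbf p}_{n-m}=\sum_{k=0}^{m}M^k_{n,m,i}\,\widetilde{\mathbf p}_{n-m+k}+\sum_{k=1}^{m}(M^k_{n-k,m,i})^{\intercal}\,\widetilde{\mathbf p}_{n-m-k}$ for all such $n,m,i$; (b) with $A_{n,m,i}:=M^m_{n,m,i}$ and $C_{n,m,i}:=A_{n,m,i}^{\intercal}$, for every $n\in\mathbb N$, $m\in[n]$, $i\in[N_m]$ one has $\mathrm{rank}(A_{n,m,i})=\mathrm{rank}(C_{n,m,i})=r_{n-m}$ and $\mathrm{rank}(A_n)=\mathrm{rank}(C_n^{\intercal})=r_n$, where $A_n$ (resp. $C_n^{\intercal}$) stacks vertically all $A_{n,m,i}$ (resp. $C_{n,m,i}^{\intercal}$), $m\in[n]$, $i\in[N_m]$; and in addition, for every $m\ge1$ and $i\in[N_m]$, $\sup_{n}\|M^k_{n,m,i}\|_2<\infty$ for all integers $k\in[-m,m]$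 (the supremum being over all $n$ for which the matrix is defined), where $M^{-k}_{n,m,i}:=(M^k_{n-k,m,i})^{\intercal}$ for $1\le k\le m$.
   Context: $W=\bigoplus_{m\ge1}W^m$ is a graded real vector space with every $W^m$ finite-dimensional, $N_m=\dim W^m$, with basis of $W^m$ and dual basis $w_{m,1},\dots,w_{m,N_m}$ of $(W^m)^*$; $W^{\mathrm{gr}}=\bigoplus_m(W^m)^*$. $\mathrm{Sym}(W^{\mathrm{gr}})$ is the commutative real polynomial algebra in the $w_{m,i}$; total degree of $\prod w_{m,i}^{\alpha_{m,i}}$ is $\sum m\,\alpha_{m,i}$; $r_n$ is the number of monomials of total degree $n$ and $\mathbf w_n$ the column vector of these. $[n]=\{1,\dots,n\}$; terms with negative degree index are absent ($r_j=0$, $\widetilde{\mathbf p}_j=0$ for $j<0$). $\mathrm{Mat}(a,b)$ denotes real $a\times b$ matrices, $\|\cdot\|_2$ the spectral (operator) norm. $\widehat W=\prod_mW^m$ with the product topology; elements of $\mathrm{Sym}(W^{\mathrm{gr}})$ are polynomial functions on $\widehat W$. $\mathcal M(\widehat W)$ is the set of Borel probability measures on $\widehat W$ (with all moments $\int P\,d\mu$, $P\in\mathrm{Sym}(W^{\mathrm{gr}})$, finite). Such $\mu$ is determinate if it is the only measure in $\mathcal M(\widehat W)$ with its moments. For $\mu$ put $(P,Q)=\int_{\widehat W}PQ\,d\mu$; the sequence is orthonormal with respect to $\mu$ if the entries of $\widetilde{\mathbf p}_n$ have total degree at most $n$, $(\mathbf w_m,\widetilde{\mathbf p}_n^{\intercal})=0$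 for $m<n$, $(\mathbf w_n,\widetilde{\mathbf p}_n^{\intercal})$ is invertible and $(\widetilde{\mathbf p}_n,\widetilde{\mathbf p}_n^{\intercal})$ is the identity matrix, where $(\mathbf p,\mathbf q^{\intercal})$ is the matrix of entrywise values. *)

theory Defs
  imports
    "HOL-Probability.Probability_Measure"
    "HOL-Analysis.Abstract_Topology"
    "HOL-Analysis.Function_Topology"
    "HOL-Library.Poly_Mapping"
    "Jordan_Normal_Form.Matrix"
    "Jordan_Normal_Form.DL_Rank"
begin

text \<open>The graded space \<open>W\<close> is the whole type \<open>'v\<close>, presented as the (internal) direct sum of the
  finite-dimensional subspaces \<open>W m\<close>, \<open>m \<ge> 1\<close>; the value \<open>W 0\<close> is never used.\<close>

definition graded_space :: "(nat \<Rightarrow> 'v::real_vector set) \<Rightarrow> bool" where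
  "graded_space W \<longleftrightarrow>
     (\<forall>m\<ge>1. Real_Vector_Spaces.subspace (W m) \<and> (\<exists>B. finite B \<and> span B = W m)) \<and>
     span (\<Union>m\<in>{1..}. W m) = UNIV \<and>
     (\<forall>F x. finite F \<and> F \<subseteq> {1..} \<and> (\<forall>m\<in>F. x m \<in> W m) \<and> (\<Sum>m\<in>F. x m) = 0
        \<longrightarrow> (\<forall>m\<in>F. x m = 0))"

definition graded_basis ::
    "(nat \<Rightarrow> 'v::real_vector set) \<Rightarrow> (nat \<Rightarrow> nat) \<Rightarrow> (nat \<Rightarrow> nat \<Rightarrow> 'v) \<Rightarrow> bool" where
  "graded_basis W N e \<longleftrightarrow>
     (\<forall>m\<ge>1. N m = dim (W m) \<and> inj_on (e m) {1..N m} \<and>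
        independent (e m ` {1..N m}) \<and> span (e m ` {1..N m}) = W m)"

text \<open>The dual basis element \<open>w\<^sub>m\<^sub>,\<^sub>i\<close>, evaluated at a vector of \<open>W m\<close>.\<close>

definition dual_basis ::
    "(nat \<Rightarrow> nat) \<Rightarrow> (nat \<Rightarrow> nat \<Rightarrow> 'v::real_vector) \<Rightarrow> nat \<Rightarrow> nat \<Rightarrow> 'v \<Rightarrow> real" where
  "dual_basis N e m i v = representation (e m ` {1..N m}) v (e m i)"

text \<open>The canonical topology of a finite-dimensional space is transported from \<open>\<real>\<^bsup>N m\<^esup>\<close> along the
  coordinate isomorphism. Points of the product are extensional functions, i.e. \<open>undefined\<close> at 0.\<close>

definition component_topology ::
    "(nat \<Rightarrow> 'v::real_vector set) \<Rightarrow> (nat \<Rightarrow> nat) \<Rightarrow> (nat \<Rightarrow> nat \<Rightarrow> 'v) \<Rightarrow> nat \<Rightarrow> 'v topology" where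
  "component_topology W N e m =
     pullback_topology (W m) (\<lambda>v. \<lambda>i\<in>{1..N m}. dual_basis N e m i v)
       (product_topology (\<lambda>_. euclideanreal) {1..N m})"

definition What ::
    "(nat \<Rightarrow> 'v::real_vector set) \<Rightarrow> (nat \<Rightarrow> nat) \<Rightarrow> (nat \<Rightarrow> nat \<Rightarrow> 'v) \<Rightarrow> (nat \<Rightarrow> 'v) topology" where
  "What W N e = product_topology (component_topology W N e) {1..}"

text \<open>Monomials are exponent functions of finite support on the index pairs \<open>(m, i)\<close>; the pair
  \<open>(m, i)\<close> stands for the variable \<open>w\<^sub>m\<^sub>,\<^sub>i\<close>. The polynomial type has variables for all pairs of
  naturals, hence the carrier \<open>Sym_gr\<close>.\<close>

type_synonym monomial = "(nat \<times> nat) \<Rightarrow>\<^sub>0 nat"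
type_synonym gpoly = "monomial \<Rightarrow>\<^sub>0 real"

definition var_set :: "(nat \<Rightarrow> nat) \<Rightarrow> (nat \<times> nat) set" where
  "var_set N = {(m, i). 1 \<le> m \<and> i \<in> {1..N m}}"

definition Sym_gr :: "(nat \<Rightarrow> nat) \<Rightarrow> gpoly set" where
  "Sym_gr N = {P. \<forall>\<alpha>\<in>Poly_Mapping.keys P. Poly_Mapping.keys \<alpha> \<subseteq> var_set N}"

definition mono_degree :: "monomial \<Rightarrow> nat" where
  "mono_degree \<alpha> = (\<Sum>v\<in>Poly_Mapping.keys \<alpha>. fst v * Poly_Mapping.lookup \<alpha> v)"

definition monomials :: "(nat \<Rightarrow> nat) \<Rightarrow> nat \<Rightarrow> monomial set" where
  "monomials N n = {\<alpha>. Poly_Mapping.keys \<alpha> \<subseteq> var_set N \<and> mono_degree \<alpha> = n}"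

definition num_monomials :: "(nat \<Rightarrow> nat) \<Rightarrow> nat \<Rightarrow> nat" where
  "num_monomials N n = card (monomials N n)"

definition w_var :: "nat \<Rightarrow> nat \<Rightarrow> gpoly" where
  "w_var m i = Poly_Mapping.single (Poly_Mapping.single (m, i) 1) 1"

definition const_gpoly :: "real \<Rightarrow> gpoly" where
  "const_gpoly c = Poly_Mapping.single 0 c"

definition eval_gpoly ::
    "(nat \<Rightarrow> nat) \<Rightarrow> (nat \<Rightarrow> nat \<Rightarrow> 'v::real_vector) \<Rightarrow> gpoly \<Rightarrow> (nat \<Rightarrow> 'v) \<Rightarrow> real" where
  "eval_gpoly N e P x =
     (\<Sum>\<alpha>\<in>Poly_Mapping.keys P. Poly_Mapping.lookup P \<alpha> *
        (\<Prod>(m, i)\<in>Poly_Mapping.keys \<alpha>. dual_basis N e m i (x m) ^ Poly_Mapping.lookup \<alpha> (m, i)))"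

text \<open>The order of the entries of \<open>\<^bold>w\<^sub>n\<close> is not prescribed: \<open>ws n\<close> is any enumeration of the
  monomials of total degree \<open>n\<close>.\<close>

definition monomial_enum :: "(nat \<Rightarrow> nat) \<Rightarrow> (nat \<Rightarrow> monomial list) \<Rightarrow> bool" where
  "monomial_enum N ws \<longleftrightarrow> (\<forall>n. distinct (ws n) \<and> set (ws n) = monomials N n)"

definition w_vec :: "(nat \<Rightarrow> monomial list) \<Rightarrow> nat \<Rightarrow> gpoly Matrix.vec" where
  "w_vec ws n = vec_of_list (map (\<lambda>\<alpha>. Poly_Mapping.single \<alpha> 1) (ws n))"

text \<open>The set \<open>\<M>(\<close>\<open>What\<close>\<open>)\<close> of Borel probability measures with finite moments.\<close>

definition prob_measures ::
    "(nat \<Rightarrow> 'v::real_vector set) \<Rightarrow> (nat \<Rightarrow> nat) \<Rightarrow> (nat \<Rightarrow> nat \<Rightarrow> 'v) \<Rightarrow> (nat \<Rightarrow> 'v) measure set" where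
  "prob_measures W N e =
     {\<mu>. prob_space \<mu> \<and> space \<mu> = topspace (What W N e) \<and>
         sets \<mu> = sigma_sets (topspace (What W N e)) {U. openin (What W N e) U} \<and>
         (\<forall>P\<in>Sym_gr N. integrable \<mu> (eval_gpoly N e P))}"

definition determinate ::
    "(nat \<Rightarrow> 'v::real_vector set) \<Rightarrow> (nat \<Rightarrow> nat) \<Rightarrow> (nat \<Rightarrow> nat \<Rightarrow> 'v) \<Rightarrow> (nat \<Rightarrow> 'v) measure \<Rightarrow> bool" where
  "determinate W N e \<mu> \<longleftrightarrow>
     (\<forall>\<nu>\<in>prob_measures W N e.
        (\<forall>P\<in>Sym_gr N. integral\<^sup>L \<nu> (eval_gpoly N e P) = integral\<^sup>L \<mu> (eval_gpoly N e P))
        \<longrightarrow> \<nu> = \<mu>)"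

definition measure_supp :: "'a topology \<Rightarrow> 'a measure \<Rightarrow> 'a set" where
  "measure_supp X \<mu> = {x \<in> topspace X. \<forall>U. openin X U \<and> x \<in> U \<longrightarrow> emeasure \<mu> U > 0}"

definition compactly_supported :: "'a topology \<Rightarrow> 'a measure \<Rightarrow> bool" where
  "compactly_supported X \<mu> \<longleftrightarrow> compactin X (measure_supp X \<mu>)"

text \<open>The matrix \<open>(\<^bold>p, \<^bold>q\<^sup>T)\<close> of the entrywise pairings \<open>(P, Q) = \<integral> P Q d\<mu>\<close>.\<close>

definition pairing_mat ::
    "(nat \<Rightarrow> nat) \<Rightarrow> (nat \<Rightarrow> nat \<Rightarrow> 'v::real_vector) \<Rightarrow> (nat \<Rightarrow> 'v) measure \<Rightarrow>
      gpoly Matrix.vec \<Rightarrow> gpoly Matrix.vec \<Rightarrow> real Matrix.mat" where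
  "pairing_mat N e \<mu> p q =
     Matrix.mat (dim_vec p) (dim_vec q)
       (\<lambda>(i, j). \<integral>x. eval_gpoly N e (vec_index p i * vec_index q j) x \<partial>\<mu>)"

definition orthonormal_seq ::
    "(nat \<Rightarrow> nat) \<Rightarrow> (nat \<Rightarrow> nat \<Rightarrow> 'v::real_vector) \<Rightarrow> (nat \<Rightarrow> monomial list) \<Rightarrow>
      (nat \<Rightarrow> 'v) measure \<Rightarrow> (nat \<Rightarrow> gpoly Matrix.vec) \<Rightarrow> bool" where
  "orthonormal_seq N e ws \<mu> p \<longleftrightarrow>
     (\<forall>n. (\<forall>P\<in>set\<^sub>v (p n). \<forall>\<alpha>\<in>Poly_Mapping.keys P. mono_degree \<alpha> \<le> n) \<and>
          (\<forall>m<n. pairing_mat N e \<mu> (w_vec ws m) (p n) = 0\<^sub>m (num_monomials N m) (num_monomials N n)) \<and>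
          invertible_mat (pairing_mat N e \<mu> (w_vec ws n) (p n)) \<and>
          pairing_mat N e \<mu> (p n) (p n) = 1\<^sub>m (num_monomials N n))"

text \<open>A real matrix applied to a column vector of polynomials.\<close>

definition mat_gpoly_mult ::
    "real Matrix.mat \<Rightarrow> gpoly Matrix.vec \<Rightarrow> gpoly Matrix.vec" where
  "mat_gpoly_mult A p = map_mat const_gpoly A *\<^sub>v p"

definition mat_rank :: "real Matrix.mat \<Rightarrow> nat" where
  "mat_rank A = vec_space.rank (dim_row A) A"

definition eucl_norm :: "real Matrix.vec \<Rightarrow> real" where
  "eucl_norm v = sqrt (scalar_prod v v)"

definition spectral_norm :: "real Matrix.mat \<Rightarrow> real" where
  "spectral_norm A = (SUP v\<in>{v \<in> carrier_vec (dim_col A). eucl_norm v \<le> 1}. eucl_norm (A *\<^sub>v v))"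

text \<open>Vertical stacking of the blocks \<open>A m i\<close>, \<open>m \<in> [n]\<close>, \<open>i \<in> [N m]\<close>, each with \<open>c\<close> columns.\<close>

definition stack_blocks ::
    "(nat \<Rightarrow> nat) \<Rightarrow> nat \<Rightarrow> nat \<Rightarrow> (nat \<Rightarrow> nat \<Rightarrow> real Matrix.mat) \<Rightarrow> real Matrix.mat" where
  "stack_blocks N n c A =
     mat_of_rows c (concat (map (\<lambda>m. concat (map (\<lambda>i. Matrix.rows (A m i)) [1..<Suc (N m)])) [1..<Suc n]))"

text \<open>The matrix \<open>M\<^sup>k\<^sub>n\<^sub>,\<^sub>m\<^sub>,\<^sub>i\<close> is written \<open>M k n m i\<close>; the family is extended to
  \<open>- m \<le> k < 0\<close> by transposition. For such \<open>k\<close> it is meaningful only if \<open>n \<ge> m + \<bar>k\<bar>\<close>.\<close>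

definition ext_coeff ::
    "(nat \<Rightarrow> nat \<Rightarrow> nat \<Rightarrow> nat \<Rightarrow> real Matrix.mat) \<Rightarrow> int \<Rightarrow> nat \<Rightarrow> nat \<Rightarrow> nat \<Rightarrow> real Matrix.mat" where
  "ext_coeff M k n m i =
     (if k \<ge> 0 then M (nat k) n m i else transpose_mat (M (nat (- k)) (n - nat (- k)) m i))"

end

theory Submission
  imports
    Defs
    "HOL-Probability.Helly_Selection"
    "HOL-Probability.Probability_Mass_Function"
begin

text \<open>
  All conditions are reformulated for a positive linear functional \<open>L\<close> on the polynomial algebra:
  the sequence is orthonormal for \<open>L\<close>, and multiplication by each variable is bounded for the seminorm
  \<open>P \<mapsto> sqrt (L (P * P))\<close>. Both sides of the equivalence are shown to say that such a functional
  exists.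

  From a measure to the recurrence. Integration against a compactly supported measure is such a
  functional, because the variables are bounded on the support. A count of dimensions shows that the
  entries of \<open>p 0, \<dots>, p n\<close> form a basis of the polynomials of degree at most \<open>n\<close>. The matrices \<open>M\<close>
  are the blocks of multiplication by a variable in this orthonormal basis: the recurrence is the
  expansion in the basis, the ranks come from the leading terms, and the norms are those of a
  compression of a bounded operator (\<open>jacobi_of_bounded\<close>).

  From the recurrence to a functional. The recurrence makes the span of the sequence closed under
  multiplication by variables, so by the same count the sequence is a basis. Let \<open>ip\<close> be the inner
  product that makes it orthonormal, and let \<open>L P = ip P 1\<close>. The point is \<open>L (Q * P) = ip Q P\<close>,
  which is proved by induction on the degree of \<open>P\<close> (\<open>L_mult_q\<close>); it uses that multiplication by a
  variable is symmetric. The off-diagonal blocks are symmetric by the form of the recurrence; a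
  diagonal block is symmetric because the induction hypothesis writes its entries as
  \<open>L (w * q j c * q j b)\<close>, and multiplication is commutative. The bounds on the norms make
  multiplication by each variable bounded.

  From a functional to a measure. After rescaling a variable to a contraction \<open>y\<close>, a log-convexity
  argument shows that multiplication by \<open>1 + y\<close> and \<open>1 - y\<close> preserves positivity
  (\<open>Cone_mult_yvar\<close>), so that \<open>L\<close> is nonnegative on products of Bernstein polynomials. These values are
  the weights of discrete measures on a grid whose moments converge to those of \<open>L\<close>. The limit is
  taken on the real line: a Schoenberg curve maps \<open>[0, 1]\<close> continuously onto the countable product of
  unit intervals, the discrete measures are lifted to \<open>[0, 1]\<close>, and Helly's theorem provides a weak
  limit, whose image under the curve represents \<open>L\<close> (\<open>representing_measure\<close>).

  Determinacy. The even moments of any measure with the same moments confine it to the same box;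
  there, by the one-dimensional Weierstrass theorem, polynomials approximate indicators of half lines,
  which determine all finite-dimensional distributions (\<open>same_moments.measures_eq\<close>).
\<close>

section \<open>The graded polynomial algebra\<close>

lemma lookup_const_mult: "Poly_Mapping.lookup (const_gpoly c * P) \<alpha> = c * Poly_Mapping.lookup P \<alpha>"
  unfolding const_gpoly_def mult_map_scale_conv_mult[symmetric]
  by (simp add: Poly_Mapping.map.rep_eq when_def)

lemma keys_const_mult: "Poly_Mapping.keys (const_gpoly c * P) \<subseteq> Poly_Mapping.keys P"
  by (auto simp: in_keys_iff lookup_const_mult)

lemma const_gpoly_0 [simp]: "const_gpoly 0 = 0"
  by (simp add: const_gpoly_def)

lemma const_gpoly_1 [simp]: "const_gpoly 1 = 1"
  by (simp add: const_gpoly_def)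

lemma const_gpoly_add: "const_gpoly (a + b) = const_gpoly a + const_gpoly b"
  by (simp add: const_gpoly_def single_add)

lemma const_gpoly_mult: "const_gpoly (a * b) = const_gpoly a * const_gpoly b"
  by (simp add: const_gpoly_def mult_single)

lemma const_gpoly_uminus: "const_gpoly (- a) = - const_gpoly a"
  by (simp add: const_gpoly_def single_uminus)

lemma const_gpoly_of_nat: "const_gpoly (of_nat n) = of_nat n"
  by (induction n) (auto simp: const_gpoly_add)

text \<open>The polynomials form a real vector space, scalars acting by multiplication with constant
  polynomials; this makes the linear algebra of \<^locale>\<open>vector_space\<close> available for them.\<close>

global_interpretation gp: vector_space "\<lambda>c P. const_gpoly c * (P :: gpoly)"
  by unfold_locales (auto simp: algebra_simps const_gpoly_add const_gpoly_mult)

text \<open>A monomial, regarded as a polynomial.\<close>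

abbreviation mon :: "monomial \<Rightarrow> gpoly" where
  "mon \<alpha> \<equiv> Poly_Mapping.single \<alpha> 1"

lemma poly_mapping_sum_single: "(\<Sum>\<alpha>\<in>Poly_Mapping.keys P. Poly_Mapping.single \<alpha> (Poly_Mapping.lookup P \<alpha>)) = P"
  by (rule poly_mapping_eqI)
     (auto simp: lookup_sum lookup_single when_def in_keys_iff sum.delta)

lemma single_conv_const_mult: "Poly_Mapping.single \<alpha> c = const_gpoly c * mon \<alpha>"
  by (simp add: const_gpoly_def mult_single)

lemma gpoly_sum_mon: "(P :: gpoly) = (\<Sum>\<alpha>\<in>Poly_Mapping.keys P. const_gpoly (Poly_Mapping.lookup P \<alpha>) * mon \<alpha>)"
  using poly_mapping_sum_single[of P] by (simp add: single_conv_const_mult[symmetric])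

lemma keys_add_nat: "Poly_Mapping.keys (\<alpha> + \<beta>) = Poly_Mapping.keys \<alpha> \<union> Poly_Mapping.keys (\<beta> :: 'a \<Rightarrow>\<^sub>0 nat)"
  by (auto simp: in_keys_iff lookup_add)

lemma mono_degree_superset:
  assumes "finite A" "Poly_Mapping.keys \<alpha> \<subseteq> A"
  shows "mono_degree \<alpha> = (\<Sum>v\<in>A. fst v * Poly_Mapping.lookup \<alpha> v)"
  unfolding mono_degree_def using assms
  by (intro sum.mono_neutral_left) (auto simp: in_keys_iff)

lemma mono_degree_add: "mono_degree (\<alpha> + \<beta>) = mono_degree \<alpha> + mono_degree \<beta>"
proof -
  let ?A = "Poly_Mapping.keys \<alpha> \<union> Poly_Mapping.keys \<beta>"
  have *: "finite ?A" by simp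
  show ?thesis
    using mono_degree_superset[OF *, of \<alpha>] mono_degree_superset[OF *, of \<beta>]
      mono_degree_superset[OF *, of "\<alpha> + \<beta>"]
    by (simp add: keys_add_nat lookup_add algebra_simps sum.distrib)
qed

lemma mono_degree_single [simp]: "mono_degree (Poly_Mapping.single v k) = fst v * k"
  by (cases "k = 0") (auto simp: mono_degree_def)

lemma mono_degree_0 [simp]: "mono_degree 0 = 0"
  by (simp add: mono_degree_def)

text \<open>The polynomials of total degree at most \<open>n\<close> in the variables \<open>w\<^sub>m\<^sub>,\<^sub>i\<close>.\<close>

definition Pol :: "(nat \<Rightarrow> nat) \<Rightarrow> nat \<Rightarrow> gpoly set" where
  "Pol N n = {P \<in> Sym_gr N. \<forall>\<alpha>\<in>Poly_Mapping.keys P. mono_degree \<alpha> \<le> n}"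

lemma Sym_gr_eq_span: "Sym_gr N = gp.span (mon ` {\<alpha>. Poly_Mapping.keys \<alpha> \<subseteq> var_set N})" (is "_ = gp.span ?B")
proof
  show "Sym_gr N \<subseteq> gp.span ?B"
  proof
    fix P assume P: "P \<in> Sym_gr N"
    have "(\<Sum>\<alpha>\<in>Poly_Mapping.keys P. const_gpoly (Poly_Mapping.lookup P \<alpha>) * mon \<alpha>) \<in> gp.span ?B"
      using P by (intro gp.span_sum gp.span_scale gp.span_base) (auto simp: Sym_gr_def)
    then show "P \<in> gp.span ?B" using gpoly_sum_mon[of P] by simp
  qed
  have sub: "gp.subspace (Sym_gr N)"
    unfolding gp.subspace_def Sym_gr_def using keys_const_mult keys_add by fastforce
  show "gp.span ?B \<subseteq> Sym_gr N"
    by (rule gp.span_minimal[OF _ sub]) (auto simp: Sym_gr_def)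
qed

lemma Pol_eq_span: "Pol N n = gp.span (mon ` (\<Union>j\<le>n. monomials N j))" (is "_ = gp.span ?B")
proof
  show "Pol N n \<subseteq> gp.span ?B"
  proof
    fix P assume P: "P \<in> Pol N n"
    have "(\<Sum>\<alpha>\<in>Poly_Mapping.keys P. const_gpoly (Poly_Mapping.lookup P \<alpha>) * mon \<alpha>) \<in> gp.span ?B"
      using P by (intro gp.span_sum gp.span_scale gp.span_base) (auto simp: Pol_def Sym_gr_def monomials_def)
    then show "P \<in> gp.span ?B" using gpoly_sum_mon[of P] by simp
  qed
  have sub: "gp.subspace (Pol N n)"
    unfolding gp.subspace_def Pol_def Sym_gr_def using keys_const_mult keys_add by fastforce
  show "gp.span ?B \<subseteq> Pol N n"
    by (rule gp.span_minimal[OF _ sub]) (auto simp: Pol_def Sym_gr_def monomials_def)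
qed

lemma subspace_Sym: "gp.subspace (Sym_gr N)"
  unfolding Sym_gr_eq_span by (rule gp.subspace_span)

lemma subspace_Pol: "gp.subspace (Pol N n)"
  unfolding Pol_eq_span by (rule gp.subspace_span)

lemmas Sym_add = gp.subspace_add[OF subspace_Sym]
lemmas Sym_diff = gp.subspace_diff[OF subspace_Sym]
lemmas Sym_scale = gp.subspace_scale[OF subspace_Sym]
lemmas Sym_sum = gp.subspace_sum[OF subspace_Sym]
lemmas Sym_0 = gp.subspace_0[OF subspace_Sym]

lemma Sym_mult:
  assumes "P \<in> Sym_gr N" "Q \<in> Sym_gr N"
  shows "P * Q \<in> Sym_gr N"
proof -
  have "Poly_Mapping.keys (P * Q) \<subseteq> {a + b |a b. a \<in> Poly_Mapping.keys P \<and> b \<in> Poly_Mapping.keys Q}"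
    by (rule keys_mult)
  then show ?thesis
    using assms unfolding Sym_gr_def by (fastforce simp: keys_add_nat)
qed

lemma Sym_1: "1 \<in> Sym_gr N"
  by (auto simp: Sym_gr_def)

lemma Sym_const: "const_gpoly c \<in> Sym_gr N"
  using Sym_scale[OF Sym_1, of c] by simp

lemma Sym_power: "P \<in> Sym_gr N \<Longrightarrow> P ^ k \<in> Sym_gr N"
  by (induction k) (auto intro: Sym_1 Sym_mult)

lemma Sym_prod: "(\<And>x. x \<in> A \<Longrightarrow> f x \<in> Sym_gr N) \<Longrightarrow> prod f A \<in> Sym_gr N"
  by (induction A rule: infinite_finite_induct) (auto intro: Sym_1 Sym_mult)

lemma Sym_w_var: "(m, i) \<in> var_set N \<Longrightarrow> w_var m i \<in> Sym_gr N"
  by (auto simp: Sym_gr_def w_var_def)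

lemmas Sym_closed = Sym_add Sym_diff Sym_mult Sym_1 Sym_const Sym_power Sym_w_var

lemma Pol_Sym: "P \<in> Pol N n \<Longrightarrow> P \<in> Sym_gr N"
  by (simp add: Pol_def)

lemma Pol_mono: "m \<le> n \<Longrightarrow> Pol N m \<subseteq> Pol N n"
  by (force simp: Pol_def)

lemma Sym_in_Pol:
  assumes "P \<in> Sym_gr N" obtains n where "P \<in> Pol N n"
proof -
  have "P \<in> Pol N (Max (insert 0 (mono_degree ` Poly_Mapping.keys P)))"
    using assms by (auto simp: Pol_def intro!: Max_ge)
  then show ?thesis by (rule that)
qed

lemma Pol_mult:
  assumes "P \<in> Pol N m" "Q \<in> Pol N n"
  shows "P * Q \<in> Pol N (m + n)"
proof -
  have "Poly_Mapping.keys (P * Q) \<subseteq> {a + b |a b. a \<in> Poly_Mapping.keys P \<and> b \<in> Poly_Mapping.keys Q}"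
    by (rule keys_mult)
  then show ?thesis
    using assms Sym_mult[of P N Q] unfolding Pol_def
    by (auto simp: mono_degree_add dest!: subsetD intro!: add_mono)
qed

lemma Pol_w_var: "(m, i) \<in> var_set N \<Longrightarrow> w_var m i \<in> Pol N m"
  by (auto simp: Pol_def Sym_w_var) (auto simp: w_var_def)

lemma Pol_w_var_mult: "(m, i) \<in> var_set N \<Longrightarrow> P \<in> Pol N n \<Longrightarrow> w_var m i * P \<in> Pol N (n + m)"
  using Pol_mult[OF Pol_w_var] by (metis add.commute)

lemma Pol_1: "1 \<in> Pol N n"
  by (auto simp: Pol_def Sym_1)

lemma lookup_mon_mult: "Poly_Mapping.lookup (mon \<beta> * P) (\<beta> + \<alpha>) = Poly_Mapping.lookup P (\<alpha> :: monomial)"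
proof -
  have "mon \<beta> * P = (\<Sum>\<gamma>\<in>Poly_Mapping.keys P. Poly_Mapping.single (\<beta> + \<gamma>) (Poly_Mapping.lookup P \<gamma>))"
    by (subst (1) poly_mapping_sum_single[of P, symmetric]) (simp add: sum_distrib_left mult_single)
  then show ?thesis
    by (auto simp: lookup_sum lookup_single when_def in_keys_iff sum.delta)
qed

lemma Pol_w_var_cancel:
  assumes "P \<in> Sym_gr N" "w_var m i * P \<in> Pol N (n + m)"
  shows "P \<in> Pol N n"
proof -
  have "mono_degree \<alpha> \<le> n" if "\<alpha> \<in> Poly_Mapping.keys P" for \<alpha>
  proof -
    have "Poly_Mapping.single (m, i) 1 + \<alpha> \<in> Poly_Mapping.keys (w_var m i * P)"
      using that by (simp add: in_keys_iff w_var_def lookup_mon_mult)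
    then have "mono_degree (Poly_Mapping.single (m, i) 1 + \<alpha>) \<le> n + m"
      using assms(2) by (auto simp: Pol_def)
    then show ?thesis by (simp add: mono_degree_add)
  qed
  then show ?thesis using assms(1) by (auto simp: Pol_def)
qed

lemma monomial_divide:
  assumes "\<alpha> \<in> monomials N n" "n \<ge> 1"
  obtains m i \<beta> where "m \<in> {1..n}" "i \<in> {1..N m}" "\<beta> \<in> monomials N (n - m)"
    "\<alpha> = Poly_Mapping.single (m, i) 1 + \<beta>"
proof -
  have keys: "Poly_Mapping.keys \<alpha> \<subseteq> var_set N" and deg: "mono_degree \<alpha> = n"
    using assms(1) by (auto simp: monomials_def)
  have "\<alpha> \<noteq> 0" using deg assms(2) by auto
  then obtain m i where mi: "(m, i) \<in> Poly_Mapping.keys \<alpha>" by (metis all_not_in_conv keys_eq_empty surj_pair)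
  define \<beta> where "\<beta> = \<alpha> - Poly_Mapping.single (m, i) 1"
  have \<alpha>: "\<alpha> = Poly_Mapping.single (m, i) 1 + \<beta>"
    using mi by (intro poly_mapping_eqI) (auto simp: \<beta>_def lookup_add lookup_minus lookup_single when_def in_keys_iff)
  have "m + mono_degree \<beta> = n" using deg unfolding \<alpha> by (simp add: mono_degree_add)
  moreover have "Poly_Mapping.keys \<beta> \<subseteq> var_set N" using keys unfolding \<alpha> keys_add_nat by auto
  ultimately show ?thesis
    using that[OF _ _ _ \<alpha>] subsetD[OF keys mi] by (auto simp: var_set_def monomials_def)
qed

lemma monomials_0: "monomials N 0 = {0}"
proof -
  have "\<alpha> = 0" if "Poly_Mapping.keys \<alpha> \<subseteq> var_set N" "mono_degree \<alpha> = 0" for \<alpha>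
  proof (rule ccontr)
    assume "\<alpha> \<noteq> 0"
    then obtain v where "v \<in> Poly_Mapping.keys \<alpha>" by (metis all_not_in_conv keys_eq_empty)
    moreover from this have "fst v \<ge> 1" using that(1) by (auto simp: var_set_def)
    ultimately show False using that(2) by (force simp: mono_degree_def)
  qed
  then show ?thesis by (auto simp: monomials_def)
qed

lemma independent_mon: "gp.independent (mon ` A)"
proof
  assume "gp.dependent (mon ` A)"
  then obtain t u where t: "finite t" "t \<subseteq> mon ` A" "(\<Sum>v\<in>t. const_gpoly (u v) * v) = 0" "\<exists>v\<in>t. u v \<noteq> 0"
    unfolding gp.dependent_explicit by blast
  obtain s where s: "s \<subseteq> A" "t = mon ` s" "inj_on mon s"
    using t(2) unfolding subset_image_inj by blast
  have fin: "finite s" using s t(1) finite_imageD by blast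
  have "u (mon \<alpha>) = 0" if "\<alpha> \<in> s" for \<alpha>
  proof -
    have "0 = Poly_Mapping.lookup (\<Sum>\<beta>\<in>s. const_gpoly (u (mon \<beta>)) * mon \<beta>) \<alpha>"
      using t(3) s by (simp add: sum.reindex)
    also have "\<dots> = u (mon \<alpha>)"
      using that fin by (simp add: lookup_sum lookup_const_mult lookup_single when_def if_distrib[of "\<lambda>x. _ * x"] sum.delta' cong: if_cong)
    finally show ?thesis by simp
  qed
  then show False using t(4) s by auto
qed

text \<open>An induction principle for the algebra generated by the variables of \<open>W\<close>.\<close>

lemma Sym_gr_induct [consumes 1, case_names one add scale var]:
  assumes P: "P \<in> Sym_gr N"
    and one: "S 1"
    and add: "\<And>P Q. P \<in> Sym_gr N \<Longrightarrow> Q \<in> Sym_gr N \<Longrightarrow> S P \<Longrightarrow> S Q \<Longrightarrow> S (P + Q)"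
    and scale: "\<And>c P. P \<in> Sym_gr N \<Longrightarrow> S P \<Longrightarrow> S (const_gpoly c * P)"
    and var: "\<And>m i P. (m, i) \<in> var_set N \<Longrightarrow> P \<in> Sym_gr N \<Longrightarrow> S P \<Longrightarrow> S (w_var m i * P)"
  shows "S P"
proof -
  have mon_Sym: "mon \<alpha> \<in> Sym_gr N" if "Poly_Mapping.keys \<alpha> \<subseteq> var_set N" for \<alpha>
    using that by (auto simp: Sym_gr_def)
  have S_mon: "S (mon \<alpha>)" if "Poly_Mapping.keys \<alpha> \<subseteq> var_set N" for \<alpha>
    using that
  proof (induction "mono_degree \<alpha>" arbitrary: \<alpha> rule: less_induct)
    case less
    show ?case
    proof (cases "mono_degree \<alpha> = 0")
      case True
      then have "\<alpha> \<in> monomials N 0" using less.prems by (simp add: monomials_def)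
      then show ?thesis using one by (simp add: monomials_0)
    next
      case False
      have "\<alpha> \<in> monomials N (mono_degree \<alpha>)" using less.prems by (simp add: monomials_def)
      from monomial_divide[OF this] False obtain m i \<beta> where
        mi: "m \<in> {1..mono_degree \<alpha>}" "i \<in> {1..N m}" and \<beta>: "\<beta> \<in> monomials N (mono_degree \<alpha> - m)"
        and \<alpha>: "\<alpha> = Poly_Mapping.single (m, i) 1 + \<beta>" by (metis less_one not_le)
      have "S (w_var m i * mon \<beta>)"
        using mi \<beta> by (intro var less.hyps mon_Sym) (auto simp: monomials_def var_set_def)
      then show ?thesis unfolding \<alpha> by (simp add: w_var_def mult_single)
    qed
  qed
  have "P \<in> Sym_gr N \<and> S P"
    using P[unfolded Sym_gr_eq_span]
  proof (induction rule: gp.span_induct_alt)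
    case base
    then show ?case using scale[OF Sym_1 one, of 0] by (simp add: Sym_0)
  next
    case (step c x y)
    then show ?case by (auto intro!: Sym_add Sym_scale add scale S_mon mon_Sym)
  qed
  then show ?thesis ..
qed

subsection \<open>Evaluation\<close>

text \<open>The value of a polynomial at a point given by its coordinates.\<close>

definition ev :: "gpoly \<Rightarrow> (nat \<times> nat \<Rightarrow> real) \<Rightarrow> real" where
  "ev P y = (\<Sum>\<alpha>\<in>Poly_Mapping.keys P. Poly_Mapping.lookup P \<alpha> *
     (\<Prod>v\<in>Poly_Mapping.keys \<alpha>. y v ^ Poly_Mapping.lookup \<alpha> v))"

lemma ev_superset:
  assumes "finite A" "Poly_Mapping.keys P \<subseteq> A"
  shows "ev P y = (\<Sum>\<alpha>\<in>A. Poly_Mapping.lookup P \<alpha> * (\<Prod>v\<in>Poly_Mapping.keys \<alpha>. y v ^ Poly_Mapping.lookup \<alpha> v))"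
  unfolding ev_def using assms
  by (intro sum.mono_neutral_left) (auto simp: in_keys_iff)

lemma ev_0 [simp]: "ev 0 y = 0"
  by (simp add: ev_def)

lemma ev_1 [simp]: "ev 1 y = 1"
  by (simp add: ev_def)

lemma ev_add: "ev (P + Q) y = ev P y + ev Q y"
proof -
  let ?A = "Poly_Mapping.keys P \<union> Poly_Mapping.keys Q"
  have *: "finite ?A" by simp
  show ?thesis
    using ev_superset[OF *, of P] ev_superset[OF *, of Q] ev_superset[OF *, of "P + Q"] keys_add[of P Q]
    by (simp add: lookup_add algebra_simps sum.distrib)
qed

lemma ev_scale: "ev (const_gpoly c * P) y = c * ev P y"
proof -
  have "Poly_Mapping.keys (const_gpoly c * P) \<subseteq> Poly_Mapping.keys P"
    by (auto simp: in_keys_iff lookup_const_mult)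
  from ev_superset[OF _ this] show ?thesis
    by (simp add: lookup_const_mult sum_distrib_left mult.assoc) (simp add: ev_def sum_distrib_left)
qed

lemma ev_const [simp]: "ev (const_gpoly c) y = c"
  using ev_scale[of c 1 y] by simp

lemma ev_sum: "ev (sum f A) y = (\<Sum>x\<in>A. ev (f x) y)"
  by (induction A rule: infinite_finite_induct) (simp_all add: ev_add)

lemma ev_w_var_mult_mon: "ev (w_var m i * mon \<alpha>) y = y (m, i) * ev (mon \<alpha>) y"
proof -
  let ?A = "insert (m, i) (Poly_Mapping.keys \<alpha>)"
  have "(\<Prod>v\<in>Poly_Mapping.keys (Poly_Mapping.single (m, i) 1 + \<alpha>). y v ^ Poly_Mapping.lookup (Poly_Mapping.single (m, i) 1 + \<alpha>) v)
      = (\<Prod>v\<in>?A. y v ^ Poly_Mapping.lookup (Poly_Mapping.single (m, i) 1 + \<alpha>) v)"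
    by (simp add: keys_add_nat)
  also have "\<dots> = (\<Prod>v\<in>?A. y v ^ Poly_Mapping.lookup (Poly_Mapping.single (m, i) 1) v * y v ^ Poly_Mapping.lookup \<alpha> v)"
    by (simp add: lookup_add power_add)
  also have "\<dots> = (\<Prod>v\<in>?A. if v = (m, i) then y v else 1) * (\<Prod>v\<in>?A. y v ^ Poly_Mapping.lookup \<alpha> v)"
    by (subst prod.distrib, rule arg_cong2[where f = "(*)"], rule prod.cong)
       (auto simp: lookup_single when_def)
  also have "(\<Prod>v\<in>?A. if v = (m, i) then y v else 1) = y (m, i)"
    by (subst prod.delta) auto
  also have "(\<Prod>v\<in>?A. y v ^ Poly_Mapping.lookup \<alpha> v) = (\<Prod>v\<in>Poly_Mapping.keys \<alpha>. y v ^ Poly_Mapping.lookup \<alpha> v)"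
    by (intro prod.mono_neutral_right) (auto simp: in_keys_iff)
  finally show ?thesis by (simp add: w_var_def mult_single ev_def)
qed

lemma ev_w_var_mult: "ev (w_var m i * P) y = y (m, i) * ev P y"
  by (subst (1 2) gpoly_sum_mon[of P])
     (simp add: sum_distrib_left ev_sum ev_scale ev_w_var_mult_mon mult.left_commute[of "w_var m i"]
       mult.left_commute[of "y (m, i)"])

lemma ev_mult:
  assumes "P \<in> Sym_gr N" shows "ev (P * Q) y = ev P y * ev Q y"
  using assms
proof (induction rule: Sym_gr_induct)
  case (scale c P)
  then show ?case by (simp add: ev_scale mult.assoc)
next
  case (var m i P)
  then show ?case by (simp add: ev_w_var_mult mult.assoc)
qed (simp_all add: ev_add distrib_right)

lemma ev_power: "P \<in> Sym_gr N \<Longrightarrow> ev (P ^ k) y = ev P y ^ k"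
  by (induction k) (simp_all add: ev_mult)

lemma ev_prod: "(\<And>x. x \<in> A \<Longrightarrow> f x \<in> Sym_gr N) \<Longrightarrow> ev (prod f A) y = (\<Prod>x\<in>A. ev (f x) y)"
  by (induction A rule: infinite_finite_induct) (simp_all add: ev_mult[of _ N])

lemma ev_w_var [simp]: "ev (w_var m i) y = y (m, i)"
  using ev_w_var_mult[of m i 1 y] by simp

section \<open>Linear bases of the graded algebra\<close>

text \<open>The members of index at most \<open>n\<close> of a family \<open>q j a\<close>, \<open>a < r j\<close>. When \<open>r j\<close> is the number of
  monomials of degree \<open>j\<close>, there are as many indices as monomials of degree at most \<open>n\<close>; hence the
  members form a basis of \<open>Pol N n\<close> as soon as they span it, or are independent elements of it.\<close>

abbreviation fam :: "(nat \<Rightarrow> nat) \<Rightarrow> (nat \<Rightarrow> nat \<Rightarrow> gpoly) \<Rightarrow> nat \<Rightarrow> gpoly set" where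
  "fam r q n \<equiv> (\<lambda>(j, a). q j a) ` (SIGMA j:{..n}. {..<r j})"

lemma fam_memI: "j \<le> n \<Longrightarrow> a < r j \<Longrightarrow> q j a \<in> fam r q n"
  by force

lemma mon_inject: "mon \<alpha> = mon \<beta> \<Longrightarrow> \<alpha> = \<beta>"
  by (drule arg_cong[of _ _ Poly_Mapping.keys]) simp

lemma card_monomials_up_to:
  assumes "\<And>n. finite (monomials N n)"
  shows "finite (mon ` (\<Union>j\<le>n. monomials N j))"
    "card (mon ` (\<Union>j\<le>n. monomials N j)) = card (SIGMA j:{..n}. {..<num_monomials N j})"
proof -
  have "card (mon ` (\<Union>j\<le>n. monomials N j)) = card (\<Union>j\<le>n. monomials N j)"
    by (intro card_image) (auto simp: inj_on_def dest: mon_inject)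
  also have "\<dots> = (\<Sum>j\<le>n. card (monomials N j))"
    using assms by (intro card_UN_disjoint) (auto simp: monomials_def)
  finally show "card (mon ` (\<Union>j\<le>n. monomials N j)) = card (SIGMA j:{..n}. {..<num_monomials N j})"
    by (simp add: num_monomials_def)
  show "finite (mon ` (\<Union>j\<le>n. monomials N j))" using assms by auto
qed

lemma spanning_family_is_basis:
  assumes fin: "\<And>n. finite (monomials N n)" and r: "\<And>n. r n = num_monomials N n"
    and span: "Pol N n \<subseteq> gp.span (fam r q n)"
  shows "inj_on (\<lambda>(j, a). q j a) (SIGMA j:{..n}. {..<r j})"
    and "gp.independent (fam r q n)"
    and "gp.span (fam r q n) = Pol N n"
proof -
  let ?S = "mon ` (\<Union>j\<le>n. monomials N j)" and ?I = "SIGMA j:{..n}. {..<r j}" and ?B = "fam r q n"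
  have S: "finite ?S" "card ?S = card ?I" using card_monomials_up_to[OF fin, of n] by (simp_all add: r)
  have B: "finite ?B" "card ?B \<le> card ?I" by (simp, rule card_image_le, simp)
  have S_span: "?S \<subseteq> gp.span ?B" using order.trans[OF gp.span_superset span[unfolded Pol_eq_span]] .
  have "card ?S \<le> card ?B"
    using gp.independent_span_bound[OF B(1) independent_mon S_span] by simp
  then have cB: "card ?B = card ?I" using S B by simp
  then show "inj_on (\<lambda>(j, a). q j a) ?I" by (intro eq_card_imp_inj_on) auto
  show ind: "gp.independent ?B"
  proof
    assume "gp.dependent ?B"
    then obtain b where b: "b \<in> ?B" "b \<in> gp.span (?B - {b})" unfolding gp.dependent_def by blast
    then have "gp.span (?B - {b}) = gp.span ?B"
      by (metis gp.span_redundant insert_Diff)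
    then have "card ?S \<le> card (?B - {b})"
      using gp.independent_span_bound[OF _ independent_mon, of "?B - {b}"] S_span B by simp
    moreover have "card (?B - {b}) < card ?B" using b B by (intro card_Diff1_less) auto
    ultimately show False using cB S by simp
  qed
  have "b \<in> gp.span ?S" if b: "b \<in> ?B" for b
  proof (rule ccontr)
    assume nb: "b \<notin> gp.span ?S"
    then have "gp.independent (insert b ?S)" by (intro gp.independent_insertI independent_mon)
    moreover have "insert b ?S \<subseteq> gp.span ?B" using S_span gp.span_base[OF b] by (intro insert_subsetI)
    ultimately have "card (insert b ?S) \<le> card ?B"
      using gp.independent_span_bound[OF B(1)] by blast
    moreover have "b \<notin> ?S" by (rule contrapos_nn[OF nb]) (rule gp.span_base)
    ultimately show False using S cB by simp
  qed
  then have "gp.span ?B \<subseteq> gp.span ?S" by (intro gp.span_minimal gp.subspace_span) blast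
  then show "gp.span ?B = Pol N n" using span unfolding Pol_eq_span by blast
qed

lemma independent_family_spans:
  assumes fin: "\<And>n. finite (monomials N n)" and r: "\<And>n. r n = num_monomials N n"
    and ind: "gp.independent (fam r q n)"
    and inj: "inj_on (\<lambda>(j, a). q j a) (SIGMA j:{..n}. {..<r j})"
    and sub: "fam r q n \<subseteq> Pol N n"
  shows "Pol N n \<subseteq> gp.span (fam r q n)"
proof
  let ?S = "mon ` (\<Union>j\<le>n. monomials N j)" and ?I = "SIGMA j:{..n}. {..<r j}" and ?B = "fam r q n"
  have S: "finite ?S" "card ?S = card ?I" using card_monomials_up_to[OF fin, of n] by (simp_all add: r)
  have cB: "card ?B = card ?I" using inj by (rule card_image)
  fix P assume P: "P \<in> Pol N n"
  show "P \<in> gp.span ?B"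
  proof (rule ccontr)
    assume nP: "P \<notin> gp.span ?B"
    then have "gp.independent (insert P ?B)" by (intro gp.independent_insertI ind)
    moreover have "insert P ?B \<subseteq> gp.span ?S" using P sub unfolding Pol_eq_span by (intro insert_subsetI)
    ultimately have "card (insert P ?B) \<le> card ?S"
      using gp.independent_span_bound[OF S(1)] by blast
    moreover have "P \<notin> ?B" by (rule contrapos_nn[OF nP]) (rule gp.span_base)
    ultimately show False using S cB by simp
  qed
qed

text \<open>A space that contains \<open>1\<close> and all products of variables \<open>w\<^sub>m\<^sub>,\<^sub>i\<close> with polynomials of degree
  at most \<open>n - m\<close> contains all polynomials of degree at most \<open>n\<close>.\<close>

lemma Pol_subset_if_products:
  assumes V: "gp.subspace V" and one: "1 \<in> V"
    and prod: "\<And>m i P. 1 \<le> m \<Longrightarrow> m \<le> n \<Longrightarrow> i \<in> {1..N m} \<Longrightarrow> P \<in> Pol N (n - m) \<Longrightarrow> w_var m i * P \<in> V"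
  shows "Pol N n \<subseteq> V"
  unfolding Pol_eq_span
proof (rule gp.span_minimal[OF _ V], safe)
  fix j \<alpha> assume j: "j \<le> n" and \<alpha>: "\<alpha> \<in> monomials N j"
  show "mon \<alpha> \<in> V"
  proof (cases "j = 0")
    case True
    then show ?thesis using \<alpha> one by (simp add: monomials_0)
  next
    case False
    then obtain m i \<beta> where *: "m \<in> {1..j}" "i \<in> {1..N m}" "\<beta> \<in> monomials N (j - m)"
      "\<alpha> = Poly_Mapping.single (m, i) 1 + \<beta>"
      using monomial_divide[OF \<alpha>] by (metis less_one not_le)
    have "mon \<beta> \<in> Pol N (n - m)"
      using *(3) j by (auto simp: Pol_def Sym_gr_def monomials_def)
    then have "w_var m i * mon \<beta> \<in> V" using * j by (intro prod) auto
    then show ?thesis using *(4) by (simp add: w_var_def mult_single)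
  qed
qed

section \<open>Positive functionals and orthonormal bases\<close>

text \<open>The functional and its properties are used on \<open>Sym_gr N\<close> only; its values at polynomials with other
  variables are irrelevant.\<close>

locale positive_functional =
  fixes N :: "nat \<Rightarrow> nat" and L :: "gpoly \<Rightarrow> real"
  assumes L_add: "\<And>P Q. P \<in> Sym_gr N \<Longrightarrow> Q \<in> Sym_gr N \<Longrightarrow> L (P + Q) = L P + L Q"
    and L_scale: "\<And>c P. P \<in> Sym_gr N \<Longrightarrow> L (const_gpoly c * P) = c * L P"
    and L_nonneg: "\<And>P. P \<in> Sym_gr N \<Longrightarrow> L (P * P) \<ge> 0"
begin

lemma L_lin: "x \<in> Sym_gr N \<Longrightarrow> y \<in> Sym_gr N \<Longrightarrow> z \<in> Sym_gr N \<Longrightarrow>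
    L ((const_gpoly c * x + y) * z) = c * L (x * z) + L (y * z)"
  by (simp only: distrib_right mult.assoc L_add L_scale Sym_mult Sym_scale)

lemma L_lin2: "x \<in> Sym_gr N \<Longrightarrow> y \<in> Sym_gr N \<Longrightarrow> z \<in> Sym_gr N \<Longrightarrow>
    L ((const_gpoly c * x + const_gpoly d * y) * z) = c * L (x * z) + d * L (y * z)"
  by (simp only: distrib_right mult.assoc L_add L_scale Sym_mult Sym_scale)

lemma L_0 [simp]: "L 0 = 0"
  using L_scale[OF Sym_0, of 0] by simp

lemma L_sum: "(\<And>x. x \<in> A \<Longrightarrow> f x \<in> Sym_gr N) \<Longrightarrow> L (sum f A) = (\<Sum>x\<in>A. L (f x))"
  by (induction A rule: infinite_finite_induct) (simp_all add: L_add Sym_sum)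

lemma L_sum2:
  assumes "\<And>j a. j \<in> A \<Longrightarrow> a \<in> B j \<Longrightarrow> f j a \<in> Sym_gr N"
  shows "L (\<Sum>j\<in>A. \<Sum>a\<in>B j. const_gpoly (c j a) * f j a) = (\<Sum>j\<in>A. \<Sum>a\<in>B j. c j a * L (f j a))"
proof -
  have "L (\<Sum>j\<in>A. \<Sum>a\<in>B j. const_gpoly (c j a) * f j a) = (\<Sum>j\<in>A. L (\<Sum>a\<in>B j. const_gpoly (c j a) * f j a))"
    using assms by (intro L_sum Sym_sum Sym_scale) auto
  also have "\<dots> = (\<Sum>j\<in>A. \<Sum>a\<in>B j. L (const_gpoly (c j a) * f j a))"
    using assms by (intro sum.cong refl L_sum Sym_scale) auto
  finally show ?thesis using assms by (simp add: L_scale)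
qed

lemma L_diff: "P \<in> Sym_gr N \<Longrightarrow> Q \<in> Sym_gr N \<Longrightarrow> L (P - Q) = L P - L Q"
  using L_add[of "P - Q" Q] Sym_diff[of P N Q] by simp

lemma Cauchy_Schwarz_L:
  assumes P: "P \<in> Sym_gr N" and Q: "Q \<in> Sym_gr N"
  shows "(L (P * Q))\<^sup>2 \<le> L (P * P) * L (Q * Q)"
proof -
  define a b d where a_b_d_def: "a = L (P * P)" "b = L (P * Q)" "d = L (Q * Q)"
  have quad: "0 \<le> s\<^sup>2 * a + 2 * s * t * b + t\<^sup>2 * d" for s t
  proof -
    let ?R = "const_gpoly s * P + const_gpoly t * Q"
    have R: "?R \<in> Sym_gr N" using P Q by (intro Sym_add Sym_scale)
    have "L (?R * ?R) = s * L (?R * P) + t * L (?R * Q)"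
      unfolding L_lin2[OF P Q R] mult.commute[of ?R P] mult.commute[of ?R Q] ..
    also have "\<dots> = s * (s * a + t * b) + t * (s * b + t * d)"
      unfolding a_b_d_def L_lin2[OF P Q P] L_lin2[OF P Q Q] mult.commute[of Q P] ..
    also have "\<dots> = s\<^sup>2 * a + 2 * s * t * b + t\<^sup>2 * d"
      by (simp add: power2_eq_square algebra_simps)
    finally have "L (?R * ?R) = s\<^sup>2 * a + 2 * s * t * b + t\<^sup>2 * d" .
    then show ?thesis using L_nonneg[of ?R] P Q by (simp add: Sym_add Sym_scale)
  qed
  show ?thesis
  proof (cases "a = 0")
    case True
    show ?thesis
    proof (cases "b = 0")
      case False
      have "0 \<le> 2 * (- (d + 1) / (2 * b)) * b + d" using quad[of "- (d + 1) / (2 * b)" 1] True by simp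
      then have False using False by (simp add: field_simps)
      then show ?thesis ..
    qed (use True in \<open>simp add: a_b_d_def\<close>)
  next
    case False
    then have a: "a > 0" using L_nonneg[OF P] by (simp add: a_b_d_def)
    have "0 \<le> (b / a)\<^sup>2 * a + 2 * (b / a) * (- 1) * b + (- 1)\<^sup>2 * d" by (rule quad)
    then have "b\<^sup>2 / a \<le> d" using a by (simp add: power2_eq_square field_simps)
    then show ?thesis using a by (simp add: a_b_d_def field_simps)
  qed
qed

end

text \<open>A normalized positive functional.\<close>

locale state = positive_functional +
  assumes L_1: "L 1 = 1"

text \<open>A family \<open>q j a\<close>, \<open>a < r j\<close>, that is orthonormal for the form \<open>L (P * Q)\<close> and whose members of
  index at most \<open>n\<close> form a basis of \<open>Pol N n\<close>, for every \<open>n\<close>.\<close>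

locale orthonormal_basis = state +
  fixes r :: "nat \<Rightarrow> nat" and q :: "nat \<Rightarrow> nat \<Rightarrow> gpoly"
  assumes q_Pol: "\<And>j a. a < r j \<Longrightarrow> q j a \<in> Pol N j"
    and q_orth: "\<And>j a l b. a < r j \<Longrightarrow> b < r l \<Longrightarrow> L (q j a * q l b) = (if j = l \<and> a = b then 1 else 0)"
    and q_span: "\<And>n. Pol N n \<subseteq> gp.span (fam r q n)"
begin

lemma q_Sym: "a < r j \<Longrightarrow> q j a \<in> Sym_gr N"
  using q_Pol Pol_Sym by blast

lemma expansion:
  assumes "P \<in> Pol N n"
  shows "P = (\<Sum>j\<le>n. \<Sum>a<r j. const_gpoly (L (P * q j a)) * q j a)"
proof -
  have "P \<in> Sym_gr N \<and> P = (\<Sum>j\<le>n. \<Sum>a<r j. const_gpoly (L (P * q j a)) * q j a)"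
    using subsetD[OF q_span assms]
  proof (induction rule: gp.span_induct_alt)
    case base
    then show ?case by (simp add: Sym_0)
  next
    case (step c x y)
    then obtain l b where l: "l \<le> n" "b < r l" "x = q l b" by auto
    have x: "x \<in> Sym_gr N" using l q_Sym by simp
    have y: "y \<in> Sym_gr N" and ys: "(\<Sum>j\<le>n. \<Sum>a<r j. const_gpoly (L (y * q j a)) * q j a) = y"
      using step.IH by auto
    have "(\<Sum>j\<le>n. \<Sum>a<r j. const_gpoly (L (x * q j a)) * q j a) = (\<Sum>j\<le>n. \<Sum>a<r j. if j = l \<and> a = b then q j a else 0)"
      using l by (intro sum.cong refl) (auto simp: q_orth)
    also have "\<dots> = (\<Sum>j\<le>n. if j = l then q l b else 0)"
      using l by (intro sum.cong refl) (auto simp: sum.delta)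
    also have "\<dots> = x" using l by (simp add: sum.delta)
    finally have xs: "(\<Sum>j\<le>n. \<Sum>a<r j. const_gpoly (L (x * q j a)) * q j a) = x" .
    have "(\<Sum>j\<le>n. \<Sum>a<r j. const_gpoly (L ((const_gpoly c * x + y) * q j a)) * q j a)
       = (\<Sum>j\<le>n. \<Sum>a<r j. const_gpoly c * (const_gpoly (L (x * q j a)) * q j a) + const_gpoly (L (y * q j a)) * q j a)"
      using x y
      by (intro sum.cong refl)
         (simp add: L_lin q_Sym, simp only: const_gpoly_add const_gpoly_mult distrib_right mult.assoc)
    also have "\<dots> = const_gpoly c * (\<Sum>j\<le>n. \<Sum>a<r j. const_gpoly (L (x * q j a)) * q j a)
        + (\<Sum>j\<le>n. \<Sum>a<r j. const_gpoly (L (y * q j a)) * q j a)"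
      by (simp only: sum.distrib sum_distrib_left)
    finally show ?case unfolding xs ys using x y by (simp add: Sym_add Sym_scale)
  qed
  then show ?thesis by simp
qed

lemma orth_lower_degree:
  assumes P: "P \<in> Pol N n" and "n < l" "b < r l"
  shows "L (P * q l b) = 0"
proof -
  have "P * q l b = (\<Sum>j\<le>n. \<Sum>a<r j. const_gpoly (L (P * q j a)) * (q j a * q l b))"
    by (subst (1) expansion[OF P]) (simp add: sum_distrib_right mult.assoc)
  also have "L \<dots> = (\<Sum>j\<le>n. \<Sum>a<r j. L (P * q j a) * L (q j a * q l b))"
    using assms by (intro L_sum2 Sym_mult q_Sym) auto
  also have "\<dots> = 0" using assms by (auto intro!: sum.neutral simp: q_orth)
  finally show ?thesis .
qed

lemma Parseval:
  assumes P: "P \<in> Pol N n" and Q: "Q \<in> Sym_gr N"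
  shows "L (P * Q) = (\<Sum>j\<le>n. \<Sum>a<r j. L (P * q j a) * L (q j a * Q))"
proof -
  have "P * Q = (\<Sum>j\<le>n. \<Sum>a<r j. const_gpoly (L (P * q j a)) * (q j a * Q))"
    by (subst (1) expansion[OF P]) (simp add: sum_distrib_right mult.assoc)
  also have "L \<dots> = (\<Sum>j\<le>n. \<Sum>a<r j. L (P * q j a) * L (q j a * Q))"
    using Q by (intro L_sum2 Sym_mult q_Sym) auto
  finally show ?thesis .
qed

lemma Bessel:
  assumes P: "P \<in> Sym_gr N"
  shows "(\<Sum>a<r j. (L (q j a * P))\<^sup>2) \<le> L (P * P)"
proof -
  obtain n0 where n0: "P \<in> Pol N n0" using Sym_in_Pol[OF P] .
  define n where "n = max n0 j"
  have n: "P \<in> Pol N n" "j \<le> n" using n0 Pol_mono[of n0 n N] by (auto simp: n_def)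
  have "L (P * P) = (\<Sum>l\<le>n. \<Sum>a<r l. (L (q l a * P))\<^sup>2)"
    by (subst Parseval[OF n(1) P]) (simp add: power2_eq_square mult.commute)
  also have "\<dots> \<ge> (\<Sum>l\<in>{j}. \<Sum>a<r l. (L (q l a * P))\<^sup>2)"
    using n(2) by (intro sum_mono2) (auto intro!: sum_nonneg)
  finally show ?thesis by simp
qed

text \<open>A polynomial of degree at most \<open>n\<close> that is orthogonal to the members of index \<open>n\<close> has degree less than \<open>n\<close>.\<close>

lemma degree_drop:
  assumes P: "P \<in> Pol N n" and n: "n \<ge> 1" and "\<And>a. a < r n \<Longrightarrow> L (P * q n a) = 0"
  shows "P \<in> Pol N (n - 1)"
proof -
  obtain k where k: "n = Suc k" using n by (cases n) auto
  have "P = (\<Sum>j\<le>n. \<Sum>a<r j. const_gpoly (L (P * q j a)) * q j a)" by (rule expansion[OF P])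
  also have "\<dots> = (\<Sum>j\<le>k. \<Sum>a<r j. const_gpoly (L (P * q j a)) * q j a)"
    using assms(3) unfolding k by simp
  also have "\<dots> \<in> Pol N k"
    using q_Pol Pol_mono by (intro gp.subspace_sum[OF subspace_Pol] gp.subspace_scale[OF subspace_Pol]) blast
  finally show ?thesis using k by simp
qed

end

text \<open>It suffices to check orthonormality for equal indices and orthogonality to the monomials of lower
  degree. An orthonormal family is independent, so the basis property follows by counting.\<close>

lemma (in state) orthonormal_basisI:
  assumes fin: "\<And>n. finite (monomials N n)" and r: "\<And>n. r n = num_monomials N n"
    and q_Pol: "\<And>j a. a < r j \<Longrightarrow> q j a \<in> Pol N j"
    and q_orth: "\<And>j a b. a < r j \<Longrightarrow> b < r j \<Longrightarrow> L (q j a * q j b) = (if a = b then 1 else 0)"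
    and q_low: "\<And>n j \<alpha> a. j < n \<Longrightarrow> \<alpha> \<in> monomials N j \<Longrightarrow> a < r n \<Longrightarrow> L (mon \<alpha> * q n a) = 0"
  shows "orthonormal_basis N L r q"
proof -
  have mon_Sym: "mon \<alpha> \<in> Sym_gr N" if "\<alpha> \<in> monomials N j" for \<alpha> j
    using that by (auto simp: Sym_gr_def monomials_def)
  have q_Sym: "q j a \<in> Sym_gr N" if "a < r j" for j a using q_Pol[OF that] Pol_Sym by blast
  have low: "P \<in> Sym_gr N \<and> L (P * q n a) = 0" if "P \<in> Pol N j" "j < n" "a < r n" for P j n a
    using that(1) unfolding Pol_eq_span
  proof (induction rule: gp.span_induct_alt)
    case base
    then show ?case by (simp add: Sym_0)
  next
    case (step c x y)
    then obtain l \<alpha> where l: "l \<le> j" "\<alpha> \<in> monomials N l" "x = mon \<alpha>" by auto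
    then have "L (x * q n a) = 0" "x \<in> Sym_gr N" using q_low[of l n \<alpha> a] that mon_Sym by auto
    then show ?case using step.IH q_Sym[OF that(3)]
      by (simp add: L_lin Sym_scale Sym_add)
  qed
  have orth: "L (q j a * q l b) = (if j = l \<and> a = b then 1 else 0)" if "a < r j" "b < r l" for j a l b
  proof (cases j l rule: linorder_cases)
    case less
    then show ?thesis using low[OF q_Pol[OF that(1)] less that(2)] by simp
  next
    case equal
    then show ?thesis using q_orth that by simp
  next
    case greater
    then show ?thesis using low[OF q_Pol[OF that(2)] greater that(1)] by (simp add: mult.commute)
  qed
  have inj: "inj_on (\<lambda>(j, a). q j a) (SIGMA j:{..n}. {..<r j})" for n
  proof (rule inj_onI, clarsimp)
    fix j a l b assume *: "a < r j" "b < r l" "q j a = q l b"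
    then show "j = l \<and> a = b" using orth[OF *(1) *(2)] orth[OF *(1) *(1)] by (auto split: if_splits)
  qed
  have ind: "gp.independent (fam r q n)" for n
  proof
    assume "gp.dependent (fam r q n)"
    then obtain t u where t: "finite t" "t \<subseteq> fam r q n" "(\<Sum>v\<in>t. const_gpoly (u v) * v) = 0" "\<exists>v\<in>t. u v \<noteq> 0"
      unfolding gp.dependent_explicit by blast
    have "u b = 0" if b: "b \<in> t" for b
    proof -
      have tS: "v \<in> Sym_gr N" if "v \<in> t" for v using that t(2) q_Sym by auto
      have "0 = L ((\<Sum>v\<in>t. const_gpoly (u v) * v) * b)" using t(3) by simp
      also have "\<dots> = (\<Sum>v\<in>t. u v * L (v * b))"
        using tS b by (simp add: sum_distrib_right mult.assoc L_sum L_scale Sym_mult Sym_scale)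
      also have "\<dots> = (\<Sum>v\<in>t. if v = b then u b else 0)"
      proof (intro sum.cong refl)
        fix v assume v: "v \<in> t"
        obtain j a l c where "v = q j a" "b = q l c" "a < r j" "c < r l"
          using subsetD[OF t(2) b] subsetD[OF t(2) v] by auto
        then show "u v * L (v * b) = (if v = b then u b else 0)" using orth[of a j c l] orth[of a j a j] by auto
      qed
      also have "\<dots> = u b" using b t(1) by (simp add: sum.delta)
      finally show ?thesis by simp
    qed
    then show False using t(4) by blast
  qed
  have "Pol N n \<subseteq> gp.span (fam r q n)" for n
    using q_Pol Pol_mono by (intro independent_family_spans[OF fin r ind inj]) force
  then show ?thesis using q_Pol orth by unfold_locales auto
qed

section \<open>Ranks and spectral norms\<close>

lemma mult_mat_vec_index:
  "A \<in> carrier_mat nr nc \<Longrightarrow> v \<in> carrier_vec nc \<Longrightarrow> i < nr \<Longrightarrow> vec_index (A *\<^sub>v v) i = (\<Sum>j<nc. A $$ (i, j) * vec_index v j)"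
  by (auto simp: mult_mat_vec_def scalar_prod_def atLeast0LessThan intro!: sum.cong)

lemma mat_rank_injective:
  assumes A: "A \<in> carrier_mat nr nc"
    and ker: "\<And>v. v \<in> carrier_vec nc \<Longrightarrow> A *\<^sub>v v = 0\<^sub>v nr \<Longrightarrow> v = 0\<^sub>v nc"
  shows "mat_rank A = nc"
proof -
  interpret vec_space "TYPE(real)" nr .
  have dist: "distinct (cols A)"
    unfolding distinct_conv_nth
  proof (intro allI impI)
    fix i j assume "i < length (cols A)" "j < length (cols A)" and ij: "i \<noteq> j"
    then have i: "i < nc" and j: "j < nc" using A by auto
    show "cols A ! i \<noteq> cols A ! j"
    proof
      assume "cols A ! i = cols A ! j"
      then have "col A i = col A j" using i j A by simp
      then have entries: "A $$ (a, i) = A $$ (a, j)" if "a < nr" for a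
        using that i j A by (metis carrier_matD index_col)
      let ?v = "unit_vec nc i - unit_vec nc j :: real Matrix.vec"
      have "A *\<^sub>v ?v = 0\<^sub>v nr"
      proof (rule eq_vecI)
        fix a assume "a < dim_vec (0\<^sub>v nr :: real Matrix.vec)"
        then have a: "a < nr" by simp
        have "vec_index (A *\<^sub>v ?v) a = (\<Sum>b<nc. A $$ (a, b) * ((if b = i then 1 else 0) - (if b = j then 1 else 0)))"
          using a i j by (subst mult_mat_vec_index[OF A]) (auto intro!: sum.cong)
        also have "\<dots> = A $$ (a, i) - A $$ (a, j)"
          using i j by (simp add: right_diff_distrib sum_subtractf if_distrib[of "\<lambda>x. _ * x"] sum.delta cong: if_cong)
        finally show "vec_index (A *\<^sub>v ?v) a = vec_index (0\<^sub>v nr) a" using entries[OF a] a by simp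
      qed (use A in simp)
      then have "?v = 0\<^sub>v nc" by (intro ker) auto
      then have "vec_index ?v i = 0" using i by (metis index_zero_vec(1))
      then show False using i j ij by simp
    qed
  qed
  have "lin_indpt (set (cols A))"
    using lin_depE[OF A _ dist] ker by metis
  from lin_indpt_full_rank[OF A dist this] show ?thesis
    using A by (simp add: mat_rank_def)
qed

lemma invertible_mat_injective:
  assumes A: "(A :: real Matrix.mat) \<in> carrier_mat n n"
    and ker: "\<And>v. v \<in> carrier_vec n \<Longrightarrow> A *\<^sub>v v = 0\<^sub>v n \<Longrightarrow> v = 0\<^sub>v n"
  obtains B where "B \<in> carrier_mat n n" "A * B = 1\<^sub>m n" "B * A = 1\<^sub>m n"
proof -
  have "det A \<noteq> 0" using det_0_iff_vec_prod_zero_field[OF A] ker by blast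
  from det_non_zero_imp_unit[OF A this, of "()"] show ?thesis
    using that by (auto simp: Units_def ring_mat_simps)
qed

text \<open>If \<open>A\<^sup>T\<close> is injective, then so is \<open>A A\<^sup>T\<close>, since \<open>A A\<^sup>T u = 0\<close> gives \<open>A\<^sup>T u\<close> norm \<open>0\<close>. Hence
  \<open>A\<^sup>T (A A\<^sup>T)\<^bsup>-1\<^esup>\<close> is a right inverse of \<open>A\<close>.\<close>

lemma transpose_injective_right_inverse:
  assumes A: "(A :: real Matrix.mat) \<in> carrier_mat nr nc"
    and ker: "\<And>u. u \<in> carrier_vec nr \<Longrightarrow> transpose_mat A *\<^sub>v u = 0\<^sub>v nc \<Longrightarrow> u = 0\<^sub>v nr"
  obtains B where "B \<in> carrier_mat nc nr" "A * B = 1\<^sub>m nr"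
proof -
  let ?T = "transpose_mat A"
  have T: "?T \<in> carrier_mat nc nr" using A by simp
  have N: "A * ?T \<in> carrier_mat nr nr" using A T by simp
  have "u = 0\<^sub>v nr" if u: "u \<in> carrier_vec nr" and z: "(A * ?T) *\<^sub>v u = 0\<^sub>v nr" for u
  proof (rule ker[OF u])
    let ?x = "\<lambda>j. vec_index (?T *\<^sub>v u) j"
    have Tu: "?T *\<^sub>v u \<in> carrier_vec nc" using T u by simp
    have x: "?x j = (\<Sum>i<nr. A $$ (i, j) * vec_index u i)" if "j < nc" for j
      using that A by (subst mult_mat_vec_index[OF T u]) (auto intro!: sum.cong)
    have Ax: "(\<Sum>j<nc. A $$ (i, j) * ?x j) = 0" if "i < nr" for i
    proof -
      have "vec_index (A *\<^sub>v (?T *\<^sub>v u)) i = 0"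
        using z that assoc_mult_mat_vec[OF A T u] by simp
      then show ?thesis using mult_mat_vec_index[OF A Tu that] by simp
    qed
    have "(\<Sum>j<nc. ?x j * ?x j) = (\<Sum>j<nc. \<Sum>i<nr. vec_index u i * (A $$ (i, j) * ?x j))"
      by (intro sum.cong refl) (simp add: x sum_distrib_right mult_ac)
    also have "\<dots> = (\<Sum>i<nr. vec_index u i * (\<Sum>j<nc. A $$ (i, j) * ?x j))"
      by (subst sum.swap) (simp add: sum_distrib_left)
    also have "\<dots> = 0" using Ax by simp
    finally have "\<forall>j\<in>{..<nc}. ?x j * ?x j = 0" by (subst (asm) sum_nonneg_eq_0_iff) auto
    then show "?T *\<^sub>v u = 0\<^sub>v nc" using Tu A by (intro eq_vecI) auto
  qed
  then obtain B where B: "B \<in> carrier_mat nr nr" "(A * ?T) * B = 1\<^sub>m nr"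
    using invertible_mat_injective[OF N] by blast
  then have "A * (?T * B) = 1\<^sub>m nr" using assoc_mult_mat[OF A T B(1)] by simp
  then show ?thesis using that[of "?T * B"] T B(1) by simp
qed

lemma mat_rank_surjective:
  assumes A: "A \<in> carrier_mat nr nc"
    and ker: "\<And>u. u \<in> carrier_vec nr \<Longrightarrow> transpose_mat A *\<^sub>v u = 0\<^sub>v nc \<Longrightarrow> u = 0\<^sub>v nr"
  shows "mat_rank A = nr"
proof -
  interpret vec_space "TYPE(real)" nr .
  obtain B where B: "B \<in> carrier_mat nc nr" "A * B = 1\<^sub>m nr"
    using transpose_injective_right_inverse[OF A ker] by blast
  have cA: "set (cols A) \<subseteq> carrier_vec nr" using cols_dim A by blast
  have "x \<in> span (set (cols A))" if x: "x \<in> carrier_vec nr" for x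
  proof -
    have Bx: "B *\<^sub>v x \<in> carrier_vec nc" using B(1) x by simp
    have v: "Matrix.vec nc (vec_index (B *\<^sub>v x)) = B *\<^sub>v x"
      using Bx B(1) by (intro eq_vecI) auto
    have "x = (A * B) *\<^sub>v x" using B x by simp
    also have "\<dots> = A *\<^sub>v (B *\<^sub>v x)" by (rule assoc_mult_mat_vec[OF A B(1) x])
    also have "\<dots> = lincomb_list (vec_index (B *\<^sub>v x)) (cols A)"
      using A cA v by (subst lincomb_list_as_mat_mult) (auto simp: mat_of_cols_cols)
    finally have "x \<in> span_list (cols A)" by (intro in_span_listI) auto
    then show ?thesis using span_list_as_span[OF cA] by simp
  qed
  then have "span (set (cols A)) = carrier_vec nr" using span_is_subset2[OF cA] by auto
  moreover have "vectorspace.dim class_ring (vs (carrier_vec nr)) = nr"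
    using dim_is_n by (simp add: module_vec_def)
  ultimately have "rank A = nr" unfolding rank_def by simp
  then show ?thesis using A by (simp add: mat_rank_def)
qed

lemma eucl_norm_sq:
  assumes "v \<in> carrier_vec n" shows "eucl_norm v = sqrt (\<Sum>i<n. (vec_index v i)\<^sup>2)"
  using assms by (auto simp: eucl_norm_def scalar_prod_def power2_eq_square atLeast0LessThan)

lemma spectral_norm_le:
  assumes A: "A \<in> carrier_mat nr nc" and C: "C \<ge> 0"
    and bd: "\<And>y. (\<Sum>a<nr. (\<Sum>b<nc. A $$ (a, b) * y b)\<^sup>2) \<le> C\<^sup>2 * (\<Sum>b<nc. (y b)\<^sup>2)"
  shows "spectral_norm A \<le> C"
  unfolding spectral_norm_def
proof (rule cSUP_least)
  show "{v \<in> carrier_vec (dim_col A). eucl_norm v \<le> 1} \<noteq> {}"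
    using eucl_norm_sq[of "0\<^sub>v nc" nc] A by (auto intro!: exI[of _ "0\<^sub>v nc"])
next
  fix v assume "v \<in> {v \<in> carrier_vec (dim_col A). eucl_norm v \<le> 1}"
  then have v: "v \<in> carrier_vec nc" "eucl_norm v \<le> 1" using A by auto
  have "eucl_norm (A *\<^sub>v v) = sqrt (\<Sum>a<nr. (\<Sum>b<nc. A $$ (a, b) * vec_index v b)\<^sup>2)"
    using A v mult_mat_vec_index[OF A v(1)] by (subst eucl_norm_sq[of _ nr]) (auto simp del: index_mult_mat_vec)
  also have "\<dots> \<le> sqrt (C\<^sup>2 * (\<Sum>b<nc. (vec_index v b)\<^sup>2))" using bd by simp
  also have "\<dots> = C * eucl_norm v" using C by (simp add: real_sqrt_mult eucl_norm_sq[OF v(1)])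
  also have "\<dots> \<le> C * 1" using v(2) C by (rule mult_left_mono)
  finally show "eucl_norm (A *\<^sub>v v) \<le> C" by simp
qed

text \<open>The supremum that defines \<open>spectral_norm\<close> says something only for a bounded set; the Frobenius norm
  bounds it.\<close>

lemma spectral_norm_bilinear:
  assumes A: "A \<in> carrier_mat nr nc"
  shows "\<bar>\<Sum>a<nr. \<Sum>b<nc. x a * A $$ (a, b) * y b\<bar>
    \<le> spectral_norm A * (sqrt (\<Sum>a<nr. (x a)\<^sup>2) * sqrt (\<Sum>b<nc. (y b)\<^sup>2))"
proof -
  let ?S = "{v \<in> carrier_vec (dim_col A). eucl_norm v \<le> 1}"
  let ?X = "sqrt (\<Sum>a<nr. (x a)\<^sup>2)" and ?Y = "sqrt (\<Sum>b<nc. (y b)\<^sup>2)"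
  have bil: "\<bar>\<Sum>a<nr. \<Sum>b<nc. x a * A $$ (a, b) * y b\<bar> \<le> ?X * sqrt (\<Sum>a<nr. (\<Sum>b<nc. A $$ (a, b) * y b)\<^sup>2)"
  proof -
    have "\<bar>\<Sum>a<nr. \<Sum>b<nc. x a * A $$ (a, b) * y b\<bar> = \<bar>\<Sum>a<nr. x a * (\<Sum>b<nc. A $$ (a, b) * y b)\<bar>"
      by (simp add: sum_distrib_left mult.assoc)
    also have "\<dots> \<le> (\<Sum>a<nr. \<bar>x a\<bar> * \<bar>\<Sum>b<nc. A $$ (a, b) * y b\<bar>)"
      using sum_abs[of "\<lambda>a. x a * (\<Sum>b<nc. A $$ (a, b) * y b)"] by (simp add: abs_mult)
    also have "\<dots> \<le> sqrt (\<Sum>a<nr. (x a)\<^sup>2) * sqrt (\<Sum>a<nr. (\<Sum>b<nc. A $$ (a, b) * y b)\<^sup>2)"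
      using L2_set_mult_ineq[where A = "{..<nr}" and f = x and g = "\<lambda>a. \<Sum>b<nc. A $$ (a, b) * y b"]
      unfolding L2_set_def .
    finally show ?thesis .
  qed
  have entries: "(\<Sum>a<nr. (\<Sum>b<nc. A $$ (a, b) * z b)\<^sup>2) \<le> (\<Sum>a<nr. \<Sum>b<nc. (A $$ (a, b))\<^sup>2) * (\<Sum>b<nc. (z b)\<^sup>2)" for z
    by (subst sum_distrib_right) (intro sum_mono Cauchy_Schwarz_ineq_sum)
  have norm_A: "eucl_norm (A *\<^sub>v v) = sqrt (\<Sum>a<nr. (\<Sum>b<nc. A $$ (a, b) * vec_index v b)\<^sup>2)"
    if "v \<in> carrier_vec nc" for v
    using A that mult_mat_vec_index[OF A that] by (subst eucl_norm_sq[of _ nr]) (auto simp del: index_mult_mat_vec)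
  have bdd: "bdd_above ((\<lambda>v. eucl_norm (A *\<^sub>v v)) ` ?S)"
  proof (rule bdd_aboveI2)
    fix v assume "v \<in> ?S"
    then have v: "v \<in> carrier_vec nc" "(\<Sum>b<nc. (vec_index v b)\<^sup>2) \<le> 1"
      using A by (auto simp: eucl_norm_sq)
    have "(\<Sum>a<nr. (\<Sum>b<nc. A $$ (a, b) * vec_index v b)\<^sup>2) \<le> (\<Sum>a<nr. \<Sum>b<nc. (A $$ (a, b))\<^sup>2) * 1"
      by (rule order.trans[OF entries mult_left_mono[OF v(2)]]) (auto intro!: sum_nonneg)
    then show "eucl_norm (A *\<^sub>v v) \<le> sqrt (\<Sum>a<nr. \<Sum>b<nc. (A $$ (a, b))\<^sup>2)"
      by (simp add: norm_A[OF v(1)])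
  qed
  have "sqrt (\<Sum>a<nr. (\<Sum>b<nc. A $$ (a, b) * y b)\<^sup>2) \<le> spectral_norm A * ?Y"
  proof (cases "?Y = 0")
    case True
    then have "\<forall>b\<in>{..<nc}. (y b)\<^sup>2 = 0"
      by (subst sum_nonneg_eq_0_iff[symmetric]) auto
    then show ?thesis by simp
  next
    case False
    moreover have "?Y \<ge> 0" by (simp add: sum_nonneg)
    ultimately have Y: "?Y > 0" by linarith
    have Y2: "?Y\<^sup>2 = (\<Sum>b<nc. (y b)\<^sup>2)" by (simp add: sum_nonneg)
    define v where "v = Matrix.vec nc (\<lambda>b. y b / ?Y)"
    have v: "v \<in> carrier_vec nc" by (simp add: v_def)
    have "(\<Sum>b<nc. (vec_index v b)\<^sup>2) = (\<Sum>b<nc. (y b)\<^sup>2) / ?Y\<^sup>2"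
      unfolding sum_divide_distrib by (intro sum.cong) (auto simp: v_def power_divide)
    then have "eucl_norm v \<le> 1" using Y Y2 by (simp add: eucl_norm_sq[OF v])
    then have "eucl_norm (A *\<^sub>v v) \<le> spectral_norm A"
      unfolding spectral_norm_def using v A by (intro cSUP_upper[OF _ bdd]) auto
    moreover have "eucl_norm (A *\<^sub>v v) = sqrt (\<Sum>a<nr. (\<Sum>b<nc. A $$ (a, b) * y b)\<^sup>2) / ?Y"
    proof -
      have "(\<Sum>a<nr. (\<Sum>b<nc. A $$ (a, b) * vec_index v b)\<^sup>2) = (\<Sum>a<nr. (\<Sum>b<nc. A $$ (a, b) * y b)\<^sup>2) / ?Y\<^sup>2"
        unfolding sum_divide_distrib
        by (intro sum.cong) (auto simp: v_def power_divide[symmetric] sum_divide_distrib)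
      then show ?thesis using Y by (simp add: norm_A[OF v] real_sqrt_divide)
    qed
    ultimately show ?thesis using Y by (simp add: field_simps)
  qed
  from order.trans[OF bil mult_left_mono[OF this]] show ?thesis
    by (simp add: sum_nonneg mult_ac)
qed

section \<open>The recurrence in coordinates\<close>

text \<open>The conditions on the matrices \<open>M\<^sup>k\<^sub>n\<^sub>,\<^sub>m\<^sub>,\<^sub>i\<close>, written \<open>M k n m i\<close>: their sizes, the recurrence, the ranks
  of the leading blocks, and the uniform bounds on the spectral norms.\<close>

definition jacobi_dims :: "(nat \<Rightarrow> nat) \<Rightarrow> (nat \<Rightarrow> nat) \<Rightarrow> (nat \<Rightarrow> nat \<Rightarrow> nat \<Rightarrow> nat \<Rightarrow> real Matrix.mat) \<Rightarrow> bool" where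
  "jacobi_dims N r M \<longleftrightarrow> (\<forall>n. \<forall>m\<in>{1..n}. \<forall>i\<in>{1..N m}. \<forall>k\<in>{0..m}.
     M k n m i \<in> carrier_mat (r (n - m)) (r (n - m + k)))"

definition jacobi_recurrence ::
    "(nat \<Rightarrow> nat) \<Rightarrow> (nat \<Rightarrow> nat) \<Rightarrow> (nat \<Rightarrow> gpoly Matrix.vec) \<Rightarrow>
      (nat \<Rightarrow> nat \<Rightarrow> nat \<Rightarrow> nat \<Rightarrow> real Matrix.mat) \<Rightarrow> bool" where
  "jacobi_recurrence N r p M \<longleftrightarrow> (\<forall>n. \<forall>m\<in>{1..n}. \<forall>i\<in>{1..N m}.
     w_var m i \<cdot>\<^sub>v p (n - m) =
       finsum_vec TYPE(gpoly) (r (n - m))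
         (\<lambda>k. mat_gpoly_mult (M k n m i) (p (n - m + k))) {0..m}
     + finsum_vec TYPE(gpoly) (r (n - m))
         (\<lambda>k. mat_gpoly_mult (transpose_mat (M k (n - k) m i)) (p (n - m - k)))
         {k \<in> {1..m}. m + k \<le> n})"

definition jacobi_rank ::
    "(nat \<Rightarrow> nat) \<Rightarrow> (nat \<Rightarrow> nat) \<Rightarrow> (nat \<Rightarrow> nat \<Rightarrow> nat \<Rightarrow> nat \<Rightarrow> real Matrix.mat) \<Rightarrow> bool" where
  "jacobi_rank N r M \<longleftrightarrow>
     (let A = (\<lambda>n m i. M m n m i); C = (\<lambda>n m i. transpose_mat (A n m i)) in
       \<forall>n\<ge>1.
         (\<forall>m\<in>{1..n}. \<forall>i\<in>{1..N m}.
            mat_rank (A n m i) = r (n - m) \<and> mat_rank (C n m i) = r (n - m)) \<and>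
         mat_rank (stack_blocks N n (r n) (A n)) = r n \<and>
         mat_rank (stack_blocks N n (r n) (\<lambda>m i. transpose_mat (C n m i))) = r n)"

definition jacobi_bounded ::
    "(nat \<Rightarrow> nat) \<Rightarrow> (nat \<Rightarrow> nat \<Rightarrow> nat \<Rightarrow> nat \<Rightarrow> real Matrix.mat) \<Rightarrow> bool" where
  "jacobi_bounded N M \<longleftrightarrow> (\<forall>m\<ge>1. \<forall>i\<in>{1..N m}. \<forall>k\<in>{- int m..int m}.
     bdd_above ((\<lambda>n. spectral_norm (ext_coeff M k n m i)) ` {n. m + nat (- k) \<le> n}))"

lemma mat_gpoly_mult_carrier:
  "A \<in> carrier_mat nr nc \<Longrightarrow> mat_gpoly_mult A p \<in> carrier_vec nr"
  by (auto simp: mat_gpoly_mult_def mult_mat_vec_def)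

lemma mat_gpoly_mult_index:
  assumes "A \<in> carrier_mat nr nc" "p \<in> carrier_vec nc" "a < nr"
  shows "vec_index (mat_gpoly_mult A p) a = (\<Sum>b<nc. const_gpoly (A $$ (a, b)) * vec_index p b)"
  using assms by (auto simp: mat_gpoly_mult_def mult_mat_vec_def scalar_prod_def atLeast0LessThan intro!: sum.cong)

lemma jacobi_recurrence_coords:
  assumes dims: "jacobi_dims N r M" and p: "\<And>n. p n \<in> carrier_vec (r n)"
    and m: "m \<in> {1..n}" and i: "i \<in> {1..N m}"
  shows "w_var m i \<cdot>\<^sub>v p (n - m) =
       finsum_vec TYPE(gpoly) (r (n - m))
         (\<lambda>k. mat_gpoly_mult (M k n m i) (p (n - m + k))) {0..m}
     + finsum_vec TYPE(gpoly) (r (n - m))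
         (\<lambda>k. mat_gpoly_mult (transpose_mat (M k (n - k) m i)) (p (n - m - k)))
         {k \<in> {1..m}. m + k \<le> n}
   \<longleftrightarrow> (\<forall>a<r (n - m). w_var m i * vec_index (p (n - m)) a =
         (\<Sum>k\<in>{0..m}. \<Sum>b<r (n - m + k). const_gpoly (M k n m i $$ (a, b)) * vec_index (p (n - m + k)) b)
       + (\<Sum>k\<in>{k \<in> {1..m}. m + k \<le> n}. \<Sum>b<r (n - m - k).
           const_gpoly (M k (n - k) m i $$ (b, a)) * vec_index (p (n - m - k)) b))"
    (is "?l = ?F + ?G \<longleftrightarrow> ?R")
proof -
  have M1: "M k n m i \<in> carrier_mat (r (n - m)) (r (n - m + k))" if "k \<in> {0..m}" for k
    using dims m i that unfolding jacobi_dims_def by blast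
  have M2: "M k (n - k) m i \<in> carrier_mat (r (n - m - k)) (r (n - m))" if "k \<in> {k \<in> {1..m}. m + k \<le> n}" for k
  proof -
    have "M k (n - k) m i \<in> carrier_mat (r (n - k - m)) (r (n - k - m + k))"
      using m i that by (intro dims[unfolded jacobi_dims_def, rule_format]) auto
    moreover have "n - k - m = n - m - k" "n - k - m + k = n - m" using that by auto
    ultimately show ?thesis by simp
  qed
  have M2T: "transpose_mat (M k (n - k) m i) \<in> carrier_mat (r (n - m)) (r (n - m - k))"
    if "k \<in> {k \<in> {1..m}. m + k \<le> n}" for k
    using M2[OF that] by simp
  have c1: "(\<lambda>k. mat_gpoly_mult (M k n m i) (p (n - m + k))) \<in> {0..m} \<rightarrow> carrier_vec (r (n - m))"
    using mat_gpoly_mult_carrier[OF M1] by blast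
  have c2: "(\<lambda>k. mat_gpoly_mult (transpose_mat (M k (n - k) m i)) (p (n - m - k)))
      \<in> {k \<in> {1..m}. m + k \<le> n} \<rightarrow> carrier_vec (r (n - m))"
    using mat_gpoly_mult_carrier[OF M2T] by blast
  have F: "?F \<in> carrier_vec (r (n - m))" and G: "?G \<in> carrier_vec (r (n - m))"
    using finsum_vec_closed[OF c1] finsum_vec_closed[OF c2] by simp_all
  have idx: "vec_index (?F + ?G) a =
         (\<Sum>k\<in>{0..m}. \<Sum>b<r (n - m + k). const_gpoly (M k n m i $$ (a, b)) * vec_index (p (n - m + k)) b)
       + (\<Sum>k\<in>{k \<in> {1..m}. m + k \<le> n}. \<Sum>b<r (n - m - k).
           const_gpoly (M k (n - k) m i $$ (b, a)) * vec_index (p (n - m - k)) b)" if a: "a < r (n - m)" for a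
  proof -
    have "vec_index ?F a = (\<Sum>k\<in>{0..m}. \<Sum>b<r (n - m + k). const_gpoly (M k n m i $$ (a, b)) * vec_index (p (n - m + k)) b)"
      using a by (subst index_finsum_vec[OF _ a c1]) (auto intro!: sum.cong mat_gpoly_mult_index[OF M1 p])
    moreover have "vec_index ?G a = (\<Sum>k\<in>{k \<in> {1..m}. m + k \<le> n}. \<Sum>b<r (n - m - k).
           const_gpoly (M k (n - k) m i $$ (b, a)) * vec_index (p (n - m - k)) b)"
    proof (subst index_finsum_vec[OF _ a c2], simp, rule sum.cong[OF refl])
      fix k assume k: "k \<in> {k \<in> {1..m}. m + k \<le> n}"
      show "vec_index (mat_gpoly_mult (transpose_mat (M k (n - k) m i)) (p (n - m - k))) a
        = (\<Sum>b<r (n - m - k). const_gpoly (M k (n - k) m i $$ (b, a)) * vec_index (p (n - m - k)) b)"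
        using M2[OF k] a by (subst mat_gpoly_mult_index[OF M2T[OF k] p a]) (auto intro!: sum.cong)
    qed
    ultimately show ?thesis using G a by simp
  qed
  have P: "dim_vec (p (n - m)) = r (n - m)" using p by simp
  have FG: "dim_vec (?F + ?G) = r (n - m)" using G by simp
  show ?thesis
  proof
    assume eq: "?l = ?F + ?G"
    show ?R
    proof (intro allI impI)
      fix a assume a: "a < r (n - m)"
      have "vec_index ?l a = vec_index (?F + ?G) a" using eq by simp
      then show "w_var m i * vec_index (p (n - m)) a =
           (\<Sum>k\<in>{0..m}. \<Sum>b<r (n - m + k). const_gpoly (M k n m i $$ (a, b)) * vec_index (p (n - m + k)) b)
         + (\<Sum>k\<in>{k \<in> {1..m}. m + k \<le> n}. \<Sum>b<r (n - m - k).
             const_gpoly (M k (n - k) m i $$ (b, a)) * vec_index (p (n - m - k)) b)"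
        unfolding idx[OF a] using a P by simp
    qed
  next
    assume R: ?R
    show "?l = ?F + ?G"
    proof (rule eq_vecI)
      fix a assume "a < dim_vec (?F + ?G)"
      then have a: "a < r (n - m)" using FG by simp
      show "vec_index ?l a = vec_index (?F + ?G) a"
        unfolding idx[OF a] using R a P by simp
    qed (use FG P in simp)
  qed
qed

text \<open>Indices \<open>l \<le> n\<close> are sorted according to their distance from \<open>n - m\<close>; those below \<open>n - 2 m\<close> do not contribute.\<close>

lemma sum_band:
  fixes f :: "nat \<Rightarrow> 'a::comm_monoid_add"
  assumes m: "m \<le> n" and z: "\<And>l. l + 2 * m < n \<Longrightarrow> f l = 0"
  shows "(\<Sum>l\<le>n. f l) = (\<Sum>k\<in>{0..m}. f (n - m + k)) + (\<Sum>k\<in>{k \<in> {1..m}. m + k \<le> n}. f (n - m - k))"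
proof -
  have "(\<Sum>l\<le>n. f l) = (\<Sum>l\<in>{n-m..n}. f l) + (\<Sum>l<n-m. f l)"
    by (subst sum.union_disjoint[symmetric]) (auto intro!: sum.cong)
  also have "(\<Sum>l\<in>{n-m..n}. f l) = (\<Sum>k\<in>{0..m}. f (n - m + k))"
    by (rule sum.reindex_bij_witness[where i = "\<lambda>k. n - m + k" and j = "\<lambda>l. l - (n - m)"]) (use m in auto)
  also have "(\<Sum>l<n-m. f l) = (\<Sum>l\<in>{l. l < n - m \<and> n \<le> l + 2 * m}. f l)"
    using z by (intro sum.mono_neutral_right) (auto simp: not_le)
  also have "\<dots> = (\<Sum>k\<in>{k \<in> {1..m}. m + k \<le> n}. f (n - m - k))"
    by (rule sum.reindex_bij_witness[where i = "\<lambda>k. n - m - k" and j = "\<lambda>l. n - m - l"]) (use m in auto)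
  finally show ?thesis .
qed

section \<open>Bounded functionals satisfy the recurrence\<close>

text \<open>Multiplication by every variable is bounded with respect to the seminorm \<open>sqrt (L (P * P))\<close>.\<close>

locale bounded_state = state +
  fixes c :: "nat \<times> nat \<Rightarrow> real"
  assumes c_pos: "\<And>v. v \<in> var_set N \<Longrightarrow> c v > 0"
    and L_bounded: "\<And>m i P. (m, i) \<in> var_set N \<Longrightarrow> P \<in> Sym_gr N \<Longrightarrow>
      L ((w_var m i * P) * (w_var m i * P)) \<le> (c (m, i))\<^sup>2 * L (P * P)"

locale bounded_orthonormal_basis = orthonormal_basis + bounded_state +
  assumes fin: "\<And>n. finite (monomials N n)" and r: "\<And>n. r n = num_monomials N n"
begin

text \<open>The matrix of multiplication by \<open>w\<^sub>m\<^sub>,\<^sub>i\<close> in the orthonormal basis.\<close>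

definition block :: "nat \<Rightarrow> nat \<Rightarrow> nat \<Rightarrow> nat \<Rightarrow> real Matrix.mat" where
  "block m i j l = Matrix.mat (r j) (r l) (\<lambda>(a, b). L (w_var m i * q j a * q l b))"

lemma block_carrier: "block m i j l \<in> carrier_mat (r j) (r l)"
  by (simp add: block_def)

lemma block_index: "a < r j \<Longrightarrow> b < r l \<Longrightarrow> block m i j l $$ (a, b) = L (w_var m i * q j a * q l b)"
  by (simp add: block_def)

lemma block_transpose: "transpose_mat (block m i j l) = block m i l j"
  by (rule eq_matI) (auto simp: block_def mult.assoc mult.commute[of "q l _"])

lemma lincomb_Sym: "(\<Sum>b<r l. const_gpoly (y b) * q l b) \<in> Sym_gr N"
  by (auto intro!: Sym_sum Sym_scale q_Sym)

lemma lincomb_Pol: "(\<Sum>b<r l. const_gpoly (y b) * q l b) \<in> Pol N l"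
  by (auto intro!: gp.subspace_sum[OF subspace_Pol] gp.subspace_scale[OF subspace_Pol] q_Pol)

lemma L_lincomb:
  assumes "P \<in> Sym_gr N"
  shows "L (P * (\<Sum>b<r l. const_gpoly (y b) * q l b)) = (\<Sum>b<r l. L (P * q l b) * y b)"
proof -
  have "P * (\<Sum>b<r l. const_gpoly (y b) * q l b) = (\<Sum>b<r l. const_gpoly (y b) * (P * q l b))"
    by (simp add: sum_distrib_left mult.left_commute)
  also have "L \<dots> = (\<Sum>b<r l. L (const_gpoly (y b) * (P * q l b)))"
    using assms by (intro L_sum Sym_scale Sym_mult q_Sym) auto
  also have "\<dots> = (\<Sum>b<r l. L (P * q l b) * y b)"
    using assms by (intro sum.cong refl) (simp add: L_scale Sym_mult q_Sym mult.commute)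
  finally show ?thesis .
qed

lemma L_lincomb_q:
  assumes "a < r l"
  shows "L (q l a * (\<Sum>b<r l. const_gpoly (y b) * q l b)) = y a"
proof -
  have "(\<Sum>b<r l. L (q l a * q l b) * y b) = (\<Sum>b<r l. if b = a then y b else 0)"
    using assms by (intro sum.cong refl) (auto simp: q_orth)
  then show ?thesis using assms by (simp add: L_lincomb q_Sym)
qed

lemma L_lincomb_square:
  "L ((\<Sum>b<r l. const_gpoly (y b) * q l b) * (\<Sum>b<r l. const_gpoly (y b) * q l b)) = (\<Sum>b<r l. (y b)\<^sup>2)"
proof -
  let ?Q = "\<Sum>b<r l. const_gpoly (y b) * q l b"
  have "L (?Q * ?Q) = (\<Sum>b<r l. L (?Q * q l b) * y b)" by (rule L_lincomb[OF lincomb_Sym])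
  also have "\<dots> = (\<Sum>b<r l. (y b)\<^sup>2)"
    by (intro sum.cong refl) (simp add: mult.commute[of ?Q] L_lincomb_q power2_eq_square)
  finally show ?thesis .
qed

text \<open>A block is the compression of a multiplication operator to finite-dimensional subspaces, so Bessel's
  inequality bounds its norm by that of the operator.\<close>

lemma block_norm:
  assumes v: "(m, i) \<in> var_set N"
  shows "spectral_norm (block m i j l) \<le> c (m, i)"
proof (rule spectral_norm_le[OF block_carrier])
  show "0 \<le> c (m, i)" using c_pos[OF v] by simp
  fix y :: "nat \<Rightarrow> real"
  let ?Q = "\<Sum>b<r l. const_gpoly (y b) * q l b"
  have "(\<Sum>b<r l. block m i j l $$ (a, b) * y b) = L (q j a * (w_var m i * ?Q))" if "a < r j" for a
  proof -
    have "(\<Sum>b<r l. block m i j l $$ (a, b) * y b) = (\<Sum>b<r l. L (w_var m i * q j a * q l b) * y b)"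
      using that by (intro sum.cong refl) (simp add: block_index)
    also have "\<dots> = L (w_var m i * q j a * ?Q)"
      using v that by (intro L_lincomb[symmetric] Sym_mult Sym_w_var q_Sym)
    finally show ?thesis by (simp only: mult.assoc mult.left_commute)
  qed
  then have "(\<Sum>a<r j. (\<Sum>b<r l. block m i j l $$ (a, b) * y b)\<^sup>2) = (\<Sum>a<r j. (L (q j a * (w_var m i * ?Q)))\<^sup>2)"
    by simp
  also have "\<dots> \<le> L ((w_var m i * ?Q) * (w_var m i * ?Q))"
    using v by (intro Bessel Sym_mult Sym_w_var lincomb_Sym)
  also have "\<dots> \<le> (c (m, i))\<^sup>2 * L (?Q * ?Q)" by (rule L_bounded[OF v lincomb_Sym])
  finally show "(\<Sum>a<r j. (\<Sum>b<r l. block m i j l $$ (a, b) * y b)\<^sup>2) \<le> (c (m, i))\<^sup>2 * (\<Sum>b<r l. (y b)\<^sup>2)"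
    by (simp only: L_lincomb_square)
qed

lemma block_recurrence:
  assumes m: "m \<in> {1..n}" and i: "i \<in> {1..N m}" and a: "a < r (n - m)"
  shows "w_var m i * q (n - m) a =
      (\<Sum>k\<in>{0..m}. \<Sum>b<r (n - m + k). const_gpoly (block m i (n - m) (n - m + k) $$ (a, b)) * q (n - m + k) b)
    + (\<Sum>k\<in>{k \<in> {1..m}. m + k \<le> n}. \<Sum>b<r (n - m - k).
        const_gpoly (block m i (n - k - m) (n - k - m + k) $$ (b, a)) * q (n - m - k) b)"
proof -
  have v: "(m, i) \<in> var_set N" using m i by (auto simp: var_set_def)
  have "w_var m i * q (n - m) a \<in> Pol N (n - m + m)" by (rule Pol_w_var_mult[OF v q_Pol[OF a]])
  then have "w_var m i * q (n - m) a \<in> Pol N n" using m by simp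
  from expansion[OF this]
  have "w_var m i * q (n - m) a = (\<Sum>l\<le>n. \<Sum>b<r l. const_gpoly (L (w_var m i * q (n - m) a * q l b)) * q l b)" .
  also have "\<dots> = (\<Sum>k\<in>{0..m}. \<Sum>b<r (n - m + k). const_gpoly (L (w_var m i * q (n - m) a * q (n - m + k) b)) * q (n - m + k) b)
     + (\<Sum>k\<in>{k \<in> {1..m}. m + k \<le> n}. \<Sum>b<r (n - m - k). const_gpoly (L (w_var m i * q (n - m) a * q (n - m - k) b)) * q (n - m - k) b)"
  proof (rule sum_band)
    show "m \<le> n" using m by simp
    fix l assume l: "l + 2 * m < n"
    show "(\<Sum>b<r l. const_gpoly (L (w_var m i * q (n - m) a * q l b)) * q l b) = 0"
    proof (rule sum.neutral, rule ballI)
      fix b assume "b \<in> {..<r l}"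
      then have "w_var m i * q l b \<in> Pol N (l + m)" by (intro Pol_w_var_mult[OF v q_Pol]) simp
      then have "L ((w_var m i * q l b) * q (n - m) a) = 0"
        using l a by (intro orth_lower_degree) auto
      moreover have "(w_var m i * q l b) * q (n - m) a = w_var m i * q (n - m) a * q l b"
        by (simp only: mult.assoc mult.commute[of "q (n - m) a"])
      ultimately have "L (w_var m i * q (n - m) a * q l b) = 0" by (simp only:)
      then show "const_gpoly (L (w_var m i * q (n - m) a * q l b)) * q l b = 0" by simp
    qed
  qed
  also have "(\<Sum>k\<in>{0..m}. \<Sum>b<r (n - m + k). const_gpoly (L (w_var m i * q (n - m) a * q (n - m + k) b)) * q (n - m + k) b)
    = (\<Sum>k\<in>{0..m}. \<Sum>b<r (n - m + k). const_gpoly (block m i (n - m) (n - m + k) $$ (a, b)) * q (n - m + k) b)"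
    using a by (intro sum.cong refl) (simp add: block_index)
  also have "(\<Sum>k\<in>{k \<in> {1..m}. m + k \<le> n}. \<Sum>b<r (n - m - k). const_gpoly (L (w_var m i * q (n - m) a * q (n - m - k) b)) * q (n - m - k) b)
    = (\<Sum>k\<in>{k \<in> {1..m}. m + k \<le> n}. \<Sum>b<r (n - m - k).
        const_gpoly (block m i (n - k - m) (n - k - m + k) $$ (b, a)) * q (n - m - k) b)"
  proof (intro sum.cong refl)
    fix k b assume k: "k \<in> {k \<in> {1..m}. m + k \<le> n}" and b: "b \<in> {..<r (n - m - k)}"
    have "n - k - m = n - m - k" "n - k - m + k = n - m" using k by auto
    then have "block m i (n - k - m) (n - k - m + k) $$ (b, a) = L (w_var m i * q (n - m - k) b * q (n - m) a)"
      using a b by (simp add: block_index)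
    also have "w_var m i * q (n - m - k) b * q (n - m) a = w_var m i * q (n - m) a * q (n - m - k) b"
      by (simp only: mult.assoc mult.commute[of "q (n - m) a"])
    finally show "const_gpoly (L (w_var m i * q (n - m) a * q (n - m - k) b)) * q (n - m - k) b
      = const_gpoly (block m i (n - k - m) (n - k - m + k) $$ (b, a)) * q (n - m - k) b" by simp
  qed
  finally show ?thesis .
qed

end

lemma mat_of_rows_kernel:
  assumes R: "set R \<subseteq> carrier_vec c" and v: "v \<in> carrier_vec c"
    and z: "mat_of_rows c R *\<^sub>v v = 0\<^sub>v (length R)" and \<rho>: "\<rho> \<in> set R"
  shows "scalar_prod \<rho> v = (0 :: real)"
proof -
  obtain k where k: "k < length R" "\<rho> = R ! k" using \<rho> by (auto simp: in_set_conv_nth)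
  then have "R ! k \<in> carrier_vec c" using R nth_mem by blast
  then have "vec_index (mat_of_rows c R *\<^sub>v v) k = scalar_prod \<rho> v"
    using k by simp
  then show ?thesis using z k by simp
qed

lemma stack_blocks_rank:
  assumes A: "\<And>m i. m \<in> {1..n} \<Longrightarrow> i \<in> {1..N m} \<Longrightarrow> dim_col (A m i) = c"
    and ker: "\<And>v. v \<in> carrier_vec c \<Longrightarrow>
      (\<And>m i a. m \<in> {1..n} \<Longrightarrow> i \<in> {1..N m} \<Longrightarrow> a < dim_row (A m i) \<Longrightarrow> scalar_prod (Matrix.row (A m i) a) v = 0)
      \<Longrightarrow> v = 0\<^sub>v c"
  shows "mat_rank (stack_blocks N n c A) = c"
proof -
  define R where "R = concat (map (\<lambda>m. concat (map (\<lambda>i. Matrix.rows (A m i)) [1..<Suc (N m)])) [1..<Suc n])"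
  have setR: "set R = (\<Union>m\<in>{1..n}. \<Union>i\<in>{1..N m}. set (Matrix.rows (A m i)))"
    unfolding R_def by (simp only: set_concat set_map set_upt image_image atLeastLessThanSuc_atLeastAtMost)
  have R: "set R \<subseteq> carrier_vec c"
    unfolding setR using A rows_carrier by (metis (no_types, lifting) UN_least)
  have "mat_of_rows c R \<in> carrier_mat (length R) c" by simp
  then have "mat_rank (mat_of_rows c R) = c"
  proof (rule mat_rank_injective)
    fix v assume v: "v \<in> carrier_vec c" and z: "mat_of_rows c R *\<^sub>v v = 0\<^sub>v (length R)"
    show "v = 0\<^sub>v c"
    proof (rule ker[OF v])
      fix m i a assume *: "m \<in> {1..n}" "i \<in> {1..N m}" "a < dim_row (A m i)"
      have "Matrix.row (A m i) a \<in> set (Matrix.rows (A m i))" using *(3) by (auto simp: Matrix.rows_def)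
      then have "Matrix.row (A m i) a \<in> set R" unfolding setR using *(1,2) by blast
      then show "scalar_prod (Matrix.row (A m i) a) v = 0" by (rule mat_of_rows_kernel[OF R v z])
    qed
  qed
  then show ?thesis by (simp add: stack_blocks_def R_def)
qed

context bounded_orthonormal_basis
begin

lemma block_scalar_row:
  assumes "(m, i) \<in> var_set N" "a < r j" "v \<in> carrier_vec (r l)"
  shows "scalar_prod (Matrix.row (block m i j l) a) v = L (w_var m i * q j a * (\<Sum>b<r l. const_gpoly (vec_index v b) * q l b))"
proof -
  have "scalar_prod (Matrix.row (block m i j l) a) v = (\<Sum>b<r l. L (w_var m i * q j a * q l b) * vec_index v b)"
    using assms by (auto simp: scalar_prod_def block_def atLeast0LessThan intro!: sum.cong)
  then show ?thesis using assms by (simp add: L_lincomb Sym_mult Sym_w_var q_Sym)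
qed

text \<open>A vector \<open>u\<close> in the kernel represents a combination \<open>Q\<close> of the \<open>q (n - m) a\<close> such that \<open>w Q\<close> is
  orthogonal to all \<open>q n b\<close>. Then \<open>w Q\<close> has degree less than \<open>n\<close>, so \<open>Q\<close> has degree less than
  \<open>n - m\<close>, and is orthogonal to itself.\<close>

lemma leading_block_transpose_injective:
  assumes m: "m \<in> {1..n}" and i: "i \<in> {1..N m}" and u: "u \<in> carrier_vec (r (n - m))"
    and z: "transpose_mat (block m i (n - m) n) *\<^sub>v u = 0\<^sub>v (r n)"
  shows "u = 0\<^sub>v (r (n - m))"
proof -
  have v: "(m, i) \<in> var_set N" using m i by (auto simp: var_set_def)
  let ?Q = "\<Sum>a<r (n - m). const_gpoly (vec_index u a) * q (n - m) a"
  have Q: "?Q \<in> Pol N (n - m)" by (rule lincomb_Pol)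
  have "w_var m i * ?Q \<in> Pol N (n - m + m)" by (rule Pol_w_var_mult[OF v Q])
  then have wQ: "w_var m i * ?Q \<in> Pol N n" using m by simp
  have "L ((w_var m i * ?Q) * q n b) = 0" if b: "b < r n" for b
  proof -
    have "vec_index (block m i n (n - m) *\<^sub>v u) b = 0" using z b by (simp only: block_transpose index_zero_vec)
    then have "scalar_prod (Matrix.row (block m i n (n - m)) b) u = 0" using b by (simp add: block_def)
    then have "L (w_var m i * q n b * ?Q) = 0" by (simp only: block_scalar_row[OF v b u])
    moreover have "w_var m i * q n b * ?Q = (w_var m i * ?Q) * q n b"
      by (simp only: mult.assoc mult.commute[of ?Q])
    ultimately show ?thesis by (simp only:)
  qed
  then have wQ': "w_var m i * ?Q \<in> Pol N (n - 1)" using m by (intro degree_drop[OF wQ]) auto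
  have "L (?Q * q (n - m) a) = 0" if a: "a < r (n - m)" for a
  proof (cases "n = m")
    case True
    \<comment> \<open>No nonzero multiple of the variable has degree less than \<open>m\<close>.\<close>
    have "Poly_Mapping.keys ?Q = {}"
    proof (rule ccontr)
      assume "Poly_Mapping.keys ?Q \<noteq> {}"
      then obtain \<alpha> where "\<alpha> \<in> Poly_Mapping.keys ?Q" by blast
      then have "Poly_Mapping.single (m, i) 1 + \<alpha> \<in> Poly_Mapping.keys (w_var m i * ?Q)"
        unfolding in_keys_iff w_var_def lookup_mon_mult .
      then have "mono_degree (Poly_Mapping.single (m, i) 1 + \<alpha>) \<le> n - 1"
        using wQ' unfolding Pol_def by blast
      then show False using True m by (simp add: mono_degree_add)
    qed
    then have "?Q = 0" by simp
    then show ?thesis by (simp only: mult_zero_left L_0)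
  next
    case False
    then have e: "n - 1 = (n - m - 1) + m" "n - m - 1 < n - m" using m by auto
    have "?Q \<in> Pol N (n - m - 1)"
      by (rule Pol_w_var_cancel[OF lincomb_Sym wQ'[unfolded e(1)]])
    then show ?thesis using e(2) a by (rule orth_lower_degree)
  qed
  then have "vec_index u a = 0" if "a < r (n - m)" for a
    using that L_lincomb_q[OF that, of "vec_index u"] by (simp only: mult.commute[of "q _ _" ?Q])
  then show ?thesis using u by (intro eq_vecI) auto
qed

text \<open>A vector in the kernel of all leading blocks represents a combination \<open>Q\<close> of the \<open>q n b\<close> that is
  orthogonal to all products \<open>w P\<close> with \<open>P\<close> of degree at most \<open>n - m\<close>. These products and \<open>1\<close> generate
  all polynomials of degree at most \<open>n\<close>, so \<open>Q\<close> is orthogonal to itself.\<close>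

lemma leading_blocks_injective:
  assumes n: "n \<ge> 1" and v: "v \<in> carrier_vec (r n)"
    and z: "\<And>m i a. m \<in> {1..n} \<Longrightarrow> i \<in> {1..N m} \<Longrightarrow> a < r (n - m) \<Longrightarrow>
      scalar_prod (Matrix.row (block m i (n - m) n) a) v = 0"
  shows "v = 0\<^sub>v (r n)"
proof -
  let ?Q = "\<Sum>b<r n. const_gpoly (vec_index v b) * q n b"
  let ?V = "{P \<in> Sym_gr N. L (P * ?Q) = 0}"
  have Q: "?Q \<in> Sym_gr N" by (rule lincomb_Sym)
  have low: "L (P * ?Q) = 0" if "P \<in> Pol N k" "k < n" for P k
    using that by (subst L_lincomb) (auto simp: Pol_Sym orth_lower_degree)
  have V: "gp.subspace ?V"
    using Q unfolding gp.subspace_def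
    by (auto simp: Sym_0 Sym_add Sym_scale distrib_right mult.assoc L_add L_scale Sym_mult simp del: sum_distrib_left)
  have "Pol N n \<subseteq> ?V"
  proof (rule Pol_subset_if_products[OF V])
    show "1 \<in> ?V" using low[OF Pol_1[of N 0]] n Sym_1 by simp
    fix m i P assume m: "1 \<le> m" "m \<le> n" and i: "i \<in> {1..N m}" and P: "P \<in> Pol N (n - m)"
    have mi: "(m, i) \<in> var_set N" using m i by (auto simp: var_set_def)
    have span: "P \<in> gp.span (fam r q (n - m))" using P q_span by blast
    let ?U = "{P \<in> Sym_gr N. w_var m i * P \<in> ?V}"
    have "gp.subspace ?U"
      unfolding gp.subspace_def
      using gp.subspace_0[OF V] gp.subspace_add[OF V] gp.subspace_scale[OF V]
      by (auto simp only: mem_Collect_eq mult_zero_right distrib_left mult.left_commute[of "w_var m i"] Sym_0 Sym_add Sym_scale)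
    moreover have "fam r q (n - m) \<subseteq> ?U"
    proof (rule image_subsetI)
      fix x assume "x \<in> (SIGMA j:{..n - m}. {..<r j})"
      then obtain j a where x: "x = (j, a)" and j: "j \<in> {..n - m}" and a: "a \<in> {..<r j}" by blast
      have qs: "q j a \<in> Sym_gr N" "w_var m i * q j a \<in> Sym_gr N"
        using a mi by (auto intro!: q_Sym Sym_mult Sym_w_var)
      have "L (w_var m i * q j a * ?Q) = 0"
      proof (cases "j = n - m")
        case True
        then show ?thesis using z[OF _ i, of a] m a block_scalar_row[OF mi _ v, of a "n - m"] by simp
      next
        case False
        have "w_var m i * q j a \<in> Pol N (j + m)" using a by (intro Pol_w_var_mult[OF mi q_Pol]) simp
        moreover have "j + m < n" using False j m by auto
        ultimately show ?thesis by (rule low)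
      qed
      then have "q j a \<in> ?U" using qs by blast
      then show "(case x of (j, a) \<Rightarrow> q j a) \<in> ?U" by (simp only: x prod.case)
    qed
    ultimately show "w_var m i * P \<in> ?V" using gp.span_minimal span by blast
  qed
  then have "L (q n a * ?Q) = 0" if "a < r n" for a using q_Pol[OF that] by blast
  then have "vec_index v a = 0" if "a < r n" for a
    using that L_lincomb_q[OF that, of "vec_index v"] by (simp only:)
  then show ?thesis using v by (intro eq_vecI) auto
qed

theorem jacobi_of_bounded:
  assumes p: "\<And>n. p n \<in> carrier_vec (r n)" and q: "\<And>n a. a < r n \<Longrightarrow> vec_index (p n) a = q n a"
  obtains M where "jacobi_dims N r M" "jacobi_recurrence N r p M" "jacobi_rank N r M" "jacobi_bounded N M"
proof -
  define M where "M = (\<lambda>k n m i. block m i (n - m) (n - m + k))"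
  have dims: "jacobi_dims N r M" by (auto simp: jacobi_dims_def M_def block_carrier)
  have rec: "jacobi_recurrence N r p M"
    unfolding jacobi_recurrence_def
  proof (intro allI ballI)
    fix n m i assume mi: "m \<in> {1..n}" "i \<in> {1..N m}"
    show "w_var m i \<cdot>\<^sub>v p (n - m) =
       finsum_vec TYPE(gpoly) (r (n - m))
         (\<lambda>k. mat_gpoly_mult (M k n m i) (p (n - m + k))) {0..m}
     + finsum_vec TYPE(gpoly) (r (n - m))
         (\<lambda>k. mat_gpoly_mult (transpose_mat (M k (n - k) m i)) (p (n - m - k)))
         {k \<in> {1..m}. m + k \<le> n}"
      unfolding jacobi_recurrence_coords[OF dims p mi]
    proof (intro allI impI)
      fix a assume a: "a < r (n - m)"
      show "w_var m i * vec_index (p (n - m)) a =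
         (\<Sum>k\<in>{0..m}. \<Sum>b<r (n - m + k). const_gpoly (M k n m i $$ (a, b)) * vec_index (p (n - m + k)) b)
       + (\<Sum>k\<in>{k \<in> {1..m}. m + k \<le> n}. \<Sum>b<r (n - m - k).
           const_gpoly (M k (n - k) m i $$ (b, a)) * vec_index (p (n - m - k)) b)"
        unfolding M_def using block_recurrence[OF mi a] a by (simp add: q)
    qed
  qed
  have rank: "jacobi_rank N r M"
    unfolding jacobi_rank_def Let_def transpose_transpose
  proof (intro allI impI conjI ballI)
    fix n m i assume m: "m \<in> {1..n}" and i: "i \<in> {1..N m}"
    have M: "M m n m i = block m i (n - m) n" using m by (simp add: M_def)
    show "mat_rank (M m n m i) = r (n - m)"
      unfolding M by (rule mat_rank_surjective[OF block_carrier leading_block_transpose_injective[OF m i]])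
    have "transpose_mat (block m i (n - m) n) \<in> carrier_mat (r n) (r (n - m))"
      using block_carrier by simp
    then show "mat_rank (transpose_mat (M m n m i)) = r (n - m)"
      unfolding M by (rule mat_rank_injective[OF _ leading_block_transpose_injective[OF m i]])
  next
    fix n :: nat assume n: "1 \<le> n"
    show "mat_rank (stack_blocks N n (r n) (\<lambda>m i. M m n m i)) = r n"
      "mat_rank (stack_blocks N n (r n) (\<lambda>m i. M m n m i)) = r n"
      using n by (auto intro!: stack_blocks_rank leading_blocks_injective simp: M_def block_def)
  qed
  have "spectral_norm (ext_coeff M k n m i) \<le> c (m, i)" if "m \<ge> 1" "i \<in> {1..N m}" for k n m i
    using that block_norm[of m i] by (auto simp: ext_coeff_def M_def block_transpose var_set_def)
  then have "jacobi_bounded N M"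
    unfolding jacobi_bounded_def by (intro allI impI ballI bdd_aboveI2) blast
  then show ?thesis using that dims rec rank by blast
qed

end

section \<open>The functional defined by a recurrence\<close>

text \<open>The coefficient of \<open>q j b\<close> in \<open>w\<^sub>m\<^sub>,\<^sub>i q l c\<close> that the recurrence prescribes.\<close>

definition jac_entry ::
    "(nat \<Rightarrow> nat \<Rightarrow> nat \<Rightarrow> nat \<Rightarrow> real Matrix.mat) \<Rightarrow> nat \<Rightarrow> nat \<Rightarrow> nat \<Rightarrow> nat \<Rightarrow> nat \<Rightarrow> nat \<Rightarrow> real" where
  "jac_entry M m i l c j b =
     (if l \<le> j then (if j - l \<le> m then M (j - l) (l + m) m i $$ (c, b) else 0)
      else (if l - j \<le> m then M (l - j) (j + m) m i $$ (b, c) else 0))"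

lemma jac_entry_sym: "l \<noteq> j \<Longrightarrow> jac_entry M m i l c j b = jac_entry M m i j b l c"
  by (auto simp: jac_entry_def)

lemma jac_entry_expansion:
  assumes dims: "jacobi_dims N r M" and p: "\<And>n. p n \<in> carrier_vec (r n)"
    and rec: "jacobi_recurrence N r p M" and m: "m \<ge> 1" and i: "i \<in> {1..N m}" and c: "c < r l"
  shows "w_var m i * vec_index (p l) c =
    (\<Sum>j\<le>l+m. \<Sum>b<r j. const_gpoly (jac_entry M m i l c j b) * vec_index (p j) b)"
proof -
  have m': "m \<in> {1..l+m}" using m by simp
  have lm: "l + m - m = l" by simp
  have "w_var m i * vec_index (p l) c =
       (\<Sum>k\<in>{0..m}. \<Sum>b<r (l + k). const_gpoly (M k (l + m) m i $$ (c, b)) * vec_index (p (l + k)) b)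
     + (\<Sum>k\<in>{k \<in> {1..m}. m + k \<le> l + m}. \<Sum>b<r (l - k).
         const_gpoly (M k (l + m - k) m i $$ (b, c)) * vec_index (p (l - k)) b)"
    using jacobi_recurrence_coords[OF dims p m' i, THEN iffD1, OF rec[unfolded jacobi_recurrence_def, rule_format, OF m' i]] c
    unfolding lm by blast
  also have "\<dots> = (\<Sum>k\<in>{0..m}. \<Sum>b<r (l + k). const_gpoly (jac_entry M m i l c (l + k) b) * vec_index (p (l + k)) b)
     + (\<Sum>k\<in>{k \<in> {1..m}. m + k \<le> l + m}. \<Sum>b<r (l - k).
         const_gpoly (jac_entry M m i l c (l - k) b) * vec_index (p (l - k)) b)"
  proof (rule arg_cong2[where f = "(+)"]; intro sum.cong refl arg_cong2[where f = "(*)"] arg_cong[where f = const_gpoly])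
    fix k b assume "k \<in> {k \<in> {1..m}. m + k \<le> l + m}"
    then show "M k (l + m - k) m i $$ (b, c) = jac_entry M m i l c (l - k) b"
      by (auto simp: jac_entry_def)
  qed (auto simp: jac_entry_def)
  also have "\<dots> = (\<Sum>j\<le>l+m. \<Sum>b<r j. const_gpoly (jac_entry M m i l c j b) * vec_index (p j) b)"
    using sum_band[of m "l + m" "\<lambda>j. \<Sum>b<r j. const_gpoly (jac_entry M m i l c j b) * vec_index (p j) b"]
    by (simp add: jac_entry_def)
  finally show ?thesis .
qed

text \<open>A family that satisfies the recurrence, in the form of an expansion with the coefficients
  \<open>jac_entry\<close>, and the bounds. The ranks of the leading blocks play no role.\<close>

locale jacobi_family =
  fixes N r :: "nat \<Rightarrow> nat" and q :: "nat \<Rightarrow> nat \<Rightarrow> gpoly"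
    and M :: "nat \<Rightarrow> nat \<Rightarrow> nat \<Rightarrow> nat \<Rightarrow> real Matrix.mat"
  assumes fin: "\<And>n. finite (monomials N n)" and r: "\<And>n. r n = num_monomials N n"
    and q_0: "q 0 0 = 1"
    and dims: "jacobi_dims N r M"
    and expansion: "\<And>m i l c. m \<ge> 1 \<Longrightarrow> i \<in> {1..N m} \<Longrightarrow> c < r l \<Longrightarrow> w_var m i * q l c =
      (\<Sum>j\<le>l+m. \<Sum>b<r j. const_gpoly (jac_entry M m i l c j b) * q j b)"
    and bounded: "jacobi_bounded N M"
begin

lemma r_0: "r 0 = 1"
  by (simp add: r num_monomials_def monomials_0)

text \<open>The span of the family contains \<open>q 0 0 = 1\<close>, and multiplication by \<open>w\<^sub>m\<^sub>,\<^sub>i\<close> raises the index by at most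
  \<open>m\<close>.\<close>

lemma Pol_span: "Pol N n \<subseteq> gp.span (fam r q n)"
proof (induction n rule: less_induct)
  case (less n)
  show ?case
  proof (rule Pol_subset_if_products[OF gp.subspace_span])
    have "q 0 0 \<in> fam r q n" by (rule fam_memI) (auto simp: r_0)
    then show "1 \<in> gp.span (fam r q n)" using gp.span_base q_0 by metis
    fix m i P assume m: "1 \<le> m" "m \<le> n" and i: "i \<in> {1..N m}" and "P \<in> Pol N (n - m)"
    then have "P \<in> gp.span (fam r q (n - m))" using less[of "n - m"] by auto
    then show "w_var m i * P \<in> gp.span (fam r q n)"
    proof (induction rule: gp.span_induct_alt)
      case base
      then show ?case by (simp add: gp.span_zero)
    next
      case (step c x y)
      then obtain l a where l: "l \<le> n - m" "a < r l" "x = q l a" by auto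
      have "w_var m i * x \<in> gp.span (fam r q n)"
        unfolding l(3) expansion[OF m(1) i l(2)]
        using l(1) m(2) by (intro gp.span_sum gp.span_scale gp.span_base fam_memI) auto
      then show ?case
        using step.IH by (simp only: distrib_left mult.left_commute[of "w_var m i"] gp.span_add gp.span_scale)
    qed
  qed
qed

lemmas q_basis = spanning_family_is_basis[OF fin r Pol_span]

lemma q_inj: "a < r j \<Longrightarrow> b < r l \<Longrightarrow> q j a = q l b \<Longrightarrow> j = l \<and> a = b"
  using inj_onD[OF q_basis(1)[of "max j l"], of "(j, a)" "(l, b)"] by auto

lemma q_Pol: "a < r j \<Longrightarrow> q j a \<in> Pol N j"
  using q_basis(3)[of j] gp.span_base[OF fam_memI[of j j a r q]] by auto

lemma q_Sym: "a < r j \<Longrightarrow> q j a \<in> Sym_gr N"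
  using q_Pol Pol_Sym by blast

text \<open>The whole family as a basis of \<open>Sym_gr N\<close>.\<close>

definition B :: "gpoly set" where "B = (\<Union>n. fam r q n)"

lemma q_B: "a < r j \<Longrightarrow> q j a \<in> B"
  unfolding B_def using fam_memI[of j j a r q] by blast

lemma B_cases: "b \<in> B \<Longrightarrow> (\<And>j a. a < r j \<Longrightarrow> b = q j a \<Longrightarrow> thesis) \<Longrightarrow> thesis"
  unfolding B_def by auto

lemma independent_B: "gp.independent B"
  unfolding B_def
proof (rule gp.independent_Union_directed)
  fix c d assume "c \<in> range (fam r q)" "d \<in> range (fam r q)"
  then obtain m n where "c = fam r q m" "d = fam r q n" by blast
  moreover have "fam r q m \<subseteq> fam r q n" if "m \<le> n" for m n
    using that by (intro image_mono Sigma_mono) auto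
  ultimately show "c \<subseteq> d \<or> d \<subseteq> c" by (meson nat_le_linear)
qed (use q_basis(2) in blast)

lemma span_B: "gp.span B = Sym_gr N"
proof
  show "gp.span B \<subseteq> Sym_gr N"
    by (rule gp.span_minimal[OF _ subspace_Sym]) (auto elim!: B_cases simp: q_Sym)
  show "Sym_gr N \<subseteq> gp.span B"
  proof
    fix P assume "P \<in> Sym_gr N"
    then obtain n where "P \<in> Pol N n" by (rule Sym_in_Pol)
    then show "P \<in> gp.span B"
      using Pol_span[of n] gp.span_mono[of "fam r q n" B] unfolding B_def by blast
  qed
qed

text \<open>The inner product for which the family is orthonormal, and the functional that it induces.\<close>

definition ip :: "gpoly \<Rightarrow> gpoly \<Rightarrow> real" where
  "ip P Q = (\<Sum>b\<in>{b. gp.representation B P b \<noteq> 0}. gp.representation B P b * gp.representation B Q b)"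

definition L :: "gpoly \<Rightarrow> real" where
  "L P = ip P 1"

lemma ip_commute: "ip P Q = ip Q P"
proof -
  let ?S = "\<lambda>P. {b. gp.representation B P b \<noteq> 0}"
  have fin: "finite (?S P)" for P by (rule gp.finite_representation)
  have "ip P Q = (\<Sum>b\<in>?S P \<union> ?S Q. gp.representation B P b * gp.representation B Q b)" for P Q
    unfolding ip_def by (rule sum.mono_neutral_left) (auto simp: fin)
  from this[of P Q] this[of Q P] show ?thesis by (simp add: Un_commute mult.commute)
qed

lemma ip_lin_right:
  assumes "P \<in> Sym_gr N" "Q \<in> Sym_gr N"
  shows "ip R (const_gpoly c * P + Q) = c * ip R P + ip R Q"
  using assms unfolding ip_def
  by (simp add: gp.representation_add[OF independent_B] gp.representation_scale[OF independent_B] span_B Sym_scale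
      distrib_left sum.distrib sum_distrib_left mult.left_commute)

lemma ip_0_right [simp]: "ip P 0 = 0"
  by (simp add: ip_def gp.representation_zero)

lemma ip_lin_left:
  assumes "P \<in> Sym_gr N" "Q \<in> Sym_gr N"
  shows "ip (const_gpoly c * P + Q) R = c * ip P R + ip Q R"
  using ip_lin_right[OF assms, of R c] by (simp only: ip_commute)

lemma ip_sum_right:
  assumes "\<And>x. x \<in> A \<Longrightarrow> f x \<in> Sym_gr N"
  shows "ip R (\<Sum>x\<in>A. const_gpoly (c x) * f x) = (\<Sum>x\<in>A. c x * ip R (f x))"
  using assms
proof (induction A rule: infinite_finite_induct)
  case (insert x A)
  then have "(\<Sum>x\<in>A. const_gpoly (c x) * f x) \<in> Sym_gr N" by (auto intro!: Sym_sum Sym_scale)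
  then show ?case using insert by (simp add: ip_lin_right)
qed auto

lemma ip_nonneg: "ip P P \<ge> 0"
  by (simp add: ip_def sum_nonneg)

lemma ip_q: "a < r j \<Longrightarrow> b < r l \<Longrightarrow> ip (q j a) (q l b) = (if j = l \<and> a = b then 1 else 0)"
  using q_inj[of a j b l]
  by (auto simp: ip_def gp.representation_basis[OF independent_B q_B])

lemma ip_w_var_q:
  assumes m: "m \<ge> 1" and i: "i \<in> {1..N m}" and c: "c < r l" and b: "b < r j"
  shows "ip (q j b) (w_var m i * q l c) = jac_entry M m i l c j b"
proof -
  have "ip (q j b) (w_var m i * q l c) = ip (q j b) (\<Sum>k\<le>l+m. const_gpoly 1 * (\<Sum>d<r k. const_gpoly (jac_entry M m i l c k d) * q k d))"
    by (simp add: expansion[OF m i c])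
  also have "\<dots> = (\<Sum>k\<le>l+m. 1 * ip (q j b) (\<Sum>d<r k. const_gpoly (jac_entry M m i l c k d) * q k d))"
    by (intro ip_sum_right Sym_sum Sym_scale q_Sym) auto
  also have "\<dots> = (\<Sum>k\<le>l+m. \<Sum>d<r k. jac_entry M m i l c k d * ip (q j b) (q k d))"
    unfolding mult_1 by (intro sum.cong refl ip_sum_right q_Sym) simp
  also have "\<dots> = (\<Sum>k\<le>l+m. if k = j then jac_entry M m i l c j b else 0)"
  proof (intro sum.cong refl)
    fix k
    have "(\<Sum>d<r k. jac_entry M m i l c k d * ip (q j b) (q k d)) = (\<Sum>d<r k. if d = b then (if k = j then jac_entry M m i l c j b else 0) else 0)"
      using b by (intro sum.cong refl) (auto simp: ip_q)
    also have "\<dots> = (if k = j then jac_entry M m i l c j b else 0)"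
      using b by (auto simp: sum.delta)
    finally show "(\<Sum>d<r k. jac_entry M m i l c k d * ip (q j b) (q k d)) = (if k = j then jac_entry M m i l c j b else 0)" .
  qed
  also have "\<dots> = jac_entry M m i l c j b"
    by (auto simp: sum.delta jac_entry_def)
  finally show ?thesis .
qed

lemma L_add: "P \<in> Sym_gr N \<Longrightarrow> Q \<in> Sym_gr N \<Longrightarrow> L (P + Q) = L P + L Q"
  using ip_lin_left[of P Q 1 1] by (simp add: L_def)

lemma L_scale: "P \<in> Sym_gr N \<Longrightarrow> L (const_gpoly c * P) = c * L P"
  using ip_lin_left[of P 0 c 1] by (simp add: L_def Sym_0 ip_commute[of 0])

lemma L_lin: "x \<in> Sym_gr N \<Longrightarrow> y \<in> Sym_gr N \<Longrightarrow> z \<in> Sym_gr N \<Longrightarrow>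
    L (z * (const_gpoly c * x + y)) = c * L (z * x) + L (z * y)"
  by (simp only: distrib_left mult.left_commute[of z] L_add L_scale Sym_mult Sym_scale)

text \<open>Polynomials of degree \<open>n\<close> are generated by products \<open>w P\<close> with \<open>P\<close> of lower degree, so the claim for
  \<open>n\<close> follows from the induction hypothesis once multiplication by \<open>w\<close> is known to be symmetric for
  pairs with one member of index \<open>j < n\<close>. For different indices this is the form of the recurrence. It
  does not require the diagonal blocks to be symmetric; for these, the induction hypothesis expresses
  the entries by the commutative product.\<close>

lemma L_mult_q: "a < r n \<Longrightarrow> Q \<in> Sym_gr N \<Longrightarrow> L (Q * q n a) = ip Q (q n a)"
proof (induction n arbitrary: a Q rule: less_induct)
  case (less n)
  show ?case
  proof (cases "n = 0")
    case True
    then show ?thesis using less.prems by (simp add: r_0 q_0 L_def)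
  next
    case False
    let ?V = "{P \<in> Sym_gr N. \<forall>Q\<in>Sym_gr N. L (Q * P) = ip Q P}"
    have Vlin: "const_gpoly c * x + y \<in> ?V" if "x \<in> ?V" "y \<in> ?V" for c x y
      using that by (simp add: L_lin ip_lin_right Sym_add Sym_scale)
    have V0: "0 \<in> ?V" using L_scale[OF Sym_0, of 0] by (simp add: Sym_0)
    have V: "gp.subspace ?V"
      unfolding gp.subspace_def using V0 Vlin[of _ 0] Vlin[of _ _ 1]
      by (metis (no_types, lifting) add.right_neutral const_gpoly_1 mult_1)
    have sym: "ip (w_var m i * Q) (q j b) = ip Q (w_var m i * q j b)"
      if m: "m \<ge> 1" and i: "i \<in> {1..N m}" and j: "j < n" and b: "b < r j" and Q: "Q \<in> Sym_gr N" for m i j b Q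
    proof -
      have w: "w_var m i \<in> Sym_gr N" using m i by (intro Sym_w_var) (auto simp: var_set_def)
      have basis: "ip (w_var m i * q l c) (q j b) = ip (q l c) (w_var m i * q j b)" if c: "c < r l" for l c
      proof (cases "l = j")
        case False
        then show ?thesis
          using ip_w_var_q[OF m i c b] ip_w_var_q[OF m i b c] jac_entry_sym[OF False]
          by (simp add: ip_commute[of _ "q j b"])
      next
        case True
        have "ip (w_var m i * q l c) (q j b) = L (w_var m i * q l c * q j b)"
          using less.IH[OF j b] Sym_mult[OF w q_Sym[OF c]] by simp
        also have "w_var m i * q l c * q j b = w_var m i * q j b * q l c"
          by (simp only: mult.assoc mult.commute[of "q l c"])
        also have "L \<dots> = ip (w_var m i * q j b) (q l c)"
          using less.IH[OF j, of c] True c Sym_mult[OF w q_Sym[OF b]] by simp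
        finally show ?thesis by (simp only: ip_commute)
      qed
      have "Q \<in> Sym_gr N \<and> ip (w_var m i * Q) (q j b) = ip Q (w_var m i * q j b)"
        using Q[folded span_B]
      proof (induction rule: gp.span_induct_alt)
        case base
        then show ?case by (simp add: Sym_0 ip_commute[of 0])
      next
        case (step c x y)
        have x: "x \<in> Sym_gr N" "ip (w_var m i * x) (q j b) = ip x (w_var m i * q j b)"
          using step.hyps basis q_Sym by (auto elim!: B_cases)
        have "w_var m i * (const_gpoly c * x + y) = const_gpoly c * (w_var m i * x) + w_var m i * y"
          by (simp only: distrib_left mult.left_commute)
        then show ?case using x step.IH w by (simp add: ip_lin_left Sym_mult Sym_add Sym_scale)
      qed
      then show ?thesis ..
    qed
    have "Pol N n \<subseteq> ?V"
    proof (rule Pol_subset_if_products[OF V])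
      show "1 \<in> ?V" by (simp add: L_def Sym_1)
      fix m i P assume m: "1 \<le> m" "m \<le> n" and i: "i \<in> {1..N m}" and "P \<in> Pol N (n - m)"
      then have "P \<in> gp.span (fam r q (n - m))" using Pol_span[of "n - m"] by auto
      then show "w_var m i * P \<in> ?V"
      proof (induction rule: gp.span_induct_alt)
        case base
        then show ?case using V0 by simp
      next
        case (step c x y)
        then obtain l b where l: "l \<le> n - m" "b < r l" "x = q l b" by auto
        have w: "w_var m i \<in> Sym_gr N" using m i by (intro Sym_w_var) (auto simp: var_set_def)
        have ln: "l < n" using l(1) m by simp
        have "w_var m i * x \<in> ?V"
        proof (intro CollectI conjI ballI)
          show "w_var m i * x \<in> Sym_gr N" unfolding l(3) by (intro Sym_mult w q_Sym l(2))
          fix Q assume Q: "Q \<in> Sym_gr N"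
          have "L (Q * (w_var m i * x)) = L ((w_var m i * Q) * q l b)"
            unfolding l(3) by (simp only: mult.assoc mult.left_commute)
          also have "\<dots> = ip (w_var m i * Q) (q l b)"
            using less.IH[OF ln l(2) Sym_mult[OF w Q]] .
          also have "\<dots> = ip Q (w_var m i * x)" unfolding l(3) by (rule sym[OF m(1) i ln l(2) Q])
          finally show "L (Q * (w_var m i * x)) = ip Q (w_var m i * x)" .
        qed
        from Vlin[OF this step.IH] show ?case
          by (simp only: distrib_left mult.left_commute[of "w_var m i"])
      qed
    qed
    then show ?thesis using q_Pol[OF less.prems(1)] less.prems(2) by blast
  qed
qed

lemma L_mult: "P \<in> Sym_gr N \<Longrightarrow> Q \<in> Sym_gr N \<Longrightarrow> L (Q * P) = ip Q P"
proof -
  assume P: "P \<in> Sym_gr N" and Q: "Q \<in> Sym_gr N"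
  have "P \<in> Sym_gr N \<and> L (Q * P) = ip Q P"
    using P[folded span_B]
  proof (induction rule: gp.span_induct_alt)
    case base
    then show ?case using L_scale[OF Sym_0, of 0] by (simp add: Sym_0)
  next
    case (step c x y)
    have "x \<in> Sym_gr N" "L (Q * x) = ip Q x"
      using step.hyps L_mult_q[OF _ Q] q_Sym by (auto elim!: B_cases)
    then show ?case using step.IH Q by (simp add: L_lin ip_lin_right Sym_add Sym_scale)
  qed
  then show ?thesis ..
qed

sublocale orthonormal_basis N L r q
proof
  have "gp.representation B 1 = (\<lambda>b. if b = 1 then 1 else 0)"
    using gp.representation_basis[OF independent_B q_B[of 0 0]] by (simp add: r_0 q_0)
  then show "L 1 = 1" using ip_q[of 0 0 0 0] by (simp add: L_def r_0 q_0)
qed (simp_all add: L_add L_scale L_mult ip_nonneg q_Pol q_Sym ip_q Pol_span)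

lemma entries_bounded:
  assumes m: "m \<ge> 1" and i: "i \<in> {1..N m}"
  obtains C where "C \<ge> 0" "\<And>k n. k \<le> m \<Longrightarrow> m \<le> n \<Longrightarrow> spectral_norm (M k n m i) \<le> C"
proof -
  have "\<exists>C. \<forall>n\<ge>m. spectral_norm (M k n m i) \<le> C" if "k \<in> {..m}" for k
  proof -
    have "bdd_above ((\<lambda>n. spectral_norm (ext_coeff M (int k) n m i)) ` {n. m + nat (- int k) \<le> n})"
      using that by (intro bounded[unfolded jacobi_bounded_def, rule_format, OF m i]) auto
    then obtain C where "\<forall>n\<ge>m. spectral_norm (ext_coeff M (int k) n m i) \<le> C"
      by (auto simp: bdd_above_def)
    then show ?thesis by (auto simp: ext_coeff_def)
  qed
  then obtain C where C: "\<And>k n. k \<le> m \<Longrightarrow> m \<le> n \<Longrightarrow> spectral_norm (M k n m i) \<le> C k"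
    by (metis atMost_iff)
  have "C k \<le> (\<Sum>k\<le>m. \<bar>C k\<bar>)" if "k \<le> m" for k
    using member_le_sum[of k "{..m}" "\<lambda>k. \<bar>C k\<bar>"] that by auto
  then show ?thesis using C by (intro that[of "\<Sum>k\<le>m. \<bar>C k\<bar>"]) (auto intro: order.trans sum_nonneg)
qed

lemma jac_entry_bilinear:
  assumes m: "m \<ge> 1" and i: "i \<in> {1..N m}" and C: "\<And>k n. k \<le> m \<Longrightarrow> m \<le> n \<Longrightarrow> spectral_norm (M k n m i) \<le> C"
    and C0: "C \<ge> 0"
  shows "\<bar>\<Sum>c<r l. \<Sum>b<r j. x c * jac_entry M m i l c j b * y b\<bar>
    \<le> (if j \<le> l + m \<and> l \<le> j + m then C / 2 * ((\<Sum>c<r l. (x c)\<^sup>2) + (\<Sum>b<r j. (y b)\<^sup>2)) else 0)"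
proof -
  have le: "s * (sqrt X * sqrt Y) \<le> C / 2 * (X + Y)" if "s \<le> C" "X \<ge> 0" "Y \<ge> 0" for s X Y
  proof -
    have "s * (sqrt X * sqrt Y) \<le> C * (sqrt X * sqrt Y)" using that by (intro mult_right_mono) auto
    also have "\<dots> \<le> C * ((X + Y) / 2)"
      using arith_geo_mean_sqrt[of X Y] that C0 by (intro mult_left_mono) (auto simp: real_sqrt_mult)
    finally show ?thesis by (simp add: field_simps)
  qed
  have dim: "M k n m i \<in> carrier_mat (r (n - m)) (r (n - m + k))" if "m \<le> n" "k \<le> m" for k n
    using that m i by (intro dims[unfolded jacobi_dims_def, rule_format]) auto
  consider "\<not> (j \<le> l + m \<and> l \<le> j + m)" | "l \<le> j" "j \<le> l + m" | "j < l" "l \<le> j + m" by linarith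
  then show ?thesis
  proof cases
    case 1
    then have "jac_entry M m i l c j b = 0" for c b by (auto simp: jac_entry_def)
    with 1 show ?thesis by auto
  next
    case 2
    have A: "M (j - l) (l + m) m i \<in> carrier_mat (r l) (r j)" using dim[of "l + m" "j - l"] 2 by simp
    have "\<bar>\<Sum>c<r l. \<Sum>b<r j. x c * jac_entry M m i l c j b * y b\<bar>
      = \<bar>\<Sum>c<r l. \<Sum>b<r j. x c * M (j - l) (l + m) m i $$ (c, b) * y b\<bar>"
      using 2 by (simp add: jac_entry_def le_diff_conv add.commute)
    also have "\<dots> \<le> C / 2 * ((\<Sum>c<r l. (x c)\<^sup>2) + (\<Sum>b<r j. (y b)\<^sup>2))"
      using 2 by (intro order.trans[OF spectral_norm_bilinear[OF A] le] C sum_nonneg) auto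
    finally show ?thesis using 2 by simp
  next
    case 3
    have A: "M (l - j) (j + m) m i \<in> carrier_mat (r j) (r l)" using dim[of "j + m" "l - j"] 3 by simp
    have "\<bar>\<Sum>c<r l. \<Sum>b<r j. x c * jac_entry M m i l c j b * y b\<bar>
      = \<bar>\<Sum>c<r l. \<Sum>b<r j. y b * M (l - j) (j + m) m i $$ (b, c) * x c\<bar>"
      using 3 by (simp add: jac_entry_def le_diff_conv add.commute mult_ac)
    also have "\<dots> = \<bar>\<Sum>b<r j. \<Sum>c<r l. y b * M (l - j) (j + m) m i $$ (b, c) * x c\<bar>"
      by (subst sum.swap) simp
    also have "\<dots> \<le> C / 2 * ((\<Sum>b<r j. (y b)\<^sup>2) + (\<Sum>c<r l. (x c)\<^sup>2))"
      using 3 by (intro order.trans[OF spectral_norm_bilinear[OF A] le] C sum_nonneg) auto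
    finally show ?thesis using 3 by (simp add: add.commute)
  qed
qed

lemma sum_band_le:
  fixes f :: "nat \<Rightarrow> real" and m :: nat
  assumes f: "\<And>l. f l \<ge> 0"
  shows "(\<Sum>l\<le>n. \<Sum>j\<le>n. if j \<le> l + m \<and> l \<le> j + m then f l else 0) \<le> (2 * m + 1) * (\<Sum>l\<le>n. f l)"
  unfolding sum_distrib_left
proof (rule sum_mono)
  fix l
  have "(\<Sum>j\<le>n. if j \<le> l + m \<and> l \<le> j + m then f l else 0) = card {j \<in> {..n}. j \<le> l + m \<and> l \<le> j + m} * f l"
    by (simp add: sum.If_cases Int_def)
  also have "card {j \<in> {..n}. j \<le> l + m \<and> l \<le> j + m} \<le> card {l - m..l + m}"
    by (rule card_mono) auto
  then have "real (card {j \<in> {..n}. j \<le> l + m \<and> l \<le> j + m}) * f l \<le> (2 * m + 1) * f l"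
    using f by (intro mult_right_mono) auto
  finally show "(\<Sum>j\<le>n. if j \<le> l + m \<and> l \<le> j + m then f l else 0) \<le> real (2 * m + 1) * f l" .
qed

text \<open>Only pairs of indices at distance at most \<open>m\<close> contribute, and every index belongs to at most
  \<open>2 m + 1\<close> pairs on each side.\<close>

lemma L_w_var_bilinear:
  assumes m: "m \<ge> 1" and i: "i \<in> {1..N m}" and C: "\<And>k n. k \<le> m \<Longrightarrow> m \<le> n \<Longrightarrow> spectral_norm (M k n m i) \<le> C"
    and C0: "C \<ge> 0" and P: "P \<in> Pol N n" and Q: "Q \<in> Pol N n"
  shows "\<bar>L (P * (w_var m i * Q))\<bar> \<le> C * (2 * m + 1) / 2 * (L (P * P) + L (Q * Q))"
proof -
  define x y where xy_def: "x = (\<lambda>l c. L (P * q l c))" "y = (\<lambda>j b. L (q j b * Q))"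
  define X Y where XY_def: "X = (\<lambda>l. \<Sum>c<r l. (x l c)\<^sup>2)" "Y = (\<lambda>j. \<Sum>b<r j. (y j b)\<^sup>2)"
  have w: "w_var m i \<in> Sym_gr N" using m i by (intro Sym_w_var) (auto simp: var_set_def)
  have LP: "L (P * P) = (\<Sum>l\<le>n. X l)"
    unfolding Parseval[OF P Pol_Sym[OF P]] XY_def xy_def by (simp add: power2_eq_square mult.commute)
  have LQ: "L (Q * Q) = (\<Sum>l\<le>n. Y l)"
    unfolding Parseval[OF Q Pol_Sym[OF Q]] XY_def xy_def by (simp add: power2_eq_square mult.commute)
  have inner: "L (q l c * (w_var m i * Q)) = (\<Sum>j\<le>n. \<Sum>b<r j. jac_entry M m i l c j b * y j b)"
    if c: "c < r l" for l c
  proof -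
    have "L (q l c * (w_var m i * Q)) = L (Q * (w_var m i * q l c))"
      by (simp only: mult.commute mult.left_commute mult.assoc)
    also have "\<dots> = (\<Sum>j\<le>n. \<Sum>b<r j. L (Q * q j b) * L (q j b * (w_var m i * q l c)))"
      using w c by (intro Parseval[OF Q] Sym_mult q_Sym)
    also have "\<dots> = (\<Sum>j\<le>n. \<Sum>b<r j. jac_entry M m i l c j b * y j b)"
      using c by (intro sum.cong refl)
        (simp add: xy_def L_mult Sym_mult w q_Sym ip_w_var_q[OF m i] mult.commute[of Q])
    finally show ?thesis .
  qed
  have "L (P * (w_var m i * Q)) = (\<Sum>l\<le>n. \<Sum>c<r l. x l c * L (q l c * (w_var m i * Q)))"
    unfolding xy_def by (intro Parseval[OF P] Sym_mult w Pol_Sym[OF Q])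
  also have "\<dots> = (\<Sum>l\<le>n. \<Sum>c<r l. \<Sum>j\<le>n. \<Sum>b<r j. x l c * jac_entry M m i l c j b * y j b)"
    by (intro sum.cong refl) (simp add: inner sum_distrib_left mult.assoc)
  also have "\<dots> = (\<Sum>l\<le>n. \<Sum>j\<le>n. \<Sum>c<r l. \<Sum>b<r j. x l c * jac_entry M m i l c j b * y j b)"
    by (intro sum.cong refl sum.swap)
  finally have "\<bar>L (P * (w_var m i * Q))\<bar> = \<bar>\<Sum>l\<le>n. \<Sum>j\<le>n. \<Sum>c<r l. \<Sum>b<r j. x l c * jac_entry M m i l c j b * y j b\<bar>"
    by simp
  also have "\<dots> \<le> (\<Sum>l\<le>n. \<Sum>j\<le>n. \<bar>\<Sum>c<r l. \<Sum>b<r j. x l c * jac_entry M m i l c j b * y j b\<bar>)"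
    by (intro order.trans[OF sum_abs] sum_mono sum_abs)
  also have "\<dots> \<le> (\<Sum>l\<le>n. \<Sum>j\<le>n. if j \<le> l + m \<and> l \<le> j + m then C / 2 * (X l + Y j) else 0)"
    unfolding XY_def by (intro sum_mono jac_entry_bilinear[OF m i C C0])
  also have "\<dots> = C / 2 * ((\<Sum>l\<le>n. \<Sum>j\<le>n. if j \<le> l + m \<and> l \<le> j + m then X l else 0)
      + (\<Sum>l\<le>n. \<Sum>j\<le>n. if j \<le> l + m \<and> l \<le> j + m then Y j else 0))"
    unfolding sum.distrib[symmetric] sum_distrib_left by (intro sum.cong refl) auto
  also have "(\<Sum>l\<le>n. \<Sum>j\<le>n. if j \<le> l + m \<and> l \<le> j + m then Y j else 0)
      = (\<Sum>l\<le>n. \<Sum>j\<le>n. if j \<le> l + m \<and> l \<le> j + m then Y l else 0)"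
    by (subst sum.swap) (intro sum.cong refl, auto)
  also have "C / 2 * ((\<Sum>l\<le>n. \<Sum>j\<le>n. if j \<le> l + m \<and> l \<le> j + m then X l else 0)
      + (\<Sum>l\<le>n. \<Sum>j\<le>n. if j \<le> l + m \<and> l \<le> j + m then Y l else 0))
    \<le> C / 2 * ((2 * m + 1) * (\<Sum>l\<le>n. X l) + (2 * m + 1) * (\<Sum>l\<le>n. Y l))"
    using C0 by (intro mult_left_mono add_mono sum_band_le) (auto simp: XY_def sum_nonneg)
  finally show ?thesis unfolding LP LQ by (simp add: algebra_simps)
qed

lemma L_w_var_bounded:
  assumes v: "(m, i) \<in> var_set N"
  shows "\<exists>D>0. \<forall>P\<in>Sym_gr N. L ((w_var m i * P) * (w_var m i * P)) \<le> D\<^sup>2 * L (P * P)"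
proof -
  have m: "m \<ge> 1" and i: "i \<in> {1..N m}" using v by (auto simp: var_set_def)
  obtain C where C0: "C \<ge> 0" and C: "\<And>k n. k \<le> m \<Longrightarrow> m \<le> n \<Longrightarrow> spectral_norm (M k n m i) \<le> C"
    using entries_bounded[OF m i] by blast
  define D where "D = C * (2 * m + 1) + 1"
  have D: "D > 0" using C0 by (simp add: D_def add_nonneg_pos)
  have "L ((w_var m i * P) * (w_var m i * P)) \<le> D\<^sup>2 * L (P * P)" if P: "P \<in> Sym_gr N" for P
  proof -
    let ?R = "w_var m i * P"
    define E where "E = L (?R * ?R)"
    obtain n where n: "P \<in> Pol N n" using Sym_in_Pol[OF P] .
    have R: "?R \<in> Pol N (n + m)" by (rule Pol_w_var_mult[OF v n])
    have Q: "const_gpoly (1 / D) * ?R \<in> Pol N (n + m)" by (rule gp.subspace_scale[OF subspace_Pol R])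
    have P': "P \<in> Pol N (n + m)" using n Pol_mono[of n "n + m" N] by auto
    \<comment> \<open>The bilinear estimate for \<open>P\<close> and a multiple of \<open>w P\<close>, with the multiple chosen to balance both terms.\<close>
    have "(const_gpoly (1 / D) * ?R) * ?R = const_gpoly (1 / D) * (?R * ?R)" by (simp only: mult.assoc)
    then have 1: "L ((const_gpoly (1 / D) * ?R) * ?R) = E / D"
      using R by (simp only: L_scale Sym_mult Pol_Sym E_def) simp
    have "(const_gpoly (1 / D) * ?R) * (const_gpoly (1 / D) * ?R) = const_gpoly (1 / D) * (const_gpoly (1 / D) * (?R * ?R))"
      by (simp only: mult.assoc mult.left_commute)
    then have 2: "L ((const_gpoly (1 / D) * ?R) * (const_gpoly (1 / D) * ?R)) = E / D\<^sup>2"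
      using R by (simp only: L_scale Sym_mult Sym_scale Pol_Sym E_def) (simp add: power2_eq_square)
    have "E / D \<le> C * (2 * m + 1) / 2 * (E / D\<^sup>2 + L (P * P))"
      using L_w_var_bilinear[OF m i C C0 Q P'] unfolding 1 2 by linarith
    also have "\<dots> \<le> D / 2 * (E / D\<^sup>2 + L (P * P))"
      using L_nonneg[OF P] L_nonneg[OF Pol_Sym[OF R]] by (intro mult_right_mono) (auto simp: D_def E_def)
    finally have "E / D \<le> D / 2 * (E / D\<^sup>2 + L (P * P))" .
    then have "E \<le> D\<^sup>2 * L (P * P)" using D by (simp add: field_simps power2_eq_square)
    then show ?thesis by (simp add: E_def)
  qed
  then show ?thesis using D by blast
qed

lemma bounded_basis:
  obtains c where "bounded_orthonormal_basis N L r q c"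
proof -
  define c where "c = (\<lambda>(m, i). SOME D. D > 0 \<and> (\<forall>P\<in>Sym_gr N. L ((w_var m i * P) * (w_var m i * P)) \<le> D\<^sup>2 * L (P * P)))"
  have c: "c (m, i) > 0 \<and> (\<forall>P\<in>Sym_gr N. L ((w_var m i * P) * (w_var m i * P)) \<le> (c (m, i))\<^sup>2 * L (P * P))"
    if "(m, i) \<in> var_set N" for m i
    unfolding c_def prod.case by (rule someI_ex[OF L_w_var_bounded[OF that, unfolded Bex_def]])
  have "bounded_orthonormal_basis N L r q c"
    by unfold_locales (use c fin r in auto)
  then show ?thesis by (rule that)
qed

end

section \<open>A space-filling curve of infinitely many coordinates\<close>

text \<open>The continuous 2-periodic function of Schoenberg's construction: it vanishes on \<open>[0, 1/3]\<close> and
  equals \<open>1\<close> on \<open>[2/3, 1]\<close>.\<close>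

definition sch :: "real \<Rightarrow> real" where
  "sch x = max 0 (min 1 (1 / 2 - cos (pi * x)))"

text \<open>Each coordinate of the curve reads its binary digits from the ternary digits of the parameter at its
  own infinite set of positions; the pairs of naturals that index the coordinates are encoded by
  \<open>prod_encode\<close>.\<close>

definition curve :: "nat \<times> nat \<Rightarrow> real \<Rightarrow> real" where
  "curve v t = suminf (\<lambda>i. sch (3 ^ prod_encode (prod_encode v, i) * t) / 2 ^ Suc i)"

lemma sch_bounds: "0 \<le> sch x" "sch x \<le> 1"
  by (auto simp: sch_def)

lemma sch_low: "0 \<le> x \<Longrightarrow> x \<le> 1 / 3 \<Longrightarrow> sch x = 0"
proof -
  assume x: "0 \<le> x" "x \<le> 1 / 3"
  have "cos (pi / 3) \<le> cos (pi * x)"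
    using x by (intro cos_monotone_0_pi_le) (auto simp: field_simps)
  then show ?thesis by (simp add: cos_60 sch_def)
qed

lemma sch_high: "2 / 3 \<le> x \<Longrightarrow> x \<le> 1 \<Longrightarrow> sch x = 1"
proof -
  assume x: "2 / 3 \<le> x" "x \<le> 1"
  have "cos (pi * x) \<le> cos (pi - pi / 3)"
    using x by (intro cos_monotone_0_pi_le) (auto simp: field_simps)
  moreover have "cos (pi - pi / 3) = - 1 / 2" unfolding cos_diff by (simp add: cos_60)
  ultimately show ?thesis by (simp add: sch_def)
qed

lemma sch_periodic: "sch (2 * real k + x) = sch x"
proof -
  have "cos (pi * (2 * real k + x)) = cos (2 * real k * pi + pi * x)" by (simp add: algebra_simps)
  also have "\<dots> = cos (pi * x)" by (simp add: cos_add)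
  finally show ?thesis by (simp add: sch_def)
qed

lemma curve_summable: "summable (\<lambda>i. sch (f i) / 2 ^ Suc i)"
proof (rule summable_comparison_test'[where N = 0])
  show "summable (\<lambda>i. (1 / 2 :: real) ^ i)" by (simp add: summable_geometric)
  fix i
  have "sch (f i) / 2 ^ Suc i \<le> 1 / 2 ^ i"
    using sch_bounds[of "f i"] by (intro frac_le) auto
  then show "norm (sch (f i) / 2 ^ Suc i) \<le> (1 / 2) ^ i"
    using sch_bounds[of "f i"] by (simp add: power_one_over)
qed

lemma half_sums: "(\<lambda>i. 1 / 2 ^ Suc i :: real) sums 1"
  using power_half_series by (simp add: power_one_over)

lemma curve_bounds: "0 \<le> curve v t" "curve v t \<le> 1"
proof -
  show "0 \<le> curve v t" unfolding curve_def
    by (intro suminf_nonneg curve_summable) (simp add: sch_bounds)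
  have "curve v t \<le> suminf (\<lambda>i. 1 / 2 ^ Suc i)" unfolding curve_def
    using half_sums by (intro suminf_le curve_summable) (auto simp: sch_bounds divide_right_mono sums_iff)
  then show "curve v t \<le> 1" using half_sums by (simp add: sums_iff)
qed

lemma continuous_curve: "continuous_on UNIV (curve v)"
  unfolding curve_def
proof (rule uniform_limit_theorem[where F = sequentially])
  show "uniform_limit UNIV (\<lambda>n t. \<Sum>i<n. sch (3 ^ prod_encode (prod_encode v, i) * t) / 2 ^ Suc i)
      (\<lambda>t. suminf (\<lambda>i. sch (3 ^ prod_encode (prod_encode v, i) * t) / 2 ^ Suc i)) sequentially"
    by (rule Weierstrass_m_test[where M = "\<lambda>i. 1 / 2 ^ Suc i"])
       (use half_sums in \<open>auto simp: sch_bounds divide_right_mono sums_iff\<close>)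
  show "\<forall>\<^sub>F n in sequentially. continuous_on UNIV (\<lambda>t. \<Sum>i<n. sch (3 ^ prod_encode (prod_encode v, i) * t) / 2 ^ Suc i)"
    unfolding sch_def by (intro always_eventually allI continuous_intros) auto
qed simp

text \<open>A real number with prescribed ternary digits \<open>0\<close> and \<open>2\<close>.\<close>

definition tern :: "(nat \<Rightarrow> bool) \<Rightarrow> real" where
  "tern a = suminf (\<lambda>i. 2 * of_bool (a i) / 3 ^ Suc i)"

lemma third_sums: "(\<lambda>i. 2 / 3 ^ Suc i :: real) sums 1"
proof -
  have "(\<lambda>i. (1 / 3) ^ i :: real) sums (1 / (1 - 1 / 3))" by (rule geometric_sums) simp
  from sums_mult[OF this, of "2 / 3"] show ?thesis by (simp add: power_one_over field_simps)
qed

lemma tern_summable: "summable (\<lambda>i. 2 * of_bool (a i) / 3 ^ Suc i :: real)"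
  by (rule summable_comparison_test'[where N = 0, OF sums_summable[OF third_sums]]) (simp add: of_bool_def)

lemma tern_bounds: "0 \<le> tern a" "tern a \<le> 1"
proof -
  show "0 \<le> tern a" unfolding tern_def by (intro suminf_nonneg tern_summable) simp
  have "tern a \<le> suminf (\<lambda>i. 2 / 3 ^ Suc i)" unfolding tern_def
    using third_sums by (intro suminf_le tern_summable) (auto simp: sums_iff)
  then show "tern a \<le> 1" using third_sums by (simp add: sums_iff)
qed

lemma tern_shift: "3 * tern a = 2 * of_bool (a 0) + tern (\<lambda>i. a (Suc i))"
proof -
  have "tern a = 2 * of_bool (a 0) / 3 + suminf (\<lambda>i. 2 * of_bool (a (Suc i)) / 3 ^ Suc (Suc i))"
    using suminf_split_head[OF tern_summable[of a]] unfolding tern_def by simp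
  also have "suminf (\<lambda>i. 2 * of_bool (a (Suc i)) / 3 ^ Suc (Suc i)) = tern (\<lambda>i. a (Suc i)) / 3"
    unfolding tern_def by (subst suminf_divide[OF tern_summable, symmetric]) (simp add: field_simps)
  finally show ?thesis by simp
qed

lemma sch_tern_0: "sch (tern a) = of_bool (a 0)"
  using tern_shift[of a] tern_bounds[of "\<lambda>i. a (Suc i)"]
  by (cases "a 0") (auto intro: sch_low sch_high)

text \<open>Multiplication by \<open>3 ^ n\<close> shifts the ternary digits, up to an even integer.\<close>

lemma sch_tern: "sch (3 ^ n * tern a) = of_bool (a n)"
proof -
  have "\<exists>k. 3 ^ n * tern a = 2 * real k + tern (\<lambda>i. a (i + n))"
  proof (induction n)
    case 0
    show ?case by (intro exI[of _ 0]) simp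
  next
    case (Suc n)
    then obtain k where "3 ^ n * tern a = 2 * real k + tern (\<lambda>i. a (i + n))" by blast
    then have "3 ^ Suc n * tern a = 2 * real (3 * k) + 3 * tern (\<lambda>i. a (i + n))" by simp
    also have "\<dots> = 2 * real (3 * k + of_bool (a n)) + tern (\<lambda>i. a (i + Suc n))"
      by (simp add: tern_shift)
    finally show ?case by blast
  qed
  then obtain k where "3 ^ n * tern a = 2 * real k + tern (\<lambda>i. a (i + n))" by blast
  then show ?thesis by (simp add: sch_periodic sch_tern_0)
qed

lemma binary_expansion:
  assumes "0 \<le> u" "u \<le> (1::real)"
  obtains a :: "nat \<Rightarrow> bool" where "suminf (\<lambda>i. of_bool (a i) / 2 ^ Suc i) = u"
proof (cases "u = 1")
  case True
  then show ?thesis using that[of "\<lambda>_. True"] half_sums by (simp add: sums_iff)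
next
  case False
  define b where "b = (\<lambda>n. \<lfloor>2 ^ n * u\<rfloor>)"
  define a where "a = (\<lambda>n. odd (b (Suc n)))"
  have step: "b (Suc n) = 2 * b n + of_bool (a n)" for n
  proof -
    have 1: "real_of_int (b k) \<le> 2 ^ k * u" "2 ^ k * u < real_of_int (b k) + 1" for k
      unfolding b_def by linarith+
    have "2 ^ Suc n * u = 2 * (2 ^ n * u)" by simp
    then have "real_of_int (2 * b n) < real_of_int (b (Suc n) + 1)" "real_of_int (b (Suc n)) < real_of_int (2 * b n + 2)"
      using 1[of n] 1[of "Suc n"] by simp_all
    then have "2 * b n < b (Suc n) + 1" "b (Suc n) < 2 * b n + 2" unfolding of_int_less_iff .
    then have "b (Suc n) = 2 * b n \<or> b (Suc n) = 2 * b n + 1" by linarith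
    then show ?thesis by (auto simp: a_def)
  qed
  have b0: "b 0 = 0" using assms False by (auto simp: b_def floor_eq_iff)
  have part: "(\<Sum>i<n. of_bool (a i) / 2 ^ Suc i) = real_of_int (b n) / 2 ^ n" for n
    by (induction n) (auto simp: b0 step field_simps)
  have "(\<lambda>n. real_of_int (b n) / 2 ^ n) \<longlonglongrightarrow> u"
  proof (rule real_tendsto_sandwich)
    have "real_of_int (b n) / 2 ^ n \<le> u \<and> u - 1 / 2 ^ n \<le> real_of_int (b n) / 2 ^ n" for n
    proof -
      have "real_of_int (b n) \<le> 2 ^ n * u" "2 ^ n * u - 1 \<le> real_of_int (b n)" unfolding b_def by linarith+
      then have "real_of_int (b n) / 2 ^ n \<le> (2 ^ n * u) / 2 ^ n" "(2 ^ n * u - 1) / 2 ^ n \<le> real_of_int (b n) / 2 ^ n"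
        by (intro divide_right_mono; simp)+
      then show ?thesis by (simp add: diff_divide_distrib)
    qed
    then show "\<forall>\<^sub>F n in sequentially. u - 1 / 2 ^ n \<le> real_of_int (b n) / 2 ^ n"
      "\<forall>\<^sub>F n in sequentially. real_of_int (b n) / 2 ^ n \<le> u" by auto
    have "(\<lambda>n. u - (1 / 2) ^ n) \<longlonglongrightarrow> u - 0" by (intro tendsto_intros LIMSEQ_power_zero) simp
    then show "(\<lambda>n. u - 1 / 2 ^ n) \<longlonglongrightarrow> u" by (simp add: power_one_over)
  qed simp
  then have "(\<lambda>i. of_bool (a i) / 2 ^ Suc i) sums u" unfolding sums_def part .
  then show ?thesis by (intro that[of a]) (simp add: sums_iff)
qed

lemma curve_surj:
  assumes "\<And>v. 0 \<le> u v \<and> u v \<le> 1"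
  obtains t where "0 \<le> t" "t \<le> 1" "\<And>v. curve v t = u v"
proof -
  have "\<exists>a :: nat \<Rightarrow> bool. suminf (\<lambda>i. of_bool (a i) / 2 ^ Suc i) = u v" for v
    using binary_expansion[of "u v"] assms[of v] by metis
  then obtain a :: "nat \<times> nat \<Rightarrow> nat \<Rightarrow> bool" where a: "\<And>v. suminf (\<lambda>i. of_bool (a v i) / 2 ^ Suc i) = u v" by metis
  define d where "d = (\<lambda>n. a (prod_decode (fst (prod_decode n))) (snd (prod_decode n)))"
  have "curve v (tern d) = u v" for v
    unfolding curve_def sch_tern a[symmetric] by (simp add: d_def)
  then show ?thesis using that[of "tern d"] tern_bounds by blast
qed

section \<open>The positive cone of a bounded functional\<close>

lemma le_1_if_powers_bounded:
  fixes x :: real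
  assumes "\<And>k. x ^ (2 ^ k) \<le> K"
  shows "x \<le> 1"
proof (rule ccontr)
  assume "\<not> x \<le> 1"
  then obtain n where n: "K < x ^ n" using real_arch_pow[of x K] by auto
  have "n \<le> 2 ^ n" by (simp add: less_imp_le)
  then have "x ^ n \<le> x ^ (2 ^ n)" using \<open>\<not> x \<le> 1\<close> by (intro power_increasing) auto
  then show False using n assms[of n] by simp
qed

text \<open>A bounded sequence of moments that satisfies the Cauchy-Schwarz inequality is dominated by
  its zeroth term.\<close>

lemma first_moment_le:
  fixes b :: "nat \<Rightarrow> real"
  assumes b0: "b 0 \<ge> 0" and CS: "\<And>n. (b n)\<^sup>2 \<le> b 0 * b (2 * n)" and K: "\<And>n. \<bar>b n\<bar> \<le> K"
  shows "\<bar>b 1\<bar> \<le> b 0"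
proof (cases "b 0 = 0")
  case True
  then show ?thesis using CS[of 1] by simp
next
  case False
  then have pos: "b 0 > 0" using b0 by simp
  have "(\<bar>b 1\<bar> / b 0) ^ (2 ^ k) \<le> \<bar>b (2 ^ k)\<bar> / b 0" for k
  proof (induction k)
    case (Suc k)
    have "(\<bar>b 1\<bar> / b 0) ^ (2 ^ Suc k) = ((\<bar>b 1\<bar> / b 0) ^ (2 ^ k))\<^sup>2"
      by (simp only: power_Suc mult.commute[of 2] power_mult)
    also have "\<dots> \<le> (\<bar>b (2 ^ k)\<bar> / b 0)\<^sup>2" using Suc pos by (intro power_mono) auto
    also have "\<dots> \<le> b (2 * 2 ^ k) / b 0"
      using CS[of "2 ^ k"] pos by (simp add: power_divide power2_eq_square field_simps)
    finally show ?case using pos by (simp add: divide_right_mono order.trans)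
  qed simp
  moreover have "\<bar>b (2 ^ k)\<bar> / b 0 \<le> K / b 0" for k
    using K pos by (simp add: divide_right_mono)
  ultimately have "(\<bar>b 1\<bar> / b 0) ^ (2 ^ k) \<le> K / b 0" for k by (meson order.trans)
  then have "\<bar>b 1\<bar> / b 0 \<le> 1" by (rule le_1_if_powers_bounded)
  then show ?thesis using pos by simp
qed

context bounded_state
begin

text \<open>The polynomials with which \<open>L\<close> may be multiplied without losing positivity.\<close>

definition Cone :: "gpoly set" where
  "Cone = {Q \<in> Sym_gr N. \<forall>P\<in>Sym_gr N. L (Q * (P * P)) \<ge> 0}"

lemma Cone_1: "1 \<in> Cone"
  by (simp add: Cone_def Sym_1 L_nonneg)

lemma Cone_Sym: "Q \<in> Cone \<Longrightarrow> Q \<in> Sym_gr N"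
  by (simp add: Cone_def)

lemma Cone_L: "Q \<in> Cone \<Longrightarrow> L Q \<ge> 0"
  using Sym_1 by (force simp: Cone_def)

lemma Cone_scale: "Q \<in> Cone \<Longrightarrow> s \<ge> 0 \<Longrightarrow> const_gpoly s * Q \<in> Cone"
  by (simp add: Cone_def Sym_scale Sym_mult mult.assoc L_scale)

text \<open>The variable \<open>w\<close>, rescaled so that multiplication by it is a contraction.\<close>

definition yvar :: "nat \<times> nat \<Rightarrow> gpoly" where
  "yvar v = const_gpoly (1 / c v) * w_var (fst v) (snd v)"

lemma yvar_Sym: "v \<in> var_set N \<Longrightarrow> yvar v \<in> Sym_gr N"
  by (auto simp: yvar_def intro!: Sym_scale Sym_w_var)

lemma yvar_contraction:
  assumes v: "v \<in> var_set N" and P: "P \<in> Sym_gr N"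
  shows "L ((yvar v * P) * (yvar v * P)) \<le> L (P * P)"
proof -
  obtain m i where mi: "v = (m, i)" by (cases v)
  have c: "c v > 0" by (rule c_pos[OF v])
  have S: "w_var m i * P \<in> Sym_gr N" using v P by (intro Sym_mult Sym_w_var) (simp_all add: mi)
  have "(yvar v * P) * (yvar v * P) = const_gpoly (1 / c v) * (const_gpoly (1 / c v) * ((w_var m i * P) * (w_var m i * P)))"
    unfolding yvar_def mi fst_conv snd_conv by (simp only: mult.assoc mult.left_commute)
  then have "L ((yvar v * P) * (yvar v * P)) = 1 / c v * (1 / c v * L ((w_var m i * P) * (w_var m i * P)))"
    using S by (simp only: L_scale Sym_scale Sym_mult)
  also have "\<dots> = L ((w_var m i * P) * (w_var m i * P)) / (c v)\<^sup>2" by (simp add: power2_eq_square)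
  also have "\<dots> \<le> L (P * P)"
    using L_bounded[OF v[unfolded mi] P] c by (simp add: mi field_simps)
  finally show ?thesis .
qed

text \<open>For fixed \<open>Q\<close> in the cone and any \<open>P\<close>, the numbers \<open>b n = L (Q y\<^sup>n P\<^sup>2)\<close> satisfy the Cauchy-Schwarz
  inequality, as \<open>Q\<close> is in the cone, and are bounded, as \<open>y\<close> is a contraction. Hence
  \<open>\<bar>b 1\<bar> \<le> b 0\<close>, which is the claim.\<close>

lemma Cone_mult_yvar:
  assumes v: "v \<in> var_set N" and Q: "Q \<in> Cone"
  shows "(1 + yvar v) * Q \<in> Cone" "(1 - yvar v) * Q \<in> Cone"
proof -
  let ?y = "yvar v"
  have y: "?y \<in> Sym_gr N" by (rule yvar_Sym[OF v])
  have QS: "Q \<in> Sym_gr N" by (rule Cone_Sym[OF Q])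
  interpret LQ: positive_functional N "\<lambda>A. L (Q * A)"
    using Q QS by unfold_locales (auto simp: distrib_left mult.left_commute[of Q] L_add L_scale Sym_mult Cone_def)
  have ypow: "L ((?y ^ k) * (?y ^ k)) \<le> 1" for k
  proof (induction k)
    case (Suc k)
    have "L ((?y * ?y ^ k) * (?y * ?y ^ k)) \<le> L (?y ^ k * ?y ^ k)" by (rule yvar_contraction[OF v Sym_power[OF y]])
    then show ?case using Suc by simp
  qed (simp add: L_1)
  have key: "\<bar>L (Q * (?y * (P * P)))\<bar> \<le> L (Q * (P * P))" if P: "P \<in> Sym_gr N" for P
  proof -
    define b where "b = (\<lambda>n. L (Q * (?y ^ n * (P * P))))"
    let ?R = "Q * (P * P)"
    have R: "?R \<in> Sym_gr N" using QS P by (intro Sym_mult)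
    have "b 0 \<ge> 0" using Q P by (simp add: b_def Cone_def)
    moreover have "(b n)\<^sup>2 \<le> b 0 * b (2 * n)" for n
    proof -
      have "(L (Q * (P * (?y ^ n * P))))\<^sup>2 \<le> L (Q * (P * P)) * L (Q * ((?y ^ n * P) * (?y ^ n * P)))"
        using P y by (intro LQ.Cauchy_Schwarz_L Sym_mult Sym_power)
      moreover have "P * (?y ^ n * P) = ?y ^ n * (P * P)" by (simp only: mult.left_commute)
      moreover have "(?y ^ n * P) * (?y ^ n * P) = ?y ^ (2 * n) * (P * P)"
        by (simp only: mult_2 power_add mult.assoc mult.left_commute)
      ultimately show ?thesis by (simp add: b_def)
    qed
    moreover have "\<bar>b n\<bar> \<le> sqrt (L (?R * ?R))" for n
    proof -
      have "(L (?R * ?y ^ n))\<^sup>2 \<le> L (?R * ?R) * L (?y ^ n * ?y ^ n)"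
        by (rule Cauchy_Schwarz_L[OF R Sym_power[OF y]])
      also have "\<dots> \<le> L (?R * ?R) * 1" by (intro mult_left_mono ypow L_nonneg[OF R])
      finally have "\<bar>L (?R * ?y ^ n)\<bar> \<le> sqrt (L (?R * ?R))" by (simp add: real_le_rsqrt)
      moreover have "?R * ?y ^ n = Q * (?y ^ n * (P * P))" by (simp only: mult.assoc mult.commute mult.left_commute)
      ultimately show ?thesis by (simp only: b_def)
    qed
    ultimately have "\<bar>b 1\<bar> \<le> b 0" by (rule first_moment_le)
    then show ?thesis by (simp add: b_def)
  qed
  have *: "L ((1 + ?y) * Q * (P * P)) = L (Q * (P * P)) + L (Q * (?y * (P * P)))"
    "L ((1 - ?y) * Q * (P * P)) = L (Q * (P * P)) - L (Q * (?y * (P * P)))" if P: "P \<in> Sym_gr N" for P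
  proof -
    have S: "Q * (P * P) \<in> Sym_gr N" "Q * (?y * (P * P)) \<in> Sym_gr N" using P QS y by (auto intro!: Sym_mult)
    have "(1 + ?y) * Q * (P * P) = Q * (P * P) + Q * (?y * (P * P))"
      by (simp only: distrib_right distrib_left mult_1 mult.assoc mult.left_commute)
    then show "L ((1 + ?y) * Q * (P * P)) = L (Q * (P * P)) + L (Q * (?y * (P * P)))"
      by (simp only: L_add S)
    have "(1 - ?y) * Q * (P * P) = Q * (P * P) - Q * (?y * (P * P))"
      by (simp only: left_diff_distrib right_diff_distrib mult_1 mult.assoc mult.left_commute)
    then show "L ((1 - ?y) * Q * (P * P)) = L (Q * (P * P)) - L (Q * (?y * (P * P)))"
      by (simp only: L_diff S)
  qed
  have "L ((1 + ?y) * Q * (P * P)) \<ge> 0" "L ((1 - ?y) * Q * (P * P)) \<ge> 0" if P: "P \<in> Sym_gr N" for P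
    using key[OF P] unfolding *[OF P] by linarith+
  then show "(1 + ?y) * Q \<in> Cone" "(1 - ?y) * Q \<in> Cone"
    unfolding Cone_def using y QS by (auto intro!: Sym_mult Sym_add Sym_diff Sym_1)
qed

text \<open>The affine image of a variable that takes values in \<open>[0, 1]\<close>.\<close>

definition uvar :: "nat \<times> nat \<Rightarrow> gpoly" where
  "uvar v = const_gpoly (1 / 2) * (1 + yvar v)"

lemma one_minus_uvar: "1 - uvar v = const_gpoly (1 / 2) * (1 - yvar v)"
proof -
  have "1 = const_gpoly (1 / 2) + const_gpoly (1 / 2)" by (simp add: const_gpoly_add[symmetric])
  then have "1 - uvar v = const_gpoly (1 / 2) + const_gpoly (1 / 2) - const_gpoly (1 / 2) * (1 + yvar v)"
    by (simp only: uvar_def)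
  also have "\<dots> = const_gpoly (1 / 2) * (1 - yvar v)" by (simp only: distrib_left right_diff_distrib mult_1_right) simp
  finally show ?thesis .
qed

lemma uvar_Sym: "v \<in> var_set N \<Longrightarrow> uvar v \<in> Sym_gr N"
  by (auto simp: uvar_def intro!: Sym_scale Sym_add Sym_1 yvar_Sym)

lemma Cone_mult_uvar:
  assumes "v \<in> var_set N" "Q \<in> Cone"
  shows "uvar v * Q \<in> Cone" "(1 - uvar v) * Q \<in> Cone"
  unfolding one_minus_uvar using assms
  by (simp_all only: uvar_def mult.assoc) (intro Cone_scale Cone_mult_yvar; simp)+

text \<open>Bernstein polynomials in the rescaled variable.\<close>

definition bern :: "nat \<Rightarrow> nat \<times> nat \<Rightarrow> nat \<Rightarrow> gpoly" where
  "bern n v k = const_gpoly (n choose k) * (uvar v ^ k * (1 - uvar v) ^ (n - k))"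

lemma bern_Sym: "v \<in> var_set N \<Longrightarrow> bern n v k \<in> Sym_gr N"
  by (auto simp: bern_def intro!: Sym_scale Sym_mult Sym_power Sym_diff Sym_1 uvar_Sym)

lemma Cone_mult_bern:
  assumes v: "v \<in> var_set N" and Q: "Q \<in> Cone"
  shows "bern n v k * Q \<in> Cone"
proof -
  have 1: "(1 - uvar v) ^ j * Q \<in> Cone" for j
    by (induction j) (simp_all add: Q mult.assoc Cone_mult_uvar[OF v])
  have "uvar v ^ i * ((1 - uvar v) ^ j * Q) \<in> Cone" for i j
    by (induction i) (simp_all add: 1 mult.assoc Cone_mult_uvar[OF v])
  then show ?thesis by (simp add: bern_def mult.assoc Cone_scale)
qed

lemma Cone_prod_bern:
  assumes "finite F" "F \<subseteq> var_set N"
  shows "(\<Prod>v\<in>F. bern n v (\<kappa> v)) \<in> Cone"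
  using assms by (induction F rule: finite_induct) (simp_all add: Cone_1 Cone_mult_bern)

text \<open>The factorial moments of the binomial distribution are exact monomials: the ratio of binomial
  coefficients takes the place of \<open>(k / n) ^ a\<close>, so that no error term arises.\<close>

lemma sum_bern:
  assumes a: "a \<le> n"
  shows "(\<Sum>k\<le>n. const_gpoly (real (k choose a) / real (n choose a)) * bern n v k) = uvar v ^ a"
proof -
  let ?u = "uvar v"
  have "(\<Sum>k\<le>n. const_gpoly (real (k choose a) / real (n choose a)) * bern n v k)
    = (\<Sum>k\<in>{a..n}. const_gpoly (real (k choose a) / real (n choose a)) * bern n v k)"
    by (rule sum.mono_neutral_right) auto
  also have "\<dots> = (\<Sum>j\<le>n - a. ?u ^ a * (of_nat ((n - a) choose j) * ?u ^ j * (1 - ?u) ^ (n - a - j)))"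
  proof (rule sum.reindex_bij_witness[where i = "\<lambda>j. j + a" and j = "\<lambda>k. k - a"])
    fix k assume k: "k \<in> {a..n}"
    have "real (n choose k) * real (k choose a) = real (n choose a) * real ((n - a) choose (k - a))"
      using choose_mult[of a k n] k by (simp flip: of_nat_mult)
    then have coeff: "real (k choose a) / real (n choose a) * real (n choose k) = real ((n - a) choose (k - a))"
      using a by (simp add: field_simps)
    have "const_gpoly (real (k choose a) / real (n choose a)) * bern n v k
       = const_gpoly (real ((n - a) choose (k - a))) * (?u ^ k * (1 - ?u) ^ (n - k))"
      by (simp only: bern_def mult.assoc[symmetric] const_gpoly_mult[symmetric] coeff)
    also have "?u ^ k = ?u ^ a * ?u ^ (k - a)" using k by (simp add: power_add[symmetric])
    finally show "?u ^ a * (of_nat ((n - a) choose (k - a)) * ?u ^ (k - a) * (1 - ?u) ^ (n - a - (k - a)))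
       = const_gpoly (real (k choose a) / real (n choose a)) * bern n v k"
      using k by (simp only: const_gpoly_of_nat mult.assoc mult.left_commute) simp
  qed (use a in auto)
  also have "\<dots> = ?u ^ a * (\<Sum>j\<le>n - a. of_nat ((n - a) choose j) * ?u ^ j * (1 - ?u) ^ (n - a - j))"
    by (simp only: sum_distrib_left)
  also have "\<dots> = ?u ^ a * (?u + (1 - ?u)) ^ (n - a)"
    by (simp only: binomial_ring)
  finally show ?thesis by simp
qed

lemma bern_moments:
  assumes F: "finite F" "F \<subseteq> var_set N" and \<alpha>: "\<And>v. v \<in> F \<Longrightarrow> \<alpha> v \<le> n"
  shows "(\<Sum>\<kappa>\<in>PiE F (\<lambda>_. {..n}). L (\<Prod>v\<in>F. bern n v (\<kappa> v)) * (\<Prod>v\<in>F. real (\<kappa> v choose \<alpha> v) / real (n choose \<alpha> v)))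
     = L (\<Prod>v\<in>F. uvar v ^ \<alpha> v)"
proof -
  let ?g = "\<lambda>v k. real (k choose \<alpha> v) / real (n choose \<alpha> v)"
  have "(\<Prod>v\<in>F. uvar v ^ \<alpha> v) = (\<Prod>v\<in>F. \<Sum>k\<le>n. const_gpoly (?g v k) * bern n v k)"
    using \<alpha> by (intro prod.cong refl) (simp add: sum_bern)
  also have "\<dots> = (\<Sum>\<kappa>\<in>PiE F (\<lambda>_. {..n}). \<Prod>v\<in>F. const_gpoly (?g v (\<kappa> v)) * bern n v (\<kappa> v))"
    by (rule prod_sum_PiE) (simp_all add: F)
  also have "\<dots> = (\<Sum>\<kappa>\<in>PiE F (\<lambda>_. {..n}). const_gpoly (\<Prod>v\<in>F. ?g v (\<kappa> v)) * (\<Prod>v\<in>F. bern n v (\<kappa> v)))"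
  proof (rule sum.cong[OF refl])
    fix \<kappa>
    have "const_gpoly (\<Prod>v\<in>F. ?g v (\<kappa> v)) = (\<Prod>v\<in>F. const_gpoly (?g v (\<kappa> v)))"
      using F(1) by (induction F rule: finite_induct) (simp_all only: prod.empty prod.insert const_gpoly_1 const_gpoly_mult simp_thms)
    then show "(\<Prod>v\<in>F. const_gpoly (?g v (\<kappa> v)) * bern n v (\<kappa> v)) = const_gpoly (\<Prod>v\<in>F. ?g v (\<kappa> v)) * (\<Prod>v\<in>F. bern n v (\<kappa> v))"
      by (simp only: prod.distrib)
  qed
  also have "L \<dots> = (\<Sum>\<kappa>\<in>PiE F (\<lambda>_. {..n}). L (const_gpoly (\<Prod>v\<in>F. ?g v (\<kappa> v)) * (\<Prod>v\<in>F. bern n v (\<kappa> v))))"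
    using F by (intro L_sum Sym_scale Sym_prod bern_Sym) auto
  also have "\<dots> = (\<Sum>\<kappa>\<in>PiE F (\<lambda>_. {..n}). L (\<Prod>v\<in>F. bern n v (\<kappa> v)) * (\<Prod>v\<in>F. ?g v (\<kappa> v)))"
    using F by (intro sum.cong refl, subst L_scale) (auto intro!: Sym_prod bern_Sym)
  finally show ?thesis ..
qed

end

lemma continuous_on_curve_prod: "continuous_on UNIV (\<lambda>t. \<Prod>v\<in>S. curve v t ^ \<alpha> v)"
  by (intro continuous_on_prod continuous_on_power continuous_curve)

lemma prod_restrict_exponent:
  assumes "finite F" "S \<subseteq> F" "\<And>v. f v (0 :: nat) = (1 :: 'a::comm_monoid_mult)"
  shows "(\<Prod>v\<in>F. f v (if v \<in> S then \<alpha> v else 0)) = (\<Prod>v\<in>S. f v (\<alpha> v))"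
  using assms by (intro prod.mono_neutral_cong_right) auto

text \<open>The ratio of binomial coefficients differs from the power by \<open>O (1 / n)\<close>, uniformly in \<open>k\<close>.\<close>

lemma choose_ratio_approx:
  assumes n: "2 * a < n" and k: "k \<le> n"
  shows "\<bar>real (k choose a) / real (n choose a) - (real k / real n) ^ a\<bar> \<le> real a * (real a / (real n - real a))"
    and "\<bar>real (k choose a) / real (n choose a)\<bar> \<le> 1"
proof -
  have "real (k choose a) / real (n choose a) = (\<Prod>i<a. (real k - real i) / (real n - real i))"
    by (simp add: binomial_gbinomial gbinomial_prod_rev prod_dividef atLeast0LessThan)
  moreover have le1: "\<bar>(real k - real i) / (real n - real i)\<bar> \<le> 1" if "i < a" for i
    using that n k by (auto simp: abs_le_iff field_simps)
  moreover have "\<bar>\<Prod>i<a. (real k - real i) / (real n - real i)\<bar> \<le> 1"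
    unfolding abs_prod by (intro prod_le_1) (use le1 in auto)
  ultimately show "\<bar>real (k choose a) / real (n choose a)\<bar> \<le> 1" by simp
  have "\<bar>(\<Prod>i<a. (real k - real i) / (real n - real i)) - (\<Prod>i<a. real k / real n)\<bar>
      \<le> (\<Sum>i<a. \<bar>(real k - real i) / (real n - real i) - real k / real n\<bar>)"
    using norm_prod_diff[of "{..<a}" "\<lambda>i. (real k - real i) / (real n - real i)" "\<lambda>i. real k / real n"] le1 n k
    by auto
  also have "\<dots> \<le> (\<Sum>i<a. real a / (real n - real a))"
  proof (rule sum_mono)
    fix i assume "i \<in> {..<a}"
    then have i: "i < a" by simp
    have "(real k - real i) / (real n - real i) - real k / real n = - (real i * ((real n - real k) / real n) / (real n - real i))"
      using i n by (simp add: field_simps)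
    then have "\<bar>(real k - real i) / (real n - real i) - real k / real n\<bar> = real i * ((real n - real k) / real n) / (real n - real i)"
      using i n k by (simp add: abs_mult)
    also have "\<dots> \<le> real a * 1 / (real n - real a)"
      using i n k by (intro frac_le mult_mono) (auto simp: field_simps)
    finally show "\<bar>(real k - real i) / (real n - real i) - real k / real n\<bar> \<le> real a / (real n - real a)" by simp
  qed
  finally show "\<bar>real (k choose a) / real (n choose a) - (real k / real n) ^ a\<bar> \<le> real a * (real a / (real n - real a))"
    using \<open>real (k choose a) / real (n choose a) = (\<Prod>i<a. (real k - real i) / (real n - real i))\<close> by simp
qed

section \<open>The representing measure\<close>

context bounded_state
begin

text \<open>Discrete measures on the parameter interval of the curve: the \<open>n\<close>-th one gives the point of the
  curve with coordinates \<open>\<kappa> v / n\<close> the value of \<open>L\<close> at the corresponding product of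
  Bernstein polynomials.\<close>

lemma discrete_measure:
  fixes F :: "(nat \<times> nat) set" and n :: nat
  assumes F: "finite F" "F \<subseteq> var_set N" and n: "n > 0"
  obtains \<nu> where "real_distribution \<nu>" "measure \<nu> {-1<..1} = 1"
    "\<And>S \<alpha>. S \<subseteq> F \<Longrightarrow> (\<integral>t. (\<Prod>v\<in>S. curve v t ^ \<alpha> v) \<partial>\<nu>)
      = (\<Sum>\<kappa>\<in>PiE F (\<lambda>_. {..n}). L (\<Prod>v\<in>F. bern n v (\<kappa> v)) * (\<Prod>v\<in>S. (real (\<kappa> v) / real n) ^ \<alpha> v))"
proof -
  define K where "K = PiE F (\<lambda>_. {..n})"
  define l where "l = (\<lambda>\<kappa>. if \<kappa> \<in> K then L (\<Prod>v\<in>F. bern n v (\<kappa> v)) else 0)"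
  have fin: "finite K" unfolding K_def using F by (intro finite_PiE) auto
  have l0: "l \<kappa> \<ge> 0" for \<kappa> by (simp add: l_def Cone_L Cone_prod_bern F)
  have l1: "(\<Sum>\<kappa>\<in>K. l \<kappa>) = 1"
    using bern_moments[OF F, of "\<lambda>_. 0" n] by (simp add: l_def K_def L_1 cong: sum.cong)
  have nn: "(\<integral>\<^sup>+\<kappa>. ennreal (l \<kappa>) \<partial>count_space UNIV) = 1"
  proof -
    have "(\<integral>\<^sup>+\<kappa>. ennreal (l \<kappa>) \<partial>count_space UNIV) = (\<Sum>\<kappa>\<in>K. ennreal (l \<kappa>))"
      by (rule nn_integral_count_space'[OF fin]) (auto simp: l_def)
    also have "\<dots> = 1" by (subst sum_ennreal) (simp_all add: l0 l1)
    finally show ?thesis .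
  qed
  define p where "p = embed_pmf l"
  have p: "pmf p \<kappa> = l \<kappa>" for \<kappa> unfolding p_def by (rule pmf_embed_pmf[OF l0 nn])
  have setp: "set_pmf p \<subseteq> K" using p by (auto simp: set_pmf_eq l_def split: if_splits)
  have "\<exists>t. 0 \<le> t \<and> t \<le> 1 \<and> (\<forall>v\<in>F. curve v t = real (\<kappa> v) / real n)" if \<kappa>: "\<kappa> \<in> K" for \<kappa>
  proof -
    obtain t where "0 \<le> t" "t \<le> 1" "\<And>v. curve v t = (if v \<in> F then real (\<kappa> v) / real n else 0)"
      by (rule curve_surj[of "\<lambda>v. if v \<in> F then real (\<kappa> v) / real n else 0"])
         (use \<kappa> n in \<open>auto simp: K_def PiE_iff divide_le_eq\<close>)
    then show ?thesis by auto
  qed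
  then obtain t where t: "\<And>\<kappa>. \<kappa> \<in> K \<Longrightarrow> 0 \<le> t \<kappa> \<and> t \<kappa> \<le> 1 \<and> (\<forall>v\<in>F. curve v (t \<kappa>) = real (\<kappa> v) / real n)"
    by metis
  let ?\<nu> = "distr (measure_pmf p) borel t"
  have "measure ?\<nu> {-1<..1} = measure (measure_pmf p) (t -` {-1<..1})"
    by (subst measure_distr) auto
  also have "\<dots> = 1"
    using setp t by (intro measure_pmf.prob_eq_1[THEN iffD2]) (fastforce simp: AE_measure_pmf_iff)+
  finally have \<nu>1: "measure ?\<nu> {-1<..1} = 1" .
  have \<nu>2: "real_distribution ?\<nu>" by (rule prob_space.real_distribution_distr[OF prob_space_measure_pmf]) simp
  have \<nu>3: "(\<integral>s. (\<Prod>v\<in>S. curve v s ^ \<alpha> v) \<partial>?\<nu>)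
      = (\<Sum>\<kappa>\<in>PiE F (\<lambda>_. {..n}). L (\<Prod>v\<in>F. bern n v (\<kappa> v)) * (\<Prod>v\<in>S. (real (\<kappa> v) / real n) ^ \<alpha> v))"
    if S: "S \<subseteq> F" for S \<alpha>
  proof -
    have "(\<integral>s. (\<Prod>v\<in>S. curve v s ^ \<alpha> v) \<partial>?\<nu>) = (\<integral>\<kappa>. (\<Prod>v\<in>S. curve v (t \<kappa>) ^ \<alpha> v) \<partial>measure_pmf p)"
      by (rule integral_distr)
         (auto intro!: borel_measurable_continuous_onI continuous_on_curve_prod)
    also have "\<dots> = (\<Sum>\<kappa>\<in>K. (\<Prod>v\<in>S. curve v (t \<kappa>) ^ \<alpha> v) * pmf p \<kappa>)"
      using setp by (intro integral_measure_pmf_real[OF fin]) auto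
    also have "\<dots> = (\<Sum>\<kappa>\<in>K. L (\<Prod>v\<in>F. bern n v (\<kappa> v)) * (\<Prod>v\<in>S. (real (\<kappa> v) / real n) ^ \<alpha> v))"
    proof (rule sum.cong[OF refl])
      fix \<kappa> assume \<kappa>: "\<kappa> \<in> K"
      have "(\<Prod>v\<in>S. curve v (t \<kappa>) ^ \<alpha> v) = (\<Prod>v\<in>S. (real (\<kappa> v) / real n) ^ \<alpha> v)"
        using t[OF \<kappa>] S by (intro prod.cong) auto
      then show "(\<Prod>v\<in>S. curve v (t \<kappa>) ^ \<alpha> v) * pmf p \<kappa> = L (\<Prod>v\<in>F. bern n v (\<kappa> v)) * (\<Prod>v\<in>S. (real (\<kappa> v) / real n) ^ \<alpha> v)"
        using \<kappa> by (simp add: p l_def mult.commute)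
    qed
    finally show ?thesis by (simp add: K_def)
  qed
  show ?thesis by (rule that[OF \<nu>2 \<nu>1 \<nu>3])
qed

text \<open>The moments of the discrete measures converge to those of \<open>L\<close>, at a rate that does not depend on the
  finite set \<open>F\<close> of coordinates that are discretized.\<close>

lemma discrete_moments_approx:
  assumes F: "finite F" "F \<subseteq> var_set N" and S: "S \<subseteq> F" and n: "\<And>v. v \<in> S \<Longrightarrow> 2 * \<alpha> v < n"
  shows "\<bar>(\<Sum>\<kappa>\<in>PiE F (\<lambda>_. {..n}). L (\<Prod>v\<in>F. bern n v (\<kappa> v)) * (\<Prod>v\<in>S. (real (\<kappa> v) / real n) ^ \<alpha> v))
     - L (\<Prod>v\<in>S. uvar v ^ \<alpha> v)\<bar> \<le> (\<Sum>v\<in>S. real (\<alpha> v) * (real (\<alpha> v) / (real n - real (\<alpha> v))))"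
proof -
  define K where "K = PiE F (\<lambda>_. {..n})"
  define l where "l = (\<lambda>\<kappa>. L (\<Prod>v\<in>F. bern n v (\<kappa> v)))"
  define E where "E = (\<Sum>v\<in>S. real (\<alpha> v) * (real (\<alpha> v) / (real n - real (\<alpha> v))))"
  define \<beta> where "\<beta> = (\<lambda>v. if v \<in> S then \<alpha> v else 0)"
  have \<beta>n: "\<beta> v \<le> n" for v using n[of v] by (auto simp: \<beta>_def)
  have l0: "l \<kappa> \<ge> 0" for \<kappa> by (simp add: l_def Cone_L Cone_prod_bern F)
  have l1: "(\<Sum>\<kappa>\<in>K. l \<kappa>) = 1"
    using bern_moments[OF F, of "\<lambda>_. 0" n] by (simp add: l_def K_def L_1)
  have "L (\<Prod>v\<in>S. uvar v ^ \<alpha> v) = L (\<Prod>v\<in>F. uvar v ^ \<beta> v)"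
    unfolding \<beta>_def by (subst prod_restrict_exponent[OF F(1) S, of "\<lambda>v a. uvar v ^ a"]) simp_all
  also have "\<dots> = (\<Sum>\<kappa>\<in>K. l \<kappa> * (\<Prod>v\<in>F. real (\<kappa> v choose \<beta> v) / real (n choose \<beta> v)))"
    using bern_moments[OF F, of \<beta> n] \<beta>n by (simp add: K_def l_def)
  also have "\<dots> = (\<Sum>\<kappa>\<in>K. l \<kappa> * (\<Prod>v\<in>S. real (\<kappa> v choose \<alpha> v) / real (n choose \<alpha> v)))"
    unfolding \<beta>_def by (subst prod_restrict_exponent[OF F(1) S, of "\<lambda>v a. real (_ v choose a) / real (n choose a)"]) simp_all
  finally have "\<bar>(\<Sum>\<kappa>\<in>K. l \<kappa> * (\<Prod>v\<in>S. (real (\<kappa> v) / real n) ^ \<alpha> v)) - L (\<Prod>v\<in>S. uvar v ^ \<alpha> v)\<bar>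
    = \<bar>\<Sum>\<kappa>\<in>K. l \<kappa> * ((\<Prod>v\<in>S. (real (\<kappa> v) / real n) ^ \<alpha> v) - (\<Prod>v\<in>S. real (\<kappa> v choose \<alpha> v) / real (n choose \<alpha> v)))\<bar>"
    by (simp add: sum_subtractf right_diff_distrib)
  also have "\<dots> \<le> (\<Sum>\<kappa>\<in>K. l \<kappa> * E)"
  proof (rule order.trans[OF sum_abs sum_mono])
    fix \<kappa> assume \<kappa>: "\<kappa> \<in> K"
    have \<kappa>n: "\<kappa> v \<le> n" if "v \<in> S" for v using \<kappa> that S by (auto simp: K_def PiE_iff)
    have "norm ((\<Prod>v\<in>S. (real (\<kappa> v) / real n) ^ \<alpha> v) - (\<Prod>v\<in>S. real (\<kappa> v choose \<alpha> v) / real (n choose \<alpha> v)))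
      \<le> (\<Sum>v\<in>S. norm ((real (\<kappa> v) / real n) ^ \<alpha> v - real (\<kappa> v choose \<alpha> v) / real (n choose \<alpha> v)))"
    proof (rule norm_prod_diff)
      fix v assume v: "v \<in> S"
      show "norm ((real (\<kappa> v) / real n) ^ \<alpha> v) \<le> 1"
        using n[OF v] \<kappa>n[OF v] by (simp add: norm_power power_le_one)
      show "norm (real (\<kappa> v choose \<alpha> v) / real (n choose \<alpha> v)) \<le> 1"
        using choose_ratio_approx(2)[OF n[OF v] \<kappa>n[OF v]] by simp
    qed
    also have "\<dots> \<le> E"
      unfolding E_def
    proof (rule sum_mono)
      fix v assume v: "v \<in> S"
      show "norm ((real (\<kappa> v) / real n) ^ \<alpha> v - real (\<kappa> v choose \<alpha> v) / real (n choose \<alpha> v)) \<le> real (\<alpha> v) * (real (\<alpha> v) / (real n - real (\<alpha> v)))"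
        using choose_ratio_approx(1)[OF n[OF v] \<kappa>n[OF v]] by (simp only: real_norm_def abs_minus_commute)
    qed
    finally show "\<bar>l \<kappa> * ((\<Prod>v\<in>S. (real (\<kappa> v) / real n) ^ \<alpha> v) - (\<Prod>v\<in>S. real (\<kappa> v choose \<alpha> v) / real (n choose \<alpha> v)))\<bar> \<le> l \<kappa> * E"
      using l0[of \<kappa>] by (simp add: abs_mult mult_left_mono)
  qed
  also have "\<dots> = E" using l1 by (simp add: sum_distrib_right[symmetric])
  finally show ?thesis by (simp add: K_def l_def E_def)
qed

lemma curve_measure:
  obtains \<nu> where "real_distribution \<nu>"
    "\<And>S \<alpha>. finite S \<Longrightarrow> S \<subseteq> var_set N \<Longrightarrow> (\<integral>t. (\<Prod>v\<in>S. curve v t ^ \<alpha> v) \<partial>\<nu>) = L (\<Prod>v\<in>S. uvar v ^ \<alpha> v)"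
proof -
  \<comment> \<open>A finite exhaustion of the variables; step \<open>n\<close> uses Bernstein polynomials of degree \<open>Suc n\<close>, as degree \<open>0\<close> has no grid.\<close>
  define F where "F = (\<lambda>n. var_set N \<inter> ({..n} \<times> {..n}))"
  have F: "finite (F n)" "F n \<subseteq> var_set N" for n by (auto simp: F_def)
  define G where "G = (\<lambda>n \<nu>. real_distribution \<nu> \<and> measure \<nu> {-1<..1} = 1 \<and>
    (\<forall>S \<alpha>. S \<subseteq> F n \<longrightarrow> (\<integral>t. (\<Prod>v\<in>S. curve v t ^ \<alpha> v) \<partial>\<nu>)
      = (\<Sum>\<kappa>\<in>PiE (F n) (\<lambda>_. {..Suc n}). L (\<Prod>v\<in>F n. bern (Suc n) v (\<kappa> v)) * (\<Prod>v\<in>S. (real (\<kappa> v) / real (Suc n)) ^ \<alpha> v))))"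
  have "\<exists>\<nu>. G n \<nu>" for n
  proof -
    obtain \<nu> where \<nu>: "real_distribution \<nu>" "measure \<nu> {-1<..1} = 1"
      "\<And>S \<alpha>. S \<subseteq> F n \<Longrightarrow> (\<integral>t. (\<Prod>v\<in>S. curve v t ^ \<alpha> v) \<partial>\<nu>)
        = (\<Sum>\<kappa>\<in>PiE (F n) (\<lambda>_. {..Suc n}). L (\<Prod>v\<in>F n. bern (Suc n) v (\<kappa> v)) * (\<Prod>v\<in>S. (real (\<kappa> v) / real (Suc n)) ^ \<alpha> v))"
      using discrete_measure[OF F[of n] zero_less_Suc[of n]] by blast
    then have "G n \<nu>" unfolding G_def by blast
    then show ?thesis by blast
  qed
  then have "\<forall>n. \<exists>\<nu>. G n \<nu>" by blast
  from choice[OF this] obtain \<nu> where G: "\<And>n. G n (\<nu> n)" by blast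
  have \<nu>: "\<And>n. real_distribution (\<nu> n)" "\<And>n. measure (\<nu> n) {-1<..1} = 1"
    "\<And>n S \<alpha>. S \<subseteq> F n \<Longrightarrow> (\<integral>t. (\<Prod>v\<in>S. curve v t ^ \<alpha> v) \<partial>\<nu> n)
      = (\<Sum>\<kappa>\<in>PiE (F n) (\<lambda>_. {..Suc n}). L (\<Prod>v\<in>F n. bern (Suc n) v (\<kappa> v)) * (\<Prod>v\<in>S. (real (\<kappa> v) / real (Suc n)) ^ \<alpha> v))"
    using G unfolding G_def by simp_all
  have conv: "(\<lambda>n. \<integral>t. (\<Prod>v\<in>S. curve v t ^ \<alpha> v) \<partial>\<nu> n) \<longlonglongrightarrow> L (\<Prod>v\<in>S. uvar v ^ \<alpha> v)"
    if S: "finite S" "S \<subseteq> var_set N" for S \<alpha>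
  proof -
    define k where "k = (\<Sum>v\<in>S. fst v + snd v + 2 * \<alpha> v)"
    have k: "fst v + snd v + 2 * \<alpha> v \<le> k" if "v \<in> S" for v
      unfolding k_def using that S(1) by (intro member_le_sum) auto
    have "(\<lambda>n. (\<integral>t. (\<Prod>v\<in>S. curve v t ^ \<alpha> v) \<partial>\<nu> n) - L (\<Prod>v\<in>S. uvar v ^ \<alpha> v)) \<longlonglongrightarrow> 0"
    proof (rule Lim_null_comparison)
      show "\<forall>\<^sub>F n in sequentially. norm ((\<integral>t. (\<Prod>v\<in>S. curve v t ^ \<alpha> v) \<partial>\<nu> n) - L (\<Prod>v\<in>S. uvar v ^ \<alpha> v))
        \<le> (\<Sum>v\<in>S. real (\<alpha> v) * (real (\<alpha> v) / (real (Suc n) - real (\<alpha> v))))"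
        unfolding eventually_sequentially
      proof (intro exI[of _ k] allI impI)
        fix n assume n: "k \<le> n"
        have SF: "S \<subseteq> F n" using k S(2) n unfolding F_def by (fastforce intro: order.trans)
        have "2 * \<alpha> v < Suc n" if "v \<in> S" for v using k[OF that] n by simp
        then show "norm ((\<integral>t. (\<Prod>v\<in>S. curve v t ^ \<alpha> v) \<partial>\<nu> n) - L (\<Prod>v\<in>S. uvar v ^ \<alpha> v))
          \<le> (\<Sum>v\<in>S. real (\<alpha> v) * (real (\<alpha> v) / (real (Suc n) - real (\<alpha> v))))"
          unfolding \<nu>(3)[OF SF] real_norm_def by (rule discrete_moments_approx[OF F SF])
      qed
      have "(\<lambda>n. \<Sum>v\<in>S. real (\<alpha> v) * (real (\<alpha> v) / (real (Suc n) - real (\<alpha> v)))) \<longlonglongrightarrow> (\<Sum>v\<in>S. real (\<alpha> v) * 0)"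
      proof (intro tendsto_sum tendsto_mult tendsto_const)
        fix v
        have "filterlim (\<lambda>n. real (Suc n) - real (\<alpha> v)) at_top sequentially"
          unfolding filterlim_at_top eventually_sequentially
        proof (intro allI)
          fix Z :: real
          have "Z \<le> real (Suc n) - real (\<alpha> v)" if "n \<ge> nat \<lceil>Z + real (\<alpha> v)\<rceil>" for n
            using that by linarith
          then show "\<exists>n0. \<forall>n\<ge>n0. Z \<le> real (Suc n) - real (\<alpha> v)" by blast
        qed
        then show "(\<lambda>n. real (\<alpha> v) / (real (Suc n) - real (\<alpha> v))) \<longlonglongrightarrow> 0"
          by (intro tendsto_divide_0[OF tendsto_const] filterlim_at_top_imp_at_infinity)
      qed
      then show "(\<lambda>n. \<Sum>v\<in>S. real (\<alpha> v) * (real (\<alpha> v) / (real (Suc n) - real (\<alpha> v)))) \<longlonglongrightarrow> 0" by simp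
    qed
    then show ?thesis by (simp add: LIM_zero_iff)
  qed
  have "tight \<nu>"
    unfolding tight_def
  proof (intro conjI allI impI \<nu>(1))
    fix \<epsilon> :: real assume "\<epsilon> > 0"
    then have "(-1 :: real) < 1 \<and> (\<forall>n. measure (\<nu> n) {-1<..1} > 1 - \<epsilon>)" by (simp add: \<nu>(2))
    then show "\<exists>a b::real. a < b \<and> (\<forall>n. measure (\<nu> n) {a<..b} > 1 - \<epsilon>)" by blast
  qed
  from tight_imp_convergent_subsubsequence[OF this strict_mono_id] obtain s \<mu> where
    s: "strict_mono (s :: nat \<Rightarrow> nat)" and \<mu>: "real_distribution \<mu>" and w: "weak_conv_m (\<nu> \<circ> id \<circ> s) \<mu>"
    by blast
  have "(\<integral>t. (\<Prod>v\<in>S. curve v t ^ \<alpha> v) \<partial>\<mu>) = L (\<Prod>v\<in>S. uvar v ^ \<alpha> v)"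
    if S: "finite S" "S \<subseteq> var_set N" for S \<alpha>
  proof (rule LIMSEQ_unique)
    show "(\<lambda>n. \<integral>t. (\<Prod>v\<in>S. curve v t ^ \<alpha> v) \<partial>\<nu> (s n)) \<longlonglongrightarrow> L (\<Prod>v\<in>S. uvar v ^ \<alpha> v)"
      using LIMSEQ_subseq_LIMSEQ[OF conv[OF S] s] by (simp add: o_def)
    have "isCont (\<lambda>t. \<Prod>v\<in>S. curve v t ^ \<alpha> v) x" for x
      using continuous_on_curve_prod[where S = S and \<alpha> = \<alpha>] by (simp add: continuous_on_eq_continuous_at)
    moreover have "norm (\<Prod>v\<in>S. curve v t ^ \<alpha> v) \<le> 1" for t
      by (simp add: abs_prod curve_bounds power_le_one prod_le_1)
    ultimately have "(\<lambda>n. \<integral>t. (\<Prod>v\<in>S. curve v t ^ \<alpha> v) \<partial>((\<nu> \<circ> id \<circ> s) n)) \<longlonglongrightarrow> (\<integral>t. (\<Prod>v\<in>S. curve v t ^ \<alpha> v) \<partial>\<mu>)"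
      using \<nu>(1) by (intro weak_conv_imp_integral_bdd_continuous_conv[OF _ \<mu> w]) auto
    then show "(\<lambda>n. \<integral>t. (\<Prod>v\<in>S. curve v t ^ \<alpha> v) \<partial>\<nu> (s n)) \<longlonglongrightarrow> (\<integral>t. (\<Prod>v\<in>S. curve v t ^ \<alpha> v) \<partial>\<mu>)" by simp
  qed
  then show ?thesis using that \<mu> by blast
qed

text \<open>The curve in the original coordinates; the coordinates outside \<open>W\<close> are set to \<open>0\<close>.\<close>

definition point :: "real \<Rightarrow> nat \<times> nat \<Rightarrow> real" where
  "point t v = (if v \<in> var_set N then c v * (2 * curve v t - 1) else 0)"

lemma point_bound: "v \<in> var_set N \<Longrightarrow> \<bar>point t v\<bar> \<le> c v"
proof -
  assume v: "v \<in> var_set N"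
  have "\<bar>2 * curve v t - 1\<bar> \<le> 1" using curve_bounds[of v t] by (simp add: abs_le_iff)
  then have "c v * \<bar>2 * curve v t - 1\<bar> \<le> c v * 1" using c_pos[OF v] by (intro mult_left_mono) auto
  then show ?thesis using v c_pos[OF v] by (simp add: point_def abs_mult)
qed

lemma ev_point_continuous: "continuous_on UNIV (\<lambda>t. ev P (point t))"
proof -
  have "continuous_on UNIV (\<lambda>t. point t v)" for v
    unfolding point_def by (cases "v \<in> var_set N") (auto intro!: continuous_intros continuous_curve)
  then show ?thesis unfolding ev_def by (intro continuous_intros) auto
qed

end

lemma ev_bounded_on_box:
  assumes P: "P \<in> Sym_gr N" and c: "\<And>v. v \<in> var_set N \<Longrightarrow> c v \<ge> 0"
  obtains K where "\<And>y. (\<And>v. v \<in> var_set N \<Longrightarrow> \<bar>y v\<bar> \<le> c v) \<Longrightarrow> \<bar>ev P y\<bar> \<le> K"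
proof -
  let ?box = "\<lambda>y. \<forall>v\<in>var_set N. \<bar>y v\<bar> \<le> c v"
  have "\<exists>K. \<forall>y. ?box y \<longrightarrow> \<bar>ev P y\<bar> \<le> K"
    using P
  proof (induction rule: Sym_gr_induct)
    case one
    then show ?case by auto
  next
    case (add P Q)
    then obtain K1 K2 where K: "\<forall>y. ?box y \<longrightarrow> \<bar>ev P y\<bar> \<le> K1" "\<forall>y. ?box y \<longrightarrow> \<bar>ev Q y\<bar> \<le> K2" by blast
    have "\<bar>ev (P + Q) y\<bar> \<le> K1 + K2" if "?box y" for y
      using K that unfolding ev_add by (intro order.trans[OF abs_triangle_ineq add_mono]) auto
    then show ?case by blast
  next
    case (scale s P)
    then obtain K where K: "\<forall>y. ?box y \<longrightarrow> \<bar>ev P y\<bar> \<le> K" by blast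
    have "\<bar>ev (const_gpoly s * P) y\<bar> \<le> \<bar>s\<bar> * K" if "?box y" for y
      using K that unfolding ev_scale abs_mult by (intro mult_left_mono) auto
    then show ?case by blast
  next
    case (var m i P)
    then obtain K where K: "\<forall>y. ?box y \<longrightarrow> \<bar>ev P y\<bar> \<le> K" by blast
    have "\<bar>ev (w_var m i * P) y\<bar> \<le> c (m, i) * K" if "?box y" for y
      using K that var.hyps(1) c unfolding ev_w_var_mult abs_mult by (intro mult_mono) auto
    then show ?case by blast
  qed
  then show ?thesis using that by blast
qed

context bounded_state
begin

lemma integrable_ev_point:
  assumes "P \<in> Sym_gr N" "real_distribution \<nu>"
  shows "integrable \<nu> (\<lambda>t. ev P (point t))"
proof -
  interpret real_distribution \<nu> by fact
  obtain K where "\<And>y. (\<And>v. v \<in> var_set N \<Longrightarrow> \<bar>y v\<bar> \<le> c v) \<Longrightarrow> \<bar>ev P y\<bar> \<le> K"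
    using ev_bounded_on_box[OF assms(1), of c] c_pos by (metis less_imp_le)
  then have "\<bar>ev P (point t)\<bar> \<le> K" for t using point_bound by blast
  moreover have "(\<lambda>t. ev P (point t)) \<in> borel_measurable \<nu>"
    using borel_measurable_continuous_onI[OF ev_point_continuous] by simp
  ultimately show ?thesis by (intro integrable_const_bound[where B = K]) auto
qed

lemma w_var_eq_uvar:
  assumes v: "(m, i) \<in> var_set N"
  shows "w_var m i = const_gpoly (2 * c (m, i)) * uvar (m, i) - const_gpoly (c (m, i))"
proof -
  have "const_gpoly (2 * c (m, i)) * uvar (m, i) = const_gpoly (c (m, i)) * (1 + yvar (m, i))"
    unfolding uvar_def mult.assoc[symmetric] const_gpoly_mult[symmetric] by simp
  also have "\<dots> = const_gpoly (c (m, i)) + const_gpoly (c (m, i) * (1 / c (m, i))) * w_var m i"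
    unfolding yvar_def by (simp only: distrib_left mult_1_right mult.assoc[symmetric] const_gpoly_mult fst_conv snd_conv)
  also have "c (m, i) * (1 / c (m, i)) = 1" using c_pos[OF v] by simp
  finally show ?thesis by simp
qed

theorem representing_measure:
  obtains \<nu> where "real_distribution \<nu>" "\<And>P. P \<in> Sym_gr N \<Longrightarrow> (\<integral>t. ev P (point t) \<partial>\<nu>) = L P"
proof -
  obtain \<nu> where \<nu>: "real_distribution \<nu>" and mom: "\<And>S \<alpha>. finite S \<Longrightarrow> S \<subseteq> var_set N \<Longrightarrow>
      (\<integral>t. (\<Prod>v\<in>S. curve v t ^ \<alpha> v) \<partial>\<nu>) = L (\<Prod>v\<in>S. uvar v ^ \<alpha> v)"
    using curve_measure by blast
  define up where "up = (\<lambda>S \<alpha>. \<Prod>v\<in>S. uvar v ^ \<alpha> v)"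
  have up_Sym: "up S \<alpha> \<in> Sym_gr N" if "S \<subseteq> var_set N" for S \<alpha>
    using that unfolding up_def by (intro Sym_prod Sym_power uvar_Sym) auto
  have ev_uvar: "ev (uvar v) (point t) = curve v t" if v: "v \<in> var_set N" for v t
  proof -
    have "ev (uvar v) (point t) = 1 / 2 * (1 + 1 / c v * point t v)"
      by (simp only: uvar_def yvar_def ev_scale ev_add ev_1 ev_w_var prod.collapse)
    then show ?thesis using v c_pos[OF v] by (simp add: point_def)
  qed
  have ev_up: "ev (up S \<alpha>) (point t) = (\<Prod>v\<in>S. curve v t ^ \<alpha> v)" if S: "S \<subseteq> var_set N" for S \<alpha> t
  proof -
    have "ev (up S \<alpha>) (point t) = (\<Prod>v\<in>S. ev (uvar v ^ \<alpha> v) (point t))"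
      unfolding up_def using S by (intro ev_prod[where N = N] Sym_power uvar_Sym) auto
    also have "\<dots> = (\<Prod>v\<in>S. curve v t ^ \<alpha> v)"
      using S by (intro prod.cong refl) (auto simp: ev_power[OF uvar_Sym] ev_uvar)
    finally show ?thesis .
  qed
  have "\<forall>S \<alpha>. finite S \<and> S \<subseteq> var_set N \<longrightarrow> (\<integral>t. ev (P * up S \<alpha>) (point t) \<partial>\<nu>) = L (P * up S \<alpha>)"
    if "P \<in> Sym_gr N" for P
    using that
  proof (induction rule: Sym_gr_induct)
    case one
    then show ?case using mom by (simp add: ev_up) (simp add: up_def)
  next
    case (add P Q)
    show ?case
    proof (intro allI impI)
      fix S and \<alpha> :: "nat \<times> nat \<Rightarrow> nat" assume S: "finite S \<and> S \<subseteq> var_set N"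
      have *: "P * up S \<alpha> \<in> Sym_gr N" "Q * up S \<alpha> \<in> Sym_gr N" using add.hyps up_Sym S by (auto intro!: Sym_mult)
      have "(\<integral>t. ev ((P + Q) * up S \<alpha>) (point t) \<partial>\<nu>) = (\<integral>t. ev (P * up S \<alpha>) (point t) + ev (Q * up S \<alpha>) (point t) \<partial>\<nu>)"
        by (simp only: distrib_right ev_add)
      also have "\<dots> = L (P * up S \<alpha>) + L (Q * up S \<alpha>)"
        using add.IH S by (subst Bochner_Integration.integral_add) (auto intro: integrable_ev_point[OF _ \<nu>] *)
      finally show "(\<integral>t. ev ((P + Q) * up S \<alpha>) (point t) \<partial>\<nu>) = L ((P + Q) * up S \<alpha>)"
        by (simp only: distrib_right L_add *)
    qed
  next
    case (scale s P)
    show ?case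
    proof (intro allI impI)
      fix S and \<alpha> :: "nat \<times> nat \<Rightarrow> nat" assume S: "finite S \<and> S \<subseteq> var_set N"
      have *: "P * up S \<alpha> \<in> Sym_gr N" using scale.hyps up_Sym S by (auto intro!: Sym_mult)
      show "(\<integral>t. ev (const_gpoly s * P * up S \<alpha>) (point t) \<partial>\<nu>) = L (const_gpoly s * P * up S \<alpha>)"
        using scale.IH S by (simp add: mult.assoc ev_scale L_scale *)
    qed
  next
    case (var m i P)
    show ?case
    proof (intro allI impI)
      fix S and \<alpha> :: "nat \<times> nat \<Rightarrow> nat" assume S: "finite S \<and> S \<subseteq> var_set N"
      define S' \<beta> where "S' = insert (m, i) S" and "\<beta> = \<alpha>((m, i) := (if (m, i) \<in> S then Suc (\<alpha> (m, i)) else 1))"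
      have S': "finite S' \<and> S' \<subseteq> var_set N" using S var.hyps(1) by (auto simp: S'_def)
      \<comment> \<open>Another factor \<open>u\<^sub>m\<^sub>,\<^sub>i\<close> raises an exponent by one.\<close>
      have up': "uvar (m, i) * up S \<alpha> = up S' \<beta>"
      proof (cases "(m, i) \<in> S")
        case True
        have "up S \<alpha> = uvar (m, i) ^ \<alpha> (m, i) * (\<Prod>v\<in>S - {(m, i)}. uvar v ^ \<alpha> v)"
          unfolding up_def using S True by (intro prod.remove) auto
        moreover have "up S' \<beta> = uvar (m, i) ^ \<beta> (m, i) * (\<Prod>v\<in>S - {(m, i)}. uvar v ^ \<beta> v)"
          unfolding up_def S'_def insert_absorb[OF True] using S True by (intro prod.remove) auto
        moreover have "(\<Prod>v\<in>S - {(m, i)}. uvar v ^ \<beta> v) = (\<Prod>v\<in>S - {(m, i)}. uvar v ^ \<alpha> v)"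
          by (intro prod.cong) (auto simp: \<beta>_def)
        ultimately show ?thesis using True by (simp add: \<beta>_def mult.assoc)
      next
        case False
        have "up S' \<beta> = uvar (m, i) ^ \<beta> (m, i) * (\<Prod>v\<in>S. uvar v ^ \<beta> v)"
          unfolding up_def S'_def using S False by (intro prod.insert) auto
        moreover have "(\<Prod>v\<in>S. uvar v ^ \<beta> v) = up S \<alpha>"
          unfolding up_def using False by (intro prod.cong) (auto simp: \<beta>_def)
        ultimately show ?thesis using False by (simp add: \<beta>_def)
      qed
      have *: "P * up S \<alpha> \<in> Sym_gr N" "P * up S' \<beta> \<in> Sym_gr N"
        using var.hyps up_Sym S S' by (auto intro!: Sym_mult)
      have split: "w_var m i * P * up S \<alpha> = const_gpoly (2 * c (m, i)) * (P * up S' \<beta>) + const_gpoly (- c (m, i)) * (P * up S \<alpha>)"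
        unfolding w_var_eq_uvar[OF var.hyps(1)] up'[symmetric] const_gpoly_uminus
        by (simp only: diff_conv_add_uminus distrib_right distrib_left mult.assoc mult.left_commute mult_minus_left mult_minus_right)
      have "(\<integral>t. ev (w_var m i * P * up S \<alpha>) (point t) \<partial>\<nu>)
        = (\<integral>t. 2 * c (m, i) * ev (P * up S' \<beta>) (point t) + - c (m, i) * ev (P * up S \<alpha>) (point t) \<partial>\<nu>)"
        unfolding split ev_add ev_scale ..
      also have "\<dots> = 2 * c (m, i) * L (P * up S' \<beta>) + - c (m, i) * L (P * up S \<alpha>)"
        using var.IH S S' by (subst Bochner_Integration.integral_add) (auto intro!: integrable_ev_point[OF _ \<nu>] *)
      also have "\<dots> = L (w_var m i * P * up S \<alpha>)"
        unfolding split by (simp only: L_add L_scale Sym_scale *)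
      finally show "(\<integral>t. ev (w_var m i * P * up S \<alpha>) (point t) \<partial>\<nu>) = L (w_var m i * P * up S \<alpha>)" .
    qed
  qed
  then have "(\<integral>t. ev (P * up {} (\<lambda>_. 0)) (point t) \<partial>\<nu>) = L (P * up {} (\<lambda>_. 0))" if "P \<in> Sym_gr N" for P
    using that by blast
  then have "(\<integral>t. ev P (point t) \<partial>\<nu>) = L P" if "P \<in> Sym_gr N" for P
    using that by (simp add: up_def)
  then show ?thesis using that \<nu> by blast
qed

end

section \<open>Determinacy\<close>

lemma measurable_coordinate [measurable]: "(\<lambda>y :: nat \<times> nat \<Rightarrow> real. y v) \<in> borel_measurable borel"
  by (intro borel_measurable_continuous_onI) simp

lemma measurable_ev [measurable]: "ev P \<in> borel_measurable borel"
  unfolding ev_def[abs_def] by measurable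

lemma polynomial_in_coordinate:
  assumes "real_polynomial_function q" and v: "(m, i) \<in> var_set N"
  shows "\<exists>Q\<in>Sym_gr N. \<forall>y. ev Q y = q (y (m, i))"
  using assms(1)
proof induction
  case (linear f)
  have f: "x * f 1 = f x" for x :: real
    using linear_cmul[OF bounded_linear.linear[OF linear], of x 1] by simp
  have "ev (const_gpoly (f 1) * w_var m i) y = f (y (m, i))" for y
    unfolding ev_scale ev_w_var f[symmetric, of "y (m, i)"] by (rule mult.commute)
  then show ?case using Sym_scale[OF Sym_w_var[OF v]] by blast
next
  case (const s)
  then show ?case by (intro bexI[of _ "const_gpoly s"]) (auto simp: Sym_const)
next
  case (add f g)
  then obtain P Q where "P \<in> Sym_gr N" "Q \<in> Sym_gr N" "\<forall>y. ev P y = f (y (m, i))" "\<forall>y. ev Q y = g (y (m, i))" by blast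
  then show ?case by (intro bexI[of _ "P + Q"]) (auto simp: ev_add intro: Sym_add)
next
  case (mult f g)
  then obtain P Q where "P \<in> Sym_gr N" "Q \<in> Sym_gr N" "\<forall>y. ev P y = f (y (m, i))" "\<forall>y. ev Q y = g (y (m, i))" by blast
  then show ?case by (intro bexI[of _ "P * Q"]) (auto simp: ev_mult intro: Sym_mult)
qed

text \<open>On a bounded interval the indicator of a half line is a bounded pointwise limit of polynomials.\<close>

lemma half_line_approx:
  fixes a c :: real
  obtains q where "\<And>k. real_polynomial_function (q k)" "\<And>k t. \<bar>t\<bar> \<le> c \<Longrightarrow> \<bar>q k t\<bar> \<le> 2"
    "\<And>t. \<bar>t\<bar> \<le> c \<Longrightarrow> (\<lambda>k. q k t) \<longlonglongrightarrow> indicator {..a} t"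
proof -
  define f where "f = (\<lambda>(k::nat) t. max 0 (min 1 (1 - real k * (t - a))))"
  have "\<exists>g. real_polynomial_function g \<and> (\<forall>t\<in>{-c..c}. \<bar>f k t - g t\<bar> < 1 / real (Suc k))" for k
  proof -
    have "continuous_on {-c..c} (f k)" unfolding f_def by (intro continuous_intros)
    then obtain g where "real_polynomial_function g" "\<And>t. t \<in> {-c..c} \<Longrightarrow> \<bar>f k t - g t\<bar> < 1 / real (Suc k)"
      using Stone_Weierstrass_real_polynomial_function[of "{-c..c}" "f k" "1 / real (Suc k)"] by auto
    then show ?thesis by blast
  qed
  then obtain q where q: "\<And>k. real_polynomial_function (q k)"
    "\<And>k t. t \<in> {-c..c} \<Longrightarrow> \<bar>f k t - q k t\<bar> < 1 / real (Suc k)" by metis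
  have f1: "\<bar>f k t\<bar> \<le> 1" for k t by (auto simp: f_def)
  have "\<bar>q k t\<bar> \<le> 2" if "\<bar>t\<bar> \<le> c" for k t
  proof -
    have "\<bar>f k t - q k t\<bar> < 1 / real (Suc k)" using that by (intro q) auto
    moreover have "1 / real (Suc k) \<le> 1" by simp
    ultimately show ?thesis using f1[of k t] by linarith
  qed
  moreover have "(\<lambda>k. q k t) \<longlonglongrightarrow> indicator {..a} t" if t: "\<bar>t\<bar> \<le> c" for t
  proof -
    have t_in: "t \<in> {-c..c}" using t by auto
    have "(\<lambda>k. f k t - q k t) \<longlonglongrightarrow> 0"
    proof (rule Lim_null_comparison)
      show "\<forall>\<^sub>F k in sequentially. norm (f k t - q k t) \<le> 1 / real (Suc k)"
        using less_imp_le[OF q(2)[OF t_in]] by (intro always_eventually allI) (simp only: real_norm_def)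
      show "(\<lambda>k. 1 / real (Suc k)) \<longlonglongrightarrow> 0" by (rule LIMSEQ_Suc[OF lim_1_over_n])
    qed
    moreover have "(\<lambda>k. f k t) \<longlonglongrightarrow> indicator {..a} t"
    proof (cases "t \<le> a")
      case True
      then have "f k t = 1" for k by (auto simp: f_def mult_nonneg_nonpos)
      then show ?thesis using True by simp
    next
      case False
      then obtain n where n: "1 < real n * (t - a)" using reals_Archimedean3[of "t - a"] by auto
      have "f k t = 0" if "k \<ge> n" for k
      proof -
        have "real n * (t - a) \<le> real k * (t - a)" using that False by (intro mult_right_mono) auto
        then show ?thesis using n by (auto simp: f_def)
      qed
      then have "\<forall>\<^sub>F k in sequentially. f k t = 0" by (auto simp: eventually_sequentially)
      then show ?thesis using False by (simp add: tendsto_eventually)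
    qed
    ultimately have "(\<lambda>k. f k t - (f k t - q k t)) \<longlonglongrightarrow> indicator {..a} t - 0" by (intro tendsto_diff)
    then show ?thesis by simp
  qed
  ultimately show ?thesis using that q(1) by blast
qed

text \<open>Two probability measures on the space of all coordinates with the same moments in the variables of
  \<open>W\<close>, the first of them concentrated on a box. The other coordinates vanish almost surely.\<close>

locale same_moments =
  fixes N :: "nat \<Rightarrow> nat" and \<mu> \<nu> :: "(nat \<times> nat \<Rightarrow> real) measure" and c :: "nat \<times> nat \<Rightarrow> real"
  assumes prob: "prob_space \<mu>" "prob_space \<nu>"
    and sets: "sets \<mu> = sets borel" "sets \<nu> = sets borel"
    and int: "\<And>P. P \<in> Sym_gr N \<Longrightarrow> integrable \<mu> (ev P)" "\<And>P. P \<in> Sym_gr N \<Longrightarrow> integrable \<nu> (ev P)"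
    and moments: "\<And>P. P \<in> Sym_gr N \<Longrightarrow> (\<integral>y. ev P y \<partial>\<mu>) = (\<integral>y. ev P y \<partial>\<nu>)"
    and box: "\<And>v. v \<in> var_set N \<Longrightarrow> AE y in \<mu>. \<bar>y v\<bar> \<le> c v"
    and c_pos: "\<And>v. v \<in> var_set N \<Longrightarrow> c v > 0"
    and zero: "\<And>v. v \<notin> var_set N \<Longrightarrow> AE y in \<mu>. y v = 0" "\<And>v. v \<notin> var_set N \<Longrightarrow> AE y in \<nu>. y v = 0"
begin

sublocale \<mu>: prob_space \<mu> by (rule prob)
sublocale \<nu>: prob_space \<nu> by (rule prob)

lemma meas_cong [measurable_cong]: "sets \<mu> = sets borel" "sets \<nu> = sets borel"
  by (rule sets)+

lemma even_power_le: "\<bar>x\<bar> \<le> a \<Longrightarrow> x ^ (2 * k) \<le> a ^ (2 * k)" for a x :: real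
  using power_mono[of "\<bar>x\<bar>" a "2 * k"] by (simp add: power_even_abs)

lemma even_power_ge: "0 \<le> a \<Longrightarrow> a \<le> \<bar>x\<bar> \<Longrightarrow> a ^ (2 * k) \<le> x ^ (2 * k)" for a x :: real
  using power_mono[of a "\<bar>x\<bar>" "2 * k"] by (simp add: power_even_abs)

text \<open>The growth of the even moments confines the second measure to the box of the first.\<close>

lemma box_\<nu>:
  assumes v: "v \<in> var_set N"
  shows "AE y in \<nu>. \<bar>y v\<bar> \<le> c v"
proof -
  obtain m i where mi: "v = (m, i)" by (cases v)
  have w: "w_var m i \<in> Sym_gr N" using v mi by (simp add: Sym_w_var)
  have ev_w: "ev (w_var m i ^ k) = (\<lambda>y. y v ^ k)" for k by (rule ext) (simp add: ev_power[OF w] mi)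
  have mom: "(\<integral>y. y v ^ (2 * k) \<partial>\<nu>) \<le> c v ^ (2 * k)" for k
  proof -
    have "(\<integral>y. y v ^ (2 * k) \<partial>\<nu>) = (\<integral>y. y v ^ (2 * k) \<partial>\<mu>)"
      using moments[OF Sym_power[OF w, of "2 * k"]] by (simp add: ev_w)
    also have "\<dots> \<le> (\<integral>y. c v ^ (2 * k) \<partial>\<mu>)"
    proof (rule integral_mono_AE)
      show "integrable \<mu> (\<lambda>y. y v ^ (2 * k))" using int(1)[OF Sym_power[OF w, of "2 * k"]] by (simp add: ev_w)
      show "AE y in \<mu>. y v ^ (2 * k) \<le> c v ^ (2 * k)"
        using box[OF v] by eventually_elim (rule even_power_le)
    qed simp
    also have "\<dots> = c v ^ (2 * k)" by (simp add: \<mu>.prob_space)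
    finally show ?thesis .
  qed
  have "measure \<nu> {y. c v * (1 + 1 / real (Suc j)) \<le> \<bar>y v\<bar>} = 0" for j
  proof (rule ccontr)
    define a where "a = c v * (1 + 1 / real (Suc j))"
    define E where "E = {y :: nat \<times> nat \<Rightarrow> real. a \<le> \<bar>y v\<bar>}"
    have a: "a > 0" "a / c v > 1" using c_pos[OF v] unfolding a_def by (auto intro!: mult_pos_pos add_pos_pos)
    have E: "E \<in> sets \<nu>" unfolding E_def sets by measurable
    assume "measure \<nu> {y. c v * (1 + 1 / real (Suc j)) \<le> \<bar>y v\<bar>} \<noteq> 0"
    then have pos: "measure \<nu> E > 0" by (simp add: E_def a_def zero_less_measure_iff)
    have "((a / c v)\<^sup>2) ^ (2 ^ k) \<le> 1 / measure \<nu> E" for k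
    proof -
      have "measure \<nu> E * a ^ (2 * 2 ^ k) = (\<integral>y. indicator E y * a ^ (2 * 2 ^ k) \<partial>\<nu>)"
        using E by simp
      also have "\<dots> \<le> (\<integral>y. y v ^ (2 * 2 ^ k) \<partial>\<nu>)"
      proof (rule integral_mono)
        show "integrable \<nu> (\<lambda>y. indicator E y * a ^ (2 * 2 ^ k))"
          using E by (intro integrable_mult_left integrable_real_indicator) (auto simp: \<nu>.emeasure_finite less_top[symmetric])
        show "integrable \<nu> (\<lambda>y. y v ^ (2 * 2 ^ k))" using int(2)[OF Sym_power[OF w, of "2 * 2 ^ k"]] by (simp add: ev_w)
        fix y
        show "indicator E y * a ^ (2 * 2 ^ k) \<le> y v ^ (2 * 2 ^ k)"
          using even_power_ge[of a "y v" "2 ^ k"] a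
          by (simp add: E_def indicator_def power_mult)
      qed
      also have "\<dots> \<le> c v ^ (2 * 2 ^ k)" by (rule mom)
      finally have "measure \<nu> E * (a / c v) ^ (2 * 2 ^ k) \<le> 1"
        using c_pos[OF v] by (simp add: power_divide field_simps)
      then show ?thesis using pos by (simp add: power_mult field_simps)
    qed
    then have "(a / c v)\<^sup>2 \<le> 1" by (rule le_1_if_powers_bounded)
    then have "\<bar>a / c v\<bar> \<le> 1" unfolding abs_square_le_1 .
    then show False using a(2) abs_ge_self[of "a / c v"] by linarith
  qed
  then have "emeasure \<nu> {y. c v * (1 + 1 / real (Suc j)) \<le> \<bar>y v\<bar>} = 0" for j
    by (simp add: \<nu>.emeasure_eq_measure)
  moreover have "{y. c v * (1 + 1 / real (Suc j)) \<le> \<bar>y v\<bar>} \<in> sets \<nu>" for j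
    unfolding sets by measurable
  ultimately have "AE y in \<nu>. \<not> c v * (1 + 1 / real (Suc j)) \<le> \<bar>y v\<bar>" for j
    by (intro AE_I[where N = "{y. c v * (1 + 1 / real (Suc j)) \<le> \<bar>y v\<bar>}"]) auto
  then have "AE y in \<nu>. \<forall>j. \<not> c v * (1 + 1 / real (Suc j)) \<le> \<bar>y v\<bar>" by (simp add: AE_all_countable)
  then show ?thesis
  proof eventually_elim
    case (elim y)
    have "(\<lambda>j. c v * (1 + 1 / real (Suc j))) \<longlonglongrightarrow> c v * (1 + 0)"
      by (intro tendsto_intros LIMSEQ_Suc[OF lim_1_over_n])
    then show ?case using elim by (intro LIMSEQ_le_const[where X = "\<lambda>j. c v * (1 + 1 / real (Suc j))"]) (auto simp: not_le intro: less_imp_le)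
  qed
qed

text \<open>The indicator of a cylinder set.\<close>

definition cyl :: "(nat \<times> nat) set \<Rightarrow> (nat \<times> nat \<Rightarrow> real set) \<Rightarrow> (nat \<times> nat \<Rightarrow> real) \<Rightarrow> real" where
  "cyl J A y = (\<Prod>v\<in>J. indicator (A v) (y v))"

lemma cyl_bounds: "0 \<le> cyl J A y" "cyl J A y \<le> 1"
  unfolding cyl_def by (auto intro!: prod_nonneg prod_le_1 simp: indicator_def)

lemma cyl_measurable:
  assumes "\<And>v. v \<in> J \<Longrightarrow> A v \<in> sets borel"
  shows "cyl J A \<in> borel_measurable borel"
proof -
  have "(\<lambda>y. indicator (A v) (y v) :: real) \<in> borel_measurable borel" if "v \<in> J" for v
    using assms[OF that] by measurable
  then show ?thesis unfolding cyl_def[abs_def] by (rule borel_measurable_prod)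
qed

text \<open>One coordinate is added at a time. For a half line the indicator is a bounded limit of polynomials in
  the coordinate, which are absorbed into the polynomial factor \<open>P\<close>; this is why the claim is proved
  with such a factor. The passage to all Borel sets is a Dynkin system argument.\<close>

lemma cyl_moments:
  assumes "finite J" "J \<subseteq> var_set N" "\<And>v. v \<in> J \<Longrightarrow> A v \<in> sets borel" "P \<in> Sym_gr N"
  shows "(\<integral>y. ev P y * cyl J A y \<partial>\<mu>) = (\<integral>y. ev P y * cyl J A y \<partial>\<nu>)"
  using assms
proof (induction J arbitrary: P rule: finite_induct)
  case empty
  then show ?case using moments by (simp add: cyl_def)
next
  case (insert w J)
  obtain m i where mi: "w = (m, i)" by (cases w)
  have w: "w \<in> var_set N" using insert.prems by simp
  define g where "g = (\<lambda>y. ev P y * cyl J A y)"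
  have cyl_m: "cyl J A \<in> borel_measurable borel" using insert.prems by (intro cyl_measurable) auto
  then have g_m [measurable]: "g \<in> borel_measurable borel" unfolding g_def by measurable
  have g_le: "\<bar>g y\<bar> \<le> \<bar>ev P y\<bar>" for y
    using cyl_bounds[of J A y] by (simp add: g_def abs_mult mult_left_le)
  \<comment> \<open>Dominated convergence for both measures, with the dominating function \<open>2 \<bar>ev P y\<bar>\<close>.\<close>
  have dom: "integrable M (\<lambda>y. g y * f y) \<and> (\<forall>F. (\<forall>k. F k \<in> borel_measurable borel) \<longrightarrow> (AE y in M. \<forall>k. \<bar>F k y\<bar> \<le> 2)
      \<longrightarrow> (AE y in M. (\<lambda>k. F k y) \<longlonglongrightarrow> f y) \<longrightarrow> (\<lambda>k. \<integral>y. g y * F k y \<partial>M) \<longlonglongrightarrow> (\<integral>y. g y * f y \<partial>M))"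
    if M: "M = \<mu> \<or> M = \<nu>" and f: "f \<in> borel_measurable borel" "AE y in M. \<bar>f y\<bar> \<le> 2" for M and f :: "(nat \<times> nat \<Rightarrow> real) \<Rightarrow> real"
  proof -
    have [measurable_cong]: "sets M = sets borel" using M sets by blast
    have intP: "integrable M (ev P)" using M int insert.prems(3) by blast
    note f(1) [measurable]
    have i2: "integrable M (\<lambda>y. 2 * \<bar>ev P y\<bar>)" using intP by simp
    have bd: "\<bar>g y * s\<bar> \<le> 2 * \<bar>ev P y\<bar>" if "\<bar>s\<bar> \<le> 2" for s y
      using mult_mono[OF g_le that] by (simp add: abs_mult mult.commute)
    have "integrable M (\<lambda>y. g y * f y)"
      by (rule Bochner_Integration.integrable_bound[OF i2]) (use f(2) bd in \<open>auto simp del: abs_mult\<close>)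
    moreover have "(\<lambda>k. \<integral>y. g y * F k y \<partial>M) \<longlonglongrightarrow> (\<integral>y. g y * f y \<partial>M)"
      if F: "\<forall>k. F k \<in> borel_measurable borel" "AE y in M. \<forall>k. \<bar>F k y\<bar> \<le> 2" "AE y in M. (\<lambda>k. F k y) \<longlonglongrightarrow> f y" for F
    proof (rule integral_dominated_convergence[OF _ _ i2])
      have [measurable]: "F k \<in> borel_measurable borel" for k using F(1) by blast
      show "(\<lambda>y. g y * F k y) \<in> borel_measurable M" for k by measurable
      show "(\<lambda>y. g y * f y) \<in> borel_measurable M" by measurable
      show "AE y in M. (\<lambda>k. g y * F k y) \<longlonglongrightarrow> g y * f y" using F(3) by eventually_elim (intro tendsto_intros)
      show "AE y in M. norm (g y * F k y) \<le> 2 * \<bar>ev P y\<bar>" for k using F(2) by eventually_elim (simp only: real_norm_def bd)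
    qed
    ultimately show ?thesis by blast
  qed
  have ind_m: "(\<lambda>y. indicator B (y w) :: real) \<in> borel_measurable borel" if "B \<in> sets borel" for B :: "real set"
    using that by measurable
  have ind2: "AE y in M. \<bar>indicator B (y w) :: real\<bar> \<le> 2" for B and M :: "(nat \<times> nat \<Rightarrow> real) measure"
    by (simp add: indicator_def)
  note dom_ind = dom[OF _ ind_m ind2]
  have half: "(\<integral>y. g y * indicator {..a} (y w) \<partial>\<mu>) = (\<integral>y. g y * indicator {..a} (y w) \<partial>\<nu>)" for a
  proof -
    obtain q where q: "\<And>k. real_polynomial_function (q k)" "\<And>k t. \<bar>t\<bar> \<le> c w \<Longrightarrow> \<bar>q k t\<bar> \<le> 2"
      "\<And>t. \<bar>t\<bar> \<le> c w \<Longrightarrow> (\<lambda>k. q k t) \<longlonglongrightarrow> indicator {..a} t"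
      using half_line_approx[of "c w" a] by blast
    have "\<forall>k. \<exists>Q. Q \<in> Sym_gr N \<and> (\<forall>y. ev Q y = q k (y w))"
      using polynomial_in_coordinate[OF q(1), of m i N] w mi by blast
    from choice[OF this] obtain Q where Q: "\<And>k. Q k \<in> Sym_gr N" "\<And>k y. ev (Q k) y = q k (y w)" by blast
    have lim: "(\<lambda>k. \<integral>y. g y * ev (Q k) y \<partial>M) \<longlonglongrightarrow> (\<integral>y. g y * indicator {..a} (y w) \<partial>M)"
      if M: "M = \<mu> \<or> M = \<nu>" for M
    proof -
      have b: "AE y in M. \<bar>y w\<bar> \<le> c w" using M box[OF w] box_\<nu>[OF w] by blast
      show ?thesis
      proof (rule dom_ind[OF M, THEN conjunct2, rule_format])
        show "AE y in M. \<forall>k. \<bar>ev (Q k) y\<bar> \<le> 2" using b by eventually_elim (simp add: Q(2) q(2))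
        show "AE y in M. (\<lambda>k. ev (Q k) y) \<longlonglongrightarrow> indicator {..a} (y w)" using b by eventually_elim (simp add: Q(2) q(3))
      qed (simp_all add: measurable_ev)
    qed
    have "(\<integral>y. g y * ev (Q k) y \<partial>\<mu>) = (\<integral>y. g y * ev (Q k) y \<partial>\<nu>)" for k
      using insert.IH[OF _ _ Sym_mult[OF insert.prems(3) Q(1)[of k]]] insert.prems
      by (simp add: g_def ev_mult[OF insert.prems(3)] mult_ac)
    then show ?thesis using LIMSEQ_unique[OF lim[of \<mu>]] lim[of \<nu>] by simp
  qed
  have stable: "Int_stable (range (\<lambda>a::real. {..a}))" by (auto simp: Int_stable_def)
  have "B \<in> sets borel \<and> (\<integral>y. g y * indicator B (y w) \<partial>\<mu>) = (\<integral>y. g y * indicator B (y w) \<partial>\<nu>)"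
    if B: "B \<in> sigma_sets UNIV (range (\<lambda>a::real. {..a}))" for B
    using stable subset_Pow_Union[of "range (\<lambda>a::real. {..a})", THEN order.trans, OF Pow_mono[OF subset_UNIV]] B
  proof (induction rule: sigma_sets_induct_disjoint)
    case (basic A)
    then show ?case using half by auto
  next
    case empty
    then show ?case by simp
  next
    case (compl A)
    have A: "A \<in> sets borel" using compl by blast
    have eq: "(\<integral>y. g y * indicator (UNIV - A) (y w) \<partial>M) = (\<integral>y. g y * 1 \<partial>M) - (\<integral>y. g y * indicator A (y w) \<partial>M)"
      if M: "M = \<mu> \<or> M = \<nu>" for M
    proof -
      have "(\<integral>y. g y * indicator (UNIV - A) (y w) \<partial>M) = (\<integral>y. g y * 1 - g y * indicator A (y w) \<partial>M)"
        by (intro Bochner_Integration.integral_cong refl) (simp add: indicator_def)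
      also have "\<dots> = (\<integral>y. g y * 1 \<partial>M) - (\<integral>y. g y * indicator A (y w) \<partial>M)"
        using dom[OF M, of "\<lambda>_. 1", THEN conjunct1] dom_ind[OF M A, THEN conjunct1]
        by (intro Bochner_Integration.integral_diff) auto
      finally show ?thesis .
    qed
    have "(\<integral>y. g y * 1 \<partial>\<mu>) = (\<integral>y. g y * 1 \<partial>\<nu>)"
      using insert.IH[OF _ _ insert.prems(3)] insert.prems by (simp add: g_def)
    then show ?case using eq[of \<mu>] eq[of \<nu>] compl by auto
  next
    case (union A)
    have A: "A k \<in> sets borel" for k using union by blast
    have sums: "(\<lambda>k. indicator (A k) t :: real) sums indicator (\<Union>k. A k) t" for t
      using indicator_sums[of A t] union(1) by (simp add: disjoint_family_on_def)
    have le: "\<bar>\<Sum>k<n. indicator (A k) t :: real\<bar> \<le> 2" for n and t :: real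
    proof -
      have "(\<Sum>k<n. indicator (A k) t :: real) \<le> suminf (\<lambda>k. indicator (A k) t)"
        using sums[of t] by (intro sum_le_suminf) (auto simp: sums_iff)
      also have "\<dots> \<le> 1" using sums[of t] by (simp add: sums_iff indicator_def)
      finally show ?thesis by (simp add: sum_nonneg abs_of_nonneg)
    qed
    have lim: "(\<lambda>n. \<Sum>k<n. \<integral>y. g y * indicator (A k) (y w) \<partial>M) \<longlonglongrightarrow> (\<integral>y. g y * indicator (\<Union>k. A k) (y w) \<partial>M)"
      if M: "M = \<mu> \<or> M = \<nu>" for M
    proof -
      have "(\<lambda>n. \<integral>y. g y * (\<Sum>k<n. indicator (A k) (y w)) \<partial>M) \<longlonglongrightarrow> (\<integral>y. g y * indicator (\<Union>k. A k) (y w) \<partial>M)"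
      proof (rule dom_ind[OF M, THEN conjunct2, rule_format])
        show "(\<lambda>y. \<Sum>k<n. indicator (A k) (y w) :: real) \<in> borel_measurable borel" for n
          using ind_m[OF A] by (intro borel_measurable_sum)
        show "AE y in M. \<forall>n. \<bar>\<Sum>k<n. indicator (A k) (y w) :: real\<bar> \<le> 2" using le by blast
        show "AE y in M. (\<lambda>n. \<Sum>k<n. indicator (A k) (y w)) \<longlonglongrightarrow> (indicator (\<Union>k. A k) (y w) :: real)"
          using sums by (simp add: sums_def)
      qed (use A in blast)
      moreover have "(\<integral>y. g y * (\<Sum>k<n. indicator (A k) (y w)) \<partial>M) = (\<Sum>k<n. \<integral>y. g y * indicator (A k) (y w) \<partial>M)" for n
        unfolding sum_distrib_left using dom_ind[OF M A, THEN conjunct1]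
        by (intro Bochner_Integration.integral_sum) auto
      ultimately show ?thesis by simp
    qed
    have "(\<integral>y. g y * indicator (\<Union>k. A k) (y w) \<partial>\<mu>) = (\<integral>y. g y * indicator (\<Union>k. A k) (y w) \<partial>\<nu>)"
      using LIMSEQ_unique[OF lim[of \<mu>]] lim[of \<nu>] union by simp
    then show ?case using A by auto
  qed
  moreover have "A w \<in> sigma_sets UNIV (range (\<lambda>a::real. {..a}))"
    using insert.prems(2)[of w] by (simp add: borel_eq_atMost)
  ultimately have "(\<integral>y. g y * indicator (A w) (y w) \<partial>\<mu>) = (\<integral>y. g y * indicator (A w) (y w) \<partial>\<nu>)" by blast
  moreover have "ev P y * cyl (insert w J) A y = g y * indicator (A w) (y w)" for y
    using insert.hyps by (simp add: g_def cyl_def mult_ac)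
  ultimately show ?case by simp
qed

theorem measures_eq: "\<mu> = \<nu>"
proof (rule measure_eqI_PiM_infinite[where I = UNIV and M = "\<lambda>_. borel"])
  show "sets \<mu> = sets (PiM UNIV (\<lambda>_. borel))" "sets \<nu> = sets (PiM UNIV (\<lambda>_. borel))"
    by (simp_all only: sets sets_PiM_equal_borel)
  show "finite_measure \<mu>" by unfold_locales
next
  fix A :: "nat \<times> nat \<Rightarrow> real set" and J :: "(nat \<times> nat) set"
  assume J: "finite J" and A: "\<And>v. v \<in> J \<Longrightarrow> A v \<in> sets borel"
  let ?E = "prod_emb UNIV (\<lambda>_. borel) J (PiE J A)"
  define z :: real where "z = (\<Prod>v\<in>J - var_set N. indicator (A v) 0)"
  have E: "y \<in> ?E \<longleftrightarrow> (\<forall>v\<in>J. y v \<in> A v)" for y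
    by (auto simp: prod_emb_def PiE_iff)
  have "measure M ?E = z * (\<integral>y. ev 1 y * cyl (J \<inter> var_set N) A y \<partial>M)" if M: "M = \<mu> \<or> M = \<nu>" for M
  proof -
    have setsM [measurable_cong]: "sets M = sets borel" using M sets by blast
    interpret prob_space M using M prob by blast
    have Em: "?E \<in> sets M"
      unfolding setsM sets_PiM_equal_borel[symmetric] using J A by (intro sets_PiM_I) auto
    have "AE y in M. y v = 0" if "v \<notin> var_set N" for v using M zero[OF that] by blast
    then have "AE y in M. \<forall>v\<in>J - var_set N. y v = 0" using J by (intro AE_finite_allI) auto
    then have "AE y in M. indicator ?E y = z * cyl (J \<inter> var_set N) A y"
    proof eventually_elim
      case (elim y)
      have "indicator ?E y = (\<Prod>v\<in>J. indicator (A v) (y v) :: real)"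
        using J by (auto simp: indicator_def E prod.neutral intro!: prod_zero[symmetric])
      also have "\<dots> = (\<Prod>v\<in>J - var_set N. indicator (A v) (y v)) * cyl (J \<inter> var_set N) A y"
        unfolding cyl_def by (subst prod.Int_Diff[OF J, of _ "var_set N"]) (rule mult.commute)
      also have "(\<Prod>v\<in>J - var_set N. indicator (A v) (y v) :: real) = z"
        unfolding z_def using elim by (intro prod.cong) auto
      finally show ?case .
    qed
    moreover have "cyl (J \<inter> var_set N) A \<in> borel_measurable borel" using A by (intro cyl_measurable) auto
    ultimately have "(\<integral>y. indicator ?E y \<partial>M) = (\<integral>y. z * cyl (J \<inter> var_set N) A y \<partial>M)"
      using Em by (intro integral_cong_AE) auto
    then show ?thesis using Em by simp
  qed
  moreover have "(\<integral>y. ev 1 y * cyl (J \<inter> var_set N) A y \<partial>\<mu>) = (\<integral>y. ev 1 y * cyl (J \<inter> var_set N) A y \<partial>\<nu>)"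
    using J A by (intro cyl_moments Sym_1) auto
  ultimately have "measure \<mu> ?E = measure \<nu> ?E" by simp
  then show "emeasure \<mu> ?E = emeasure \<nu> ?E"
    by (simp add: \<mu>.emeasure_eq_measure \<nu>.emeasure_eq_measure)
qed

end

section \<open>Coordinates on the completed space\<close>

text \<open>Points of \<open>What\<close> are described by all their coordinates; entries at pairs that do not index a
  variable of \<open>W\<close> are set to \<open>0\<close>.\<close>

definition coords :: "(nat \<Rightarrow> nat) \<Rightarrow> (nat \<Rightarrow> nat \<Rightarrow> 'v::real_vector) \<Rightarrow> (nat \<Rightarrow> 'v) \<Rightarrow> nat \<times> nat \<Rightarrow> real" where
  "coords N e x v = (if v \<in> var_set N then dual_basis N e (fst v) (snd v) (x (fst v)) else 0)"

definition synth :: "(nat \<Rightarrow> nat) \<Rightarrow> (nat \<Rightarrow> nat \<Rightarrow> 'v::real_vector) \<Rightarrow> (nat \<times> nat \<Rightarrow> real) \<Rightarrow> nat \<Rightarrow> 'v" where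
  "synth N e y = (\<lambda>m\<in>{1..}. \<Sum>i\<in>{1..N m}. y (m, i) *\<^sub>R e m i)"

lemma eval_gpoly_coords:
  assumes "P \<in> Sym_gr N"
  shows "eval_gpoly N e P x = ev P (coords N e x)"
  unfolding eval_gpoly_def ev_def
proof (intro sum.cong refl arg_cong2[where f = "(*)"] prod.cong)
  fix \<alpha> v assume "\<alpha> \<in> Poly_Mapping.keys P" "v \<in> Poly_Mapping.keys \<alpha>"
  then have "v \<in> var_set N" using assms by (auto simp: Sym_gr_def)
  then show "(case v of (m, i) \<Rightarrow> dual_basis N e m i (x m) ^ Poly_Mapping.lookup \<alpha> (m, i)) = coords N e x v ^ Poly_Mapping.lookup \<alpha> v"
    by (cases v) (simp add: coords_def)
qed

lemma eval_gpoly_fun: "P \<in> Sym_gr N \<Longrightarrow> eval_gpoly N e P = (\<lambda>x. ev P (coords N e x))"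
  by (rule ext) (rule eval_gpoly_coords)

locale graded_coordinates =
  fixes W :: "nat \<Rightarrow> 'v::real_vector set" and N :: "nat \<Rightarrow> nat" and e :: "nat \<Rightarrow> nat \<Rightarrow> 'v"
  assumes basis: "graded_basis W N e"
begin

lemma e_inj: "m \<ge> 1 \<Longrightarrow> inj_on (e m) {1..N m}"
  and e_independent: "m \<ge> 1 \<Longrightarrow> independent (e m ` {1..N m})"
  and e_span: "m \<ge> 1 \<Longrightarrow> span (e m ` {1..N m}) = W m"
  using basis by (auto simp: graded_basis_def)

lemma dual_basis_sum:
  assumes m: "m \<ge> 1" and i: "i \<in> {1..N m}"
  shows "dual_basis N e m i (\<Sum>j\<in>{1..N m}. a j *\<^sub>R e m j) = a i"
proof -
  let ?B = "e m ` {1..N m}"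
  have "representation ?B (\<Sum>j\<in>{1..N m}. a j *\<^sub>R e m j) (e m i) = (\<Sum>j\<in>{1..N m}. representation ?B (a j *\<^sub>R e m j) (e m i))"
    by (subst representation_sum[OF e_independent[OF m]], intro span_scale span_base imageI, assumption, rule refl)
  also have "\<dots> = (\<Sum>j\<in>{1..N m}. if j = i then a j else 0)"
  proof (rule sum.cong[OF refl])
    fix j assume j: "j \<in> {1..N m}"
    have "representation ?B (a j *\<^sub>R e m j) (e m i) = a j * representation ?B (e m j) (e m i)"
      using j by (subst representation_scale[OF e_independent[OF m]]) (auto intro!: span_base)
    also have "representation ?B (e m j) (e m i) = (if e m i = e m j then 1 else 0)"
      using j by (subst representation_basis[OF e_independent[OF m]]) auto
    finally show "representation ?B (a j *\<^sub>R e m j) (e m i) = (if j = i then a j else 0)"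
      using inj_onD[OF e_inj[OF m], of i j] i j by auto
  qed
  also have "\<dots> = a i" using i by (simp add: sum.delta)
  finally show ?thesis by (simp add: dual_basis_def)
qed

lemma sum_dual_basis:
  assumes m: "m \<ge> 1" and x: "x \<in> W m"
  shows "(\<Sum>i\<in>{1..N m}. dual_basis N e m i x *\<^sub>R e m i) = x"
proof -
  let ?B = "e m ` {1..N m}"
  have "x \<in> span ?B" unfolding e_span[OF m] by (rule x)
  then have "(\<Sum>b\<in>?B. representation ?B x b *\<^sub>R b) = x"
    by (intro sum_representation_eq[OF e_independent[OF m]]) simp_all
  then show ?thesis by (simp add: sum.reindex[OF e_inj[OF m]] dual_basis_def del: One_nat_def)
qed

lemma topspace_component: "m \<ge> 1 \<Longrightarrow> topspace (component_topology W N e m) = W m"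
  by (auto simp: component_topology_def topspace_pullback_topology)

lemma topspace_What: "topspace (What W N e) = PiE {1..} W"
  by (auto simp: What_def topspace_component PiE_iff)

lemma synth_topspace: "synth N e y \<in> topspace (What W N e)"
  unfolding topspace_What synth_def
proof (intro restrict_PiE_iff[THEN iffD2] ballI)
  fix m :: nat assume m: "m \<in> {1..}"
  have "(\<Sum>i\<in>{1..N m}. y (m, i) *\<^sub>R e m i) \<in> span (e m ` {1..N m})"
    by (intro span_sum span_scale span_base) auto
  then show "(\<Sum>i\<in>{1..N m}. y (m, i) *\<^sub>R e m i) \<in> W m" using m e_span[of m] by auto
qed

lemma coords_synth: "coords N e (synth N e y) v = (if v \<in> var_set N then y v else 0)"
  by (cases v) (auto simp: coords_def synth_def var_set_def dual_basis_sum simp del: One_nat_def)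

lemma synth_coords:
  assumes "x \<in> topspace (What W N e)" shows "synth N e (coords N e x) = x"
proof (rule ext)
  fix m
  show "synth N e (coords N e x) m = x m"
  proof (cases "m \<in> {1..}")
    case True
    have "synth N e (coords N e x) m = (\<Sum>i\<in>{1..N m}. dual_basis N e m i (x m) *\<^sub>R e m i)"
      using True by (simp add: synth_def coords_def var_set_def)
    also have "\<dots> = x m" using True assms by (intro sum_dual_basis) (auto simp: topspace_What)
    finally show ?thesis .
  next
    case False
    then show ?thesis using assms by (auto simp: synth_def topspace_What PiE_def extensional_def)
  qed
qed

lemma continuous_coords: "continuous_map (What W N e) euclidean (coords N e)"
proof -
  have "continuous_map (What W N e) euclideanreal (\<lambda>x. coords N e x v)" for v
  proof (cases "v \<in> var_set N")
    case True
    then obtain m i where v: "v = (m, i)" "m \<ge> 1" "i \<in> {1..N m}" by (auto simp: var_set_def)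
    have 1: "continuous_map (What W N e) (component_topology W N e m) (\<lambda>x. x m)"
      unfolding What_def using v(2) by (intro continuous_map_product_projection) auto
    have "continuous_map (component_topology W N e m) euclideanreal
        ((\<lambda>y. y i) \<circ> (\<lambda>v. \<lambda>i\<in>{1..N m}. dual_basis N e m i v))"
      unfolding component_topology_def using v(3)
      by (intro continuous_map_pullback continuous_map_product_projection)
    from continuous_map_compose[OF 1 this] show ?thesis
      using v True by (simp add: coords_def o_def)
  next
    case False
    then show ?thesis by (simp add: coords_def)
  qed
  then show ?thesis
    unfolding euclidean_product_topology[symmetric] continuous_map_componentwise_UNIV by blast
qed

lemma continuous_synth: "continuous_map euclidean (What W N e) (synth N e)"
  unfolding What_def continuous_map_componentwise
proof (intro conjI ballI)
  show "synth N e ` topspace euclidean \<subseteq> extensional {1..}" by (auto simp: synth_def)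
  fix m :: nat assume m: "m \<in> {1..}"
  show "continuous_map euclidean (component_topology W N e m) (\<lambda>y. synth N e y m)"
    unfolding component_topology_def
  proof (rule continuous_map_pullback')
    show "topspace euclidean \<subseteq> (\<lambda>y. synth N e y m) -` W m"
      using synth_topspace m by (auto simp: topspace_What PiE_iff)
    have "((\<lambda>v. \<lambda>i\<in>{1..N m}. dual_basis N e m i v) \<circ> (\<lambda>y. synth N e y m)) = (\<lambda>y. \<lambda>i\<in>{1..N m}. y (m, i))"
      using m by (auto simp: fun_eq_iff synth_def dual_basis_sum simp del: One_nat_def)
    then show "continuous_map euclidean (product_topology (\<lambda>_. euclideanreal) {1..N m})
      ((\<lambda>v. \<lambda>i\<in>{1..N m}. dual_basis N e m i v) \<circ> (\<lambda>y. synth N e y m))"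
      by (auto simp: continuous_map_componentwise)
  qed
qed

text \<open>The Borel sets of the completed space, as a measure space without mass.\<close>

definition borel_What :: "(nat \<Rightarrow> 'v) measure" where
  "borel_What = sigma (topspace (What W N e)) {U. openin (What W N e) U}"

lemma opens_Pow: "{U. openin (What W N e) U} \<subseteq> Pow (topspace (What W N e))"
  using openin_subset by blast

lemma sets_borel_What: "sets borel_What = sigma_sets (topspace (What W N e)) {U. openin (What W N e) U}"
  and space_borel_What: "space borel_What = topspace (What W N e)"
  unfolding borel_What_def
  by (rule sets_measure_of[OF opens_Pow]) (rule space_measure_of[OF opens_Pow])

lemma open_sets: "openin (What W N e) U \<Longrightarrow> U \<in> sets borel_What"
  by (auto simp: sets_borel_What)

lemma measurable_coords: "coords N e \<in> measurable borel_What borel"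
proof (rule borel_measurableI)
  fix S :: "(nat \<times> nat \<Rightarrow> real) set" assume "open S"
  then have "openin (What W N e) {x \<in> topspace (What W N e). coords N e x \<in> S}"
    by (intro openin_continuous_map_preimage[OF continuous_coords]) simp
  moreover have "coords N e -` S \<inter> space borel_What = {x \<in> topspace (What W N e). coords N e x \<in> S}"
    by (auto simp: space_borel_What)
  ultimately show "coords N e -` S \<inter> space borel_What \<in> sets borel_What" by (simp add: open_sets)
qed

lemma measurable_synth: "synth N e \<in> measurable borel borel_What"
proof (rule measurable_sigma_sets[OF sets_borel_What])
  show "{U. openin (What W N e) U} \<subseteq> Pow (topspace (What W N e))" by (rule opens_Pow)
  show "synth N e \<in> space borel \<rightarrow> topspace (What W N e)" using synth_topspace by auto
  fix U assume "U \<in> {U. openin (What W N e) U}"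
  then have "openin euclidean {y \<in> topspace euclidean. synth N e y \<in> U}"
    by (intro openin_continuous_map_preimage[OF continuous_synth]) simp
  then show "synth N e -` U \<inter> space borel \<in> sets borel" by (simp add: vimage_def)
qed

lemma distr_coords_synth:
  assumes "sets \<mu> = sets borel_What"
  shows "\<mu> = distr (distr \<mu> borel (coords N e)) borel_What (synth N e)"
proof -
  have [measurable]: "coords N e \<in> measurable \<mu> borel"
    using measurable_coords by (simp cong: measurable_cong_sets add: measurable_cong_sets[OF assms refl])
  have sp: "space \<mu> = topspace (What W N e)"
    using sets_eq_imp_space_eq[OF assms] by (simp add: space_borel_What)
  have "distr (distr \<mu> borel (coords N e)) borel_What (synth N e) = distr \<mu> borel_What (synth N e \<circ> coords N e)"
    by (rule distr_distr[OF measurable_synth]) measurable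
  also have "\<dots> = distr \<mu> \<mu> (\<lambda>x. x)"
    using assms by (intro distr_cong) (auto simp: sp synth_coords)
  also have "\<dots> = \<mu>" by (rule distr_id)
  finally show ?thesis ..
qed

lemma prob_measuresD:
  assumes "\<mu> \<in> prob_measures W N e"
  shows "prob_space \<mu>" "sets \<mu> = sets borel_What" "space \<mu> = topspace (What W N e)"
    "\<And>P. P \<in> Sym_gr N \<Longrightarrow> integrable \<mu> (\<lambda>x. ev P (coords N e x))"
  using assms unfolding prob_measures_def sets_borel_What
  by (simp_all add: eval_gpoly_fun)

lemma measurable_coords': "sets \<mu> = sets borel_What \<Longrightarrow> coords N e \<in> measurable \<mu> borel"
  using measurable_coords by (simp add: measurable_cong_sets[OF _ refl, of \<mu> borel_What])

text \<open>Since the topology has a countable base, the complement of the support is a null set.\<close>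

lemma AE_support:
  assumes "\<mu> \<in> prob_measures W N e"
  shows "AE x in \<mu>. x \<in> measure_supp (What W N e) \<mu>"
proof -
  interpret prob_space \<mu> by (rule prob_measuresD(1)[OF assms])
  note sets = prob_measuresD(2)[OF assms] and sp = prob_measuresD(3)[OF assms]
  note m = measurable_coords'[OF sets]
  define F where "F = {U :: (nat \<times> nat \<Rightarrow> real) set. open U \<and> emeasure \<mu> (coords N e -` U \<inter> space \<mu>) = 0}"
  obtain F' where F': "F' \<subseteq> F" "countable F'" "\<Union>F' = \<Union>F"
    by (rule Lindelof[of F]) (auto simp: F_def)
  have "coords N e -` U \<inter> space \<mu> \<in> null_sets \<mu>" if "U \<in> F'" for U
    using that F'(1) measurable_sets[OF m, of U] by (auto simp: F_def null_sets_def)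
  then have "(\<Union>U\<in>F'. coords N e -` U \<inter> space \<mu>) \<in> null_sets \<mu>"
    using F'(2) by (intro null_sets_UN') auto
  moreover have "{x \<in> space \<mu>. x \<notin> measure_supp (What W N e) \<mu>} \<subseteq> (\<Union>U\<in>F'. coords N e -` U \<inter> space \<mu>)"
  proof clarify
    fix x assume x: "x \<in> space \<mu>" "x \<notin> measure_supp (What W N e) \<mu>"
    then obtain U where U: "openin (What W N e) U" "x \<in> U" "emeasure \<mu> U = 0"
      by (auto simp: measure_supp_def sp not_gr_zero)
    define S where "S = {y. synth N e y \<in> U}"
    have "openin euclidean {y \<in> topspace euclidean. synth N e y \<in> U}"
      using U(1) by (rule openin_continuous_map_preimage[OF continuous_synth])
    then have "open S" by (simp add: S_def)
    moreover have pre: "coords N e -` S \<inter> space \<mu> = U"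
      using openin_subset[OF U(1)] by (auto simp: S_def sp synth_coords)
    ultimately have "S \<in> F" using U(3) by (simp add: F_def)
    moreover have "coords N e x \<in> S" using U(2) pre by blast
    ultimately obtain S' where "S' \<in> F'" "coords N e x \<in> S'" using F'(3) by blast
    then show "x \<in> (\<Union>U\<in>F'. coords N e -` U \<inter> space \<mu>)" using x(1) by blast
  qed
  ultimately show ?thesis by (rule AE_I')
qed

lemma compact_support_bound:
  assumes \<mu>: "\<mu> \<in> prob_measures W N e" and c: "compactly_supported (What W N e) \<mu>"
  obtains c where "\<And>v. c v > 0" "\<And>v. AE x in \<mu>. \<bar>coords N e x v\<bar> \<le> c v"
proof -
  let ?S = "measure_supp (What W N e) \<mu>"
  have "compactin (What W N e) ?S" using c by (simp add: compactly_supported_def)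
  then have "compactin euclidean (coords N e ` ?S)" by (rule image_compactin[OF _ continuous_coords])
  then have comp: "compact (coords N e ` ?S)" by simp
  have "\<exists>c>0. \<forall>x\<in>?S. \<bar>coords N e x v\<bar> \<le> c" for v
  proof -
    have "continuous_on (coords N e ` ?S) (\<lambda>y. y v)"
      by (rule continuous_on_subset[OF continuous_on_product_coordinates]) simp
    then have "bounded ((\<lambda>y. y v) ` coords N e ` ?S)"
      using comp compact_continuous_image compact_imp_bounded by blast
    then obtain c where "c > 0" "\<forall>z\<in>(\<lambda>y. y v) ` coords N e ` ?S. norm z \<le> c"
      by (auto simp: bounded_pos)
    then show ?thesis by auto
  qed
  then obtain c where c: "\<And>v. c v > 0" "\<And>v x. x \<in> ?S \<Longrightarrow> \<bar>coords N e x v\<bar> \<le> c v" by metis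
  show ?thesis
  proof (rule that[OF c(1)])
    fix v show "AE x in \<mu>. \<bar>coords N e x v\<bar> \<le> c v"
      using AE_support[OF \<mu>] by eventually_elim (rule c(2))
  qed
qed

lemma compactly_supportedI:
  assumes \<mu>: "\<mu> \<in> prob_measures W N e" and AE: "\<And>v. AE x in \<mu>. \<bar>coords N e x v\<bar> \<le> c v"
  shows "compactly_supported (What W N e) \<mu>"
proof -
  let ?X = "What W N e" and ?S = "measure_supp (What W N e) \<mu>"
  note sets = prob_measuresD(2)[OF \<mu>] and sp = prob_measuresD(3)[OF \<mu>]
  let ?box = "PiE UNIV (\<lambda>v. {- c v..c v})"
  have "compactin (product_topology (\<lambda>_. euclideanreal) UNIV) ?box"
    unfolding compactin_PiE by simp
  then have "compactin euclidean ?box" by (simp only: euclidean_product_topology)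
  then have comp: "compactin ?X (synth N e ` ?box)" by (rule image_compactin[OF _ continuous_synth])
  have sub: "?S \<subseteq> synth N e ` ?box"
  proof
    fix x assume x: "x \<in> ?S"
    then have xt: "x \<in> topspace ?X" by (simp add: measure_supp_def)
    have "\<bar>coords N e x v\<bar> \<le> c v" for v
    proof (rule ccontr)
      assume v: "\<not> \<bar>coords N e x v\<bar> \<le> c v"
      let ?U = "{x \<in> topspace ?X. coords N e x \<in> {y. c v < \<bar>y v\<bar>}}"
      have "open {y :: nat \<times> nat \<Rightarrow> real. c v < \<bar>y v\<bar>}"
        by (intro open_Collect_less continuous_intros continuous_on_product_coordinates)
      then have U: "openin ?X ?U" by (intro openin_continuous_map_preimage[OF continuous_coords]) simp
      have "emeasure \<mu> ?U > 0" using x U v xt unfolding measure_supp_def by fastforce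
      moreover have "AE x in \<mu>. x \<notin> ?U" using AE[of v] by eventually_elim auto
      then have "emeasure \<mu> ?U = 0"
        using open_sets[OF U] by (subst (asm) AE_iff_measurable[of ?U]) (auto simp: sets sp)
      ultimately show False by simp
    qed
    then have "coords N e x \<in> ?box" by (auto simp: abs_le_iff minus_le_iff)
    then show "x \<in> synth N e ` ?box" using synth_coords[OF xt] by (metis imageI)
  qed
  have "closedin ?X ?S"
    unfolding closedin_def
  proof (intro conjI)
    show "?S \<subseteq> topspace ?X" by (auto simp: measure_supp_def)
    show "openin ?X (topspace ?X - ?S)"
    proof (subst openin_subopen, intro ballI)
      fix x assume "x \<in> topspace ?X - ?S"
      then obtain U where U: "openin ?X U" "x \<in> U" "emeasure \<mu> U = 0"
        by (auto simp: measure_supp_def not_gr_zero)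
      then have "U \<subseteq> topspace ?X - ?S" using openin_subset[OF U(1)] by (auto simp: measure_supp_def)
      then show "\<exists>T. openin ?X T \<and> x \<in> T \<and> T \<subseteq> topspace ?X - ?S" using U by blast
    qed
  qed
  then show ?thesis unfolding compactly_supported_def by (rule closed_compactin[OF comp sub])
qed

lemma determinateI:
  assumes \<mu>: "\<mu> \<in> prob_measures W N e" and c: "\<And>v. v \<in> var_set N \<Longrightarrow> c v > 0"
    and AE: "\<And>v. v \<in> var_set N \<Longrightarrow> AE x in \<mu>. \<bar>coords N e x v\<bar> \<le> c v"
  shows "determinate W N e \<mu>"
  unfolding determinate_def
proof (intro ballI impI)
  fix \<nu> assume \<nu>: "\<nu> \<in> prob_measures W N e"
    and mom: "\<forall>P\<in>Sym_gr N. integral\<^sup>L \<nu> (eval_gpoly N e P) = integral\<^sup>L \<mu> (eval_gpoly N e P)"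
  note m\<mu> = measurable_coords'[OF prob_measuresD(2)[OF \<mu>]] and m\<nu> = measurable_coords'[OF prob_measuresD(2)[OF \<nu>]]
  have "same_moments N (distr \<mu> borel (coords N e)) (distr \<nu> borel (coords N e)) c"
  proof (rule same_moments.intro)
    show "prob_space (distr \<mu> borel (coords N e))"
      by (rule prob_space.prob_space_distr[OF prob_measuresD(1)[OF \<mu>] m\<mu>])
    show "prob_space (distr \<nu> borel (coords N e))"
      by (rule prob_space.prob_space_distr[OF prob_measuresD(1)[OF \<nu>] m\<nu>])
    show "c v > 0" if "v \<in> var_set N" for v using that by (rule c)
    show "sets (distr \<mu> borel (coords N e)) = sets borel" "sets (distr \<nu> borel (coords N e)) = sets borel"
      by (rule sets_distr)+
  next
    fix P assume P: "P \<in> Sym_gr N"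
    show "integrable (distr \<mu> borel (coords N e)) (ev P)" "integrable (distr \<nu> borel (coords N e)) (ev P)"
      using prob_measuresD(4)[OF \<mu> P] prob_measuresD(4)[OF \<nu> P]
      by (simp_all add: integrable_distr_eq[OF m\<mu>] integrable_distr_eq[OF m\<nu>] measurable_ev)
    show "(\<integral>y. ev P y \<partial>distr \<mu> borel (coords N e)) = (\<integral>y. ev P y \<partial>distr \<nu> borel (coords N e))"
      using mom P by (simp add: integral_distr[OF m\<mu>] integral_distr[OF m\<nu>] measurable_ev eval_gpoly_fun)
  next
    fix v assume "v \<in> var_set N"
    then show "AE y in distr \<mu> borel (coords N e). \<bar>y v\<bar> \<le> c v"
      using AE by (subst AE_distr_iff[OF m\<mu>]) measurable
  next
    fix v assume "v \<notin> var_set N"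
    then have 0: "coords N e x v = 0" for x :: "nat \<Rightarrow> 'v" by (simp add: coords_def)
    have S: "{y \<in> space borel. y v = (0 :: real)} \<in> sets borel" by measurable
    show "AE y in distr \<mu> borel (coords N e). y v = 0"
      by (simp add: AE_distr_iff[OF m\<mu> S] 0)
    show "AE y in distr \<nu> borel (coords N e). y v = 0"
      by (simp add: AE_distr_iff[OF m\<nu> S] 0)
  qed
  then have "distr \<mu> borel (coords N e) = distr \<nu> borel (coords N e)" by (rule same_moments.measures_eq)
  then show "\<nu> = \<mu>"
    using distr_coords_synth[OF prob_measuresD(2)[OF \<mu>]] distr_coords_synth[OF prob_measuresD(2)[OF \<nu>]] by simp
qed

end

section \<open>The equivalence\<close>

text \<open>A vector in the kernel represents a combination of the \<open>q n b\<close> that is orthogonal to all monomials of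
  degree at most \<open>n\<close>, hence to itself.\<close>

lemma (in bounded_orthonormal_basis) monomial_pairing_invertible:
  assumes us: "length us = r n" "set us = monomials N n"
  shows "invertible_mat (Matrix.mat (r n) (r n) (\<lambda>(i, j). L (mon (us ! i) * q n j)))"
proof -
  let ?X = "Matrix.mat (r n) (r n) (\<lambda>(i, j). L (mon (us ! i) * q n j))"
  have X: "?X \<in> carrier_mat (r n) (r n)" by simp
  have "v = 0\<^sub>v (r n)" if v: "v \<in> carrier_vec (r n)" and z: "?X *\<^sub>v v = 0\<^sub>v (r n)" for v
  proof -
    let ?Q = "\<Sum>b<r n. const_gpoly (vec_index v b) * q n b"
    let ?V = "{P \<in> Sym_gr N. L (P * ?Q) = 0}"
    have V: "gp.subspace ?V"
      using lincomb_Sym unfolding gp.subspace_def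
      by (auto simp: Sym_0 Sym_add Sym_scale distrib_right mult.assoc L_add L_scale Sym_mult)
    have "mon \<alpha> \<in> ?V" if \<alpha>: "\<alpha> \<in> monomials N j" "j \<le> n" for \<alpha> j
    proof -
      have P: "mon \<alpha> \<in> Pol N j" using \<alpha>(1) by (auto simp: Pol_def Sym_gr_def monomials_def)
      have "L (mon \<alpha> * ?Q) = 0"
      proof (cases "j = n")
        case True
        then obtain i where i: "i < r n" "\<alpha> = us ! i" using \<alpha> us by (metis in_set_conv_nth)
        have "L (mon \<alpha> * ?Q) = (\<Sum>b<r n. ?X $$ (i, b) * vec_index v b)"
          using i by (subst L_lincomb[OF Pol_Sym[OF P]]) simp
        also have "\<dots> = 0" using z i(1) mult_mat_vec_index[OF X v i(1)] by simp
        finally show ?thesis .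
      next
        case False
        then show ?thesis
          using \<alpha>(2) by (subst L_lincomb[OF Pol_Sym[OF P]]) (simp add: orth_lower_degree[OF P])
      qed
      then show ?thesis using Pol_Sym[OF P] by blast
    qed
    then have "Pol N n \<subseteq> ?V" unfolding Pol_eq_span by (intro gp.span_minimal[OF _ V]) blast
    then have "L (q n a * ?Q) = 0" if "a < r n" for a using q_Pol[OF that] by blast
    then have "vec_index v a = 0" if "a < r n" for a
      using that L_lincomb_q[OF that, of "vec_index v"] by (simp only:)
    then show ?thesis using v by (intro eq_vecI) auto
  qed
  then obtain B where "B \<in> carrier_mat (r n) (r n)" "?X * B = 1\<^sub>m (r n)" "B * ?X = 1\<^sub>m (r n)"
    using invertible_mat_injective[OF X] by blast
  then show ?thesis by (auto simp: invertible_mat_def inverts_mat_def)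
qed

context graded_coordinates
begin

lemma state_of_measure:
  assumes \<mu>: "\<mu> \<in> prob_measures W N e" and supp: "compactly_supported (What W N e) \<mu>"
  obtains c where "bounded_state N (\<lambda>P. integral\<^sup>L \<mu> (eval_gpoly N e P)) c"
proof -
  interpret prob_space \<mu> by (rule prob_measuresD(1)[OF \<mu>])
  obtain c where c: "\<And>v. c v > 0" "\<And>v. AE x in \<mu>. \<bar>coords N e x v\<bar> \<le> c v"
    using compact_support_bound[OF \<mu> supp] by blast
  have int: "integrable \<mu> (\<lambda>x. ev P (coords N e x))" if "P \<in> Sym_gr N" for P
    by (rule prob_measuresD(4)[OF \<mu> that])
  have "bounded_state N (\<lambda>P. integral\<^sup>L \<mu> (eval_gpoly N e P)) c"
  proof
    fix P Q assume P: "P \<in> Sym_gr N" and Q: "Q \<in> Sym_gr N"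
    show "integral\<^sup>L \<mu> (eval_gpoly N e (P + Q)) = integral\<^sup>L \<mu> (eval_gpoly N e P) + integral\<^sup>L \<mu> (eval_gpoly N e Q)"
      using P Q int by (simp add: eval_gpoly_fun Sym_add ev_add)
  next
    fix s P assume P: "P \<in> Sym_gr N"
    show "integral\<^sup>L \<mu> (eval_gpoly N e (const_gpoly s * P)) = s * integral\<^sup>L \<mu> (eval_gpoly N e P)"
      using P by (simp add: eval_gpoly_fun Sym_scale ev_scale)
  next
    fix P assume P: "P \<in> Sym_gr N"
    show "0 \<le> integral\<^sup>L \<mu> (eval_gpoly N e (P * P))"
      using P by (simp add: eval_gpoly_fun Sym_mult ev_mult)
  next
    show "integral\<^sup>L \<mu> (eval_gpoly N e 1) = 1" by (simp add: eval_gpoly_fun Sym_1 prob_space)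
  next
    show "0 < c v" for v by (rule c(1))
  next
    fix m i P assume v: "(m, i) \<in> var_set N" and P: "P \<in> Sym_gr N"
    have PP: "P * P \<in> Sym_gr N" and wP: "w_var m i * P \<in> Sym_gr N" and wPwP: "(w_var m i * P) * (w_var m i * P) \<in> Sym_gr N"
      using v P by (auto intro!: Sym_mult Sym_w_var)
    have ev1: "ev ((w_var m i * P) * (w_var m i * P)) y = (y (m, i))\<^sup>2 * ev (P * P) y" for y
      by (simp only: ev_mult[OF wP] ev_mult[OF P] ev_w_var_mult) (simp add: power2_eq_square)
    have "(\<integral>x. ev ((w_var m i * P) * (w_var m i * P)) (coords N e x) \<partial>\<mu>)
      \<le> (\<integral>x. (c (m, i))\<^sup>2 * ev (P * P) (coords N e x) \<partial>\<mu>)"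
    proof (rule integral_mono_AE)
      show "integrable \<mu> (\<lambda>x. ev ((w_var m i * P) * (w_var m i * P)) (coords N e x))" by (rule int[OF wPwP])
      show "integrable \<mu> (\<lambda>x. (c (m, i))\<^sup>2 * ev (P * P) (coords N e x))" using int[OF PP] by simp
      show "AE x in \<mu>. ev ((w_var m i * P) * (w_var m i * P)) (coords N e x) \<le> (c (m, i))\<^sup>2 * ev (P * P) (coords N e x)"
        using c(2)[of "(m, i)"]
      proof eventually_elim
        case (elim x)
        have "(coords N e x (m, i))\<^sup>2 \<le> (c (m, i))\<^sup>2" using elim c(1)[of "(m, i)"] by (intro abs_le_square_iff[THEN iffD1]) simp
        then show ?case unfolding ev1 by (intro mult_right_mono) (simp_all add: ev_mult[OF P])
      qed
    qed
    then show "integral\<^sup>L \<mu> (eval_gpoly N e ((w_var m i * P) * (w_var m i * P))) \<le> (c (m, i))\<^sup>2 * integral\<^sup>L \<mu> (eval_gpoly N e (P * P))"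
      by (simp only: eval_gpoly_fun[OF wPwP] eval_gpoly_fun[OF PP] integral_mult_right_zero)
  qed
  then show ?thesis by (rule that)
qed

text \<open>Every bounded positive functional is integration against a determinate measure of compact support.\<close>

lemma measure_of_state:
  assumes "bounded_state N L c"
  obtains \<mu> where "\<mu> \<in> prob_measures W N e" "determinate W N e \<mu>" "compactly_supported (What W N e) \<mu>"
    "\<And>P. P \<in> Sym_gr N \<Longrightarrow> integral\<^sup>L \<mu> (eval_gpoly N e P) = L P"
proof -
  interpret bounded_state N L c by fact
  obtain \<nu> where \<nu>: "real_distribution \<nu>" and mom: "\<And>P. P \<in> Sym_gr N \<Longrightarrow> (\<integral>t. ev P (point t) \<partial>\<nu>) = L P"
    using representing_measure by blast
  interpret \<nu>: real_distribution \<nu> by (rule \<nu>)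
  have "continuous_on UNIV point"
  proof (rule continuous_on_coordinatewise_then_product)
    fix v show "continuous_on UNIV (\<lambda>t. point t v)"
      unfolding point_def by (cases "v \<in> var_set N") (auto intro!: continuous_intros continuous_curve)
  qed
  then have "point \<in> measurable \<nu> borel"
    using borel_measurable_continuous_onI by (simp add: measurable_cong_sets[OF \<nu>.events_eq_borel refl])
  then have m: "synth N e \<circ> point \<in> measurable \<nu> borel_What"
    by (rule measurable_comp[OF _ measurable_synth])
  define \<mu> where "\<mu> = distr \<nu> borel_What (synth N e \<circ> point)"
  have point: "coords N e ((synth N e \<circ> point) t) = point t" for t
    by (rule ext) (simp add: coords_synth point_def)
  have ev_m: "(\<lambda>x. ev P (coords N e x)) \<in> borel_measurable borel_What" for P
    by (rule measurable_compose[OF measurable_coords measurable_ev])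
  have \<mu>: "\<mu> \<in> prob_measures W N e"
    unfolding prob_measures_def
  proof (intro CollectI conjI ballI)
    show "prob_space \<mu>" unfolding \<mu>_def by (rule \<nu>.prob_space_distr[OF m])
    show "space \<mu> = topspace (What W N e)" by (simp add: \<mu>_def space_borel_What)
    show "sets \<mu> = sigma_sets (topspace (What W N e)) {U. openin (What W N e) U}"
      by (simp add: \<mu>_def sets_borel_What)
    fix P assume P: "P \<in> Sym_gr N"
    show "integrable \<mu> (eval_gpoly N e P)"
      unfolding eval_gpoly_fun[OF P] \<mu>_def integrable_distr_eq[OF m ev_m] point
      by (rule integrable_ev_point[OF P \<nu>])
  qed
  have box: "AE x in \<mu>. \<bar>coords N e x v\<bar> \<le> (if v \<in> var_set N then c v else 0)" for v
  proof -
    have "(\<lambda>x. coords N e x v) \<in> borel_measurable borel_What"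
      by (rule measurable_compose[OF measurable_coords measurable_coordinate])
    then have S: "{x \<in> space borel_What. \<bar>coords N e x v\<bar> \<le> (if v \<in> var_set N then c v else 0)} \<in> sets borel_What"
      by measurable
    have "\<bar>point t v\<bar> \<le> (if v \<in> var_set N then c v else 0)" for t
      using point_bound[of v t] by (simp add: point_def)
    then show ?thesis unfolding \<mu>_def AE_distr_iff[OF m S] point by simp
  qed
  have "determinate W N e \<mu>"
  proof (rule determinateI[OF \<mu> c_pos])
    fix v assume "v \<in> var_set N"
    then show "AE x in \<mu>. \<bar>coords N e x v\<bar> \<le> c v" using box[of v] by simp
  qed
  moreover have "compactly_supported (What W N e) \<mu>" by (rule compactly_supportedI[OF \<mu> box])
  moreover have "integral\<^sup>L \<mu> (eval_gpoly N e P) = L P" if P: "P \<in> Sym_gr N" for P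
    unfolding eval_gpoly_fun[OF P] \<mu>_def integral_distr[OF m ev_m] point by (rule mom[OF P])
  ultimately show ?thesis using that \<mu> by blast
qed

end

lemma w_vec_index: "i < length (ws n) \<Longrightarrow> vec_index (w_vec ws n) i = mon (ws n ! i)"
  by (simp add: w_vec_def vec_of_list_index)

lemma dim_w_vec: "dim_vec (w_vec ws n) = length (ws n)"
  by (simp add: w_vec_def)

theorem theorem3p15:
  fixes W :: "nat \<Rightarrow> 'v::real_vector set"
    and N :: "nat \<Rightarrow> nat"
    and e :: "nat \<Rightarrow> nat \<Rightarrow> 'v"
    and ws :: "nat \<Rightarrow> monomial list"
    and p :: "nat \<Rightarrow> gpoly Matrix.vec"
    and r :: "nat \<Rightarrow> nat"
  assumes "graded_space W"
    and "graded_basis W N e"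
    and "monomial_enum N ws"
    and r: "\<And>n. r n = num_monomials N n"
    and "\<And>n. p n \<in> carrier_vec (r n) \<and> set\<^sub>v (p n) \<subseteq> Sym_gr N"
    and "p 0 = Matrix.vec 1 (\<lambda>_. 1)"
  shows "(\<exists>\<mu>\<in>prob_measures W N e.
            determinate W N e \<mu> \<and> compactly_supported (What W N e) \<mu> \<and>
            orthonormal_seq N e ws \<mu> p)
     \<longleftrightarrow>
         (\<exists>M :: nat \<Rightarrow> nat \<Rightarrow> nat \<Rightarrow> nat \<Rightarrow> real Matrix.mat.
            (\<forall>n. \<forall>m\<in>{1..n}. \<forall>i\<in>{1..N m}. \<forall>k\<in>{0..m}.
               M k n m i \<in> carrier_mat (r (n - m)) (r (n - m + k))) \<and>
            (\<forall>n. \<forall>m\<in>{1..n}. \<forall>i\<in>{1..N m}.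
               w_var m i \<cdot>\<^sub>v p (n - m) =
                 finsum_vec TYPE(gpoly) (r (n - m))
                   (\<lambda>k. mat_gpoly_mult (M k n m i) (p (n - m + k))) {0..m}
               + finsum_vec TYPE(gpoly) (r (n - m))
                   (\<lambda>k. mat_gpoly_mult (transpose_mat (M k (n - k) m i)) (p (n - m - k)))
                   {k \<in> {1..m}. m + k \<le> n}) \<and>
            (let A = (\<lambda>n m i. M m n m i); C = (\<lambda>n m i. transpose_mat (A n m i)) in
               \<forall>n\<ge>1.
                 (\<forall>m\<in>{1..n}. \<forall>i\<in>{1..N m}.
                    mat_rank (A n m i) = r (n - m) \<and> mat_rank (C n m i) = r (n - m)) \<and>
                 mat_rank (stack_blocks N n (r n) (A n)) = r n \<and>
                 mat_rank (stack_blocks N n (r n) (\<lambda>m i. transpose_mat (C n m i))) = r n) \<and>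
            (\<forall>m\<ge>1. \<forall>i\<in>{1..N m}. \<forall>k\<in>{- int m..int m}.
               bdd_above ((\<lambda>n. spectral_norm (ext_coeff M k n m i)) ` {n. m + nat (- k) \<le> n})))"
    (is "?measure \<longleftrightarrow> ?recurrence")
proof -
  interpret graded_coordinates W N e by unfold_locales fact
  have ws: "distinct (ws n)" "set (ws n) = monomials N n" for n
    using assms(3) by (simp_all add: monomial_enum_def)
  have fin: "finite (monomials N n)" for n by (simp flip: ws(2))
  have len: "length (ws n) = r n" for n using ws[of n] by (simp add: r num_monomials_def distinct_card[symmetric])
  have p: "p n \<in> carrier_vec (r n)" for n using assms(5) by blast
  define q where "q = (\<lambda>n a. vec_index (p n) a)"
  have q_mem: "q n a \<in> set\<^sub>v (p n)" if "a < r n" for n a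
    using that p[of n] by (auto simp: q_def intro!: vec_setI)
  have q_Sym: "q n a \<in> Sym_gr N" if "a < r n" for n a using q_mem[OF that] assms(5) by blast
  have recurrence: "?recurrence \<longleftrightarrow> (\<exists>M. jacobi_dims N r M \<and> jacobi_recurrence N r p M \<and> jacobi_rank N r M \<and> jacobi_bounded N M)"
    unfolding jacobi_dims_def jacobi_recurrence_def jacobi_rank_def jacobi_bounded_def ..
  have pairing: "pairing_mat N e \<mu> (p n) (p n) $$ (a, b) = integral\<^sup>L \<mu> (eval_gpoly N e (q n a * q n b))"
    if "a < r n" "b < r n" for \<mu> n a b
    using that p[of n] by (simp add: pairing_mat_def q_def)
  have pairing_w: "pairing_mat N e \<mu> (w_vec ws m) (p n) = Matrix.mat (r m) (r n) (\<lambda>(i, j). integral\<^sup>L \<mu> (eval_gpoly N e (mon (ws m ! i) * q n j)))"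
    for \<mu> m n
    using p[of n] by (intro eq_matI) (auto simp: pairing_mat_def q_def dim_w_vec len w_vec_index)
  have forward: "?recurrence" if ?measure
  proof -
    from that obtain \<mu> where \<mu>: "\<mu> \<in> prob_measures W N e" "compactly_supported (What W N e) \<mu>"
      and orth: "orthonormal_seq N e ws \<mu> p" by blast
    define L where "L = (\<lambda>P. integral\<^sup>L \<mu> (eval_gpoly N e P))"
    obtain c where "bounded_state N L c" using state_of_measure[OF \<mu>] unfolding L_def by blast
    then interpret bounded_state N L c .
    have "orthonormal_basis N L r q"
    proof (rule orthonormal_basisI[OF fin r])
      fix n a assume a: "a < r n"
      show "q n a \<in> Pol N n"
        using orth q_mem[OF a] q_Sym[OF a] unfolding orthonormal_seq_def Pol_def by blast
      fix b assume b: "b < r n"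
      have "pairing_mat N e \<mu> (p n) (p n) = 1\<^sub>m (r n)" using orth by (simp add: orthonormal_seq_def r)
      then show "L (q n a * q n b) = (if a = b then 1 else 0)"
        using pairing[OF a b, of \<mu>] a b by (simp add: L_def)
    next
      fix n j \<alpha> a assume j: "j < n" and \<alpha>: "\<alpha> \<in> monomials N j" and a: "a < r n"
      obtain i where i: "i < r j" "\<alpha> = ws j ! i" using \<alpha> ws(2)[of j] len[of j] by (metis in_set_conv_nth)
      have "pairing_mat N e \<mu> (w_vec ws j) (p n) = 0\<^sub>m (r j) (r n)"
        using orth j by (simp add: orthonormal_seq_def r)
      then have "pairing_mat N e \<mu> (w_vec ws j) (p n) $$ (i, a) = 0" using i a by simp
      then show "L (mon \<alpha> * q n a) = 0" using i a by (simp add: pairing_w L_def)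
    qed
    then interpret orthonormal_basis N L r q .
    interpret bounded_orthonormal_basis N L r q c by unfold_locales (auto simp: fin r)
    obtain M where "jacobi_dims N r M" "jacobi_recurrence N r p M" "jacobi_rank N r M" "jacobi_bounded N M"
      using jacobi_of_bounded[OF p] unfolding q_def by blast
    then show ?recurrence unfolding recurrence by blast
  qed
  have backward: "?measure" if ?recurrence
  proof -
    from that obtain M where dims: "jacobi_dims N r M" and rec: "jacobi_recurrence N r p M" and bdd: "jacobi_bounded N M"
      unfolding recurrence by blast
    interpret J: jacobi_family N r q M
    proof
      show "q 0 0 = 1" using assms(6) by (simp add: q_def)
      show "w_var m i * q l c = (\<Sum>j\<le>l + m. \<Sum>b<r j. const_gpoly (jac_entry M m i l c j b) * q j b)"
        if "1 \<le> m" "i \<in> {1..N m}" "c < r l" for m i l c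
        using jac_entry_expansion[OF dims p rec that] by (simp only: q_def)
    qed (rule fin r dims bdd)+
    obtain c where "bounded_orthonormal_basis N J.L r q c" by (rule J.bounded_basis)
    then interpret B: bounded_orthonormal_basis N J.L r q c .
    obtain \<mu> where \<mu>: "\<mu> \<in> prob_measures W N e" "determinate W N e \<mu>" "compactly_supported (What W N e) \<mu>"
      and L: "\<And>P. P \<in> Sym_gr N \<Longrightarrow> integral\<^sup>L \<mu> (eval_gpoly N e P) = J.L P"
      using measure_of_state[OF B.bounded_state_axioms] by blast
    have mon_Pol: "mon (ws m ! i) \<in> Pol N m" if "i < r m" for m i
      using that ws(2)[of m] len[of m] nth_mem[of i "ws m"] by (auto simp: Pol_def Sym_gr_def monomials_def)
    have Lw: "integral\<^sup>L \<mu> (eval_gpoly N e (mon (ws m ! i) * q n j)) = J.L (mon (ws m ! i) * q n j)"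
      if "i < r m" "j < r n" for m n i j
      using that by (intro L Sym_mult Pol_Sym[OF mon_Pol] q_Sym)
    have "orthonormal_seq N e ws \<mu> p"
      unfolding orthonormal_seq_def
    proof (intro allI conjI impI ballI)
      fix n P \<alpha> assume P: "P \<in> set\<^sub>v (p n)" and \<alpha>: "\<alpha> \<in> Poly_Mapping.keys P"
      then obtain a where "a < r n" "P = q n a" using p[of n] by (auto simp: vec_set_def q_def)
      then show "mono_degree \<alpha> \<le> n" using J.q_Pol[of a n] \<alpha> by (auto simp: Pol_def)
    next
      fix n m :: nat assume m: "m < n"
      show "pairing_mat N e \<mu> (w_vec ws m) (p n) = 0\<^sub>m (num_monomials N m) (num_monomials N n)"
        unfolding pairing_w r[symmetric]
        by (rule eq_matI) (auto simp: Lw J.orth_lower_degree[OF mon_Pol m])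
    next
      fix n
      have "pairing_mat N e \<mu> (w_vec ws n) (p n) = Matrix.mat (r n) (r n) (\<lambda>(i, j). J.L (mon (ws n ! i) * q n j))"
        unfolding pairing_w by (rule eq_matI) (auto simp: Lw)
      then show "invertible_mat (pairing_mat N e \<mu> (w_vec ws n) (p n))"
        using B.monomial_pairing_invertible[OF len ws(2)] by simp
      show "pairing_mat N e \<mu> (p n) (p n) = 1\<^sub>m (num_monomials N n)"
        unfolding r[symmetric]
      proof (rule eq_matI)
        fix a b assume "a < dim_row (1\<^sub>m (r n) :: real Matrix.mat)" "b < dim_col (1\<^sub>m (r n) :: real Matrix.mat)"
        then have ab: "a < r n" "b < r n" by simp_all
        show "pairing_mat N e \<mu> (p n) (p n) $$ (a, b) = 1\<^sub>m (r n) $$ (a, b)"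
          unfolding pairing[OF ab] L[OF Sym_mult[OF q_Sym q_Sym, OF ab]] using ab by (simp add: J.q_orth)
      qed (use p[of n] in \<open>simp_all add: pairing_mat_def\<close>)
    qed
    then show ?measure using \<mu> by blast
  qed
  show ?thesis by (rule iffI) (fact forward, fact backward)
qed

end
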